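(* Let $M$ be a finite regular left duo monoid with left regular band of idempotents $B$ and $K$ a field whose characteristic does not divide the order of any maximal subgroup of $M$. Let $X\in\Lambda(B)$ and let $V$ be a simple $KG_X$-module, where $G_X$ is a maximal subgroup of the $\mathscr L$-class $\sigma^{-1}(X)$. Then $C_\bullet(\Delta(B_{\geq X}),V)\to V$ is a projective resolution of $V$ over $KM$, where $M_{\geq X}$ acts simplicially on $\Delta(B_{\geq X})$ via $(m,b)\mapsto mbm^\dagger$ on vertices, and $C_q(\Delta(B_{\geq X}),V)$ is viewed as the tensor product $C_q(\Delta(B_{\geq X}),K)\otimes_K V$ of $KM_{\geq X}$-modules, which is then inflated to a $KM$-module via $\rho_X$.
   Context: Modules are left modules. A monoid $M$ is regular if for each $m\in M$ there is $a\in M$ with $mam=m$; it is left duo if $mM\subseteq Mm$ for all $m\in M$. For finite regular left duo $M$, the set $B=E(M)$ of idempotents is a submonoid which is a left regular band ($xyx=xy$), partially ordered by $e\leq f$ iff $fe=e$. $\Lambda(B)=\{Be\mid e\in B\}$, ordered by inclusion. For $m\in M$, $m^\omega$ is the unique idempotent positive power of $m$; $m$ lies in the group of units $G_{m^\omega}$ of $m^\omega Mm^\omega$, and $m^\dagger$ is its inverse in that group. The map $\sigma\colon M\to\Lambda(B)$, $\sigma(m)=Bm^\omega$, is a homomorphism to $\Lambda(B)$ under meet (intersection). $B_{\geq X}=\{b\in B\mid Bb\supseteq X\}$ and $M_{\geq X}=\{m\in M\mid\sigma(m)\geq X\}$, a submonoid. The maximal subgroups of $M$ are the groups $G_e$ of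 units of $eMe$ ($e\in B$); $\sigma^{-1}(X)$ is an $\mathscr L$-class of $M$ (where $a\mathrel{\mathscr L}b$ iff $Ma=Mb$), and $G_X=G_{e}$ for some idempotent $e=e_X$ with $Be_X=X$. $V$ is a $KM_{\geq X}$-module via $m\mapsto e_Xm\in G_X$. The homomorphism $\rho_X\colon KM\to KM_{\geq X}$ is given on $m\in M$ by $\rho_X(m)=m$ if $\sigma(m)\geq X$ and $\rho_X(m)=0$ otherwise; $V$ is a simple $KM$-module by inflation along $\rho_X$. $\Delta(P)$ is the order complex of a poset $P$; $C_\bullet(\Delta(P),K)$ is its simplicial chain complex, with basis in degree $q$ the chains $b_0<\cdots<b_q$. An element $m\in M_{\ge X}$ sends the chain $b_0<\cdots<b_q$ in $B_{\geq X}$ to $mb_0m^\dagger\le\cdots\le mb_qm^\dagger$ if these elements are distinct, and to $0$ otherwise. The tensor product of $KM_{\geq X}$-modules has the diagonal action $m(c\otimes v)=mc\otimes mv$. The map to $V$ is induced by the augmentation $C_0(\Delta(B_{\geq X}),K)\to K$ sending each vertex to $1$. *)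

theory Defs
  imports "HOL-Algebra.Coset" "HOL-Algebra.Module"
begin

section \<open>Left modules over rings that need not be commutative\<close>

text \<open>The library locale \<open>module\<close> requires a commutative ring of scalars. The record type
  and the locale \<open>submodule\<close> are those of the library; the ring multiplication and unit that the
  record carries play no role for modules.\<close>

locale left_module = R?: ring R + M?: abelian_group M
  for R :: "('r, 'w) ring_scheme" (structure) and M :: "('r, 'v, 'z) module_scheme" (structure) +
  assumes smult_closed [simp, intro]:
      "\<lbrakk>a \<in> carrier R; x \<in> carrier M\<rbrakk> \<Longrightarrow> a \<odot>\<^bsub>M\<^esub> x \<in> carrier M"
    and smult_l_distr:
      "\<lbrakk>a \<in> carrier R; b \<in> carrier R; x \<in> carrier M\<rbrakk> \<Longrightarrow>
        (a \<oplus>\<^bsub>R\<^esub> b) \<odot>\<^bsub>M\<^esub> x = a \<odot>\<^bsub>M\<^esub> x \<oplus>\<^bsub>M\<^esub> b \<odot>\<^bsub>M\<^esub> x"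
    and smult_r_distr:
      "\<lbrakk>a \<in> carrier R; x \<in> carrier M; y \<in> carrier M\<rbrakk> \<Longrightarrow>
        a \<odot>\<^bsub>M\<^esub> (x \<oplus>\<^bsub>M\<^esub> y) = a \<odot>\<^bsub>M\<^esub> x \<oplus>\<^bsub>M\<^esub> a \<odot>\<^bsub>M\<^esub> y"
    and smult_assoc1:
      "\<lbrakk>a \<in> carrier R; b \<in> carrier R; x \<in> carrier M\<rbrakk> \<Longrightarrow>
        (a \<otimes>\<^bsub>R\<^esub> b) \<odot>\<^bsub>M\<^esub> x = a \<odot>\<^bsub>M\<^esub> (b \<odot>\<^bsub>M\<^esub> x)"
    and smult_one [simp]:
      "x \<in> carrier M \<Longrightarrow> \<one>\<^bsub>R\<^esub> \<odot>\<^bsub>M\<^esub> x = x"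

definition simple_module :: "('r, 'w) ring_scheme \<Rightarrow> ('r, 'v, 'z) module_scheme \<Rightarrow> bool" where
  "simple_module R V \<longleftrightarrow> left_module R V \<and> carrier V \<noteq> {\<zero>\<^bsub>V\<^esub>} \<and>
     (\<forall>W. submodule W R V \<longrightarrow> W = {\<zero>\<^bsub>V\<^esub>} \<or> W = carrier V)"

definition lmod_hom ::
  "('r, 'w) ring_scheme \<Rightarrow> ('r, 'a, 'y) module_scheme \<Rightarrow> ('r, 'b, 'z) module_scheme \<Rightarrow> ('a \<Rightarrow> 'b) set"
where
  "lmod_hom R A B = {h \<in> hom (add_monoid A) (add_monoid B).
     \<forall>r \<in> carrier R. \<forall>a \<in> carrier A. h (r \<odot>\<^bsub>A\<^esub> a) = r \<odot>\<^bsub>B\<^esub> h a}"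

text \<open>Projectivity is the lifting property against epimorphisms. A formula cannot quantify over
  types, so the types of the elements of the test modules are parameters; a statement in
  which these are type variables asserts the lifting property against all modules.\<close>

definition projective_module ::
  "'a itself \<Rightarrow> 'b itself \<Rightarrow> ('r, 'w) ring_scheme \<Rightarrow> ('r, 'p, 'z) module_scheme \<Rightarrow> bool"
where
  "projective_module (_ :: 'a itself) (_ :: 'b itself) R P \<longleftrightarrow> left_module R P \<and>
     (\<forall>(A :: ('r, 'a) module) (B :: ('r, 'b) module) f g.
        left_module R A \<and> left_module R B \<and>
        f \<in> lmod_hom R A B \<and> f ` carrier A = carrier B \<and> g \<in> lmod_hom R P B \<longrightarrow>
        (\<exists>h \<in> lmod_hom R P A. \<forall>p \<in> carrier P. f (h p) = g p))"

text \<open>\<open>\<dots> \<rightarrow> P 1 \<rightarrow> P 0 \<rightarrow> V \<rightarrow> 0\<close> with differentials \<open>d q : P (q + 1) \<rightarrow> P q\<close> and augmentation \<open>\<epsilon>\<close>.\<close>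

definition projective_resolution ::
  "'a itself \<Rightarrow> 'b itself \<Rightarrow> ('r, 'w) ring_scheme \<Rightarrow> (nat \<Rightarrow> ('r, 'p, 'y) module_scheme) \<Rightarrow>
   (nat \<Rightarrow> 'p \<Rightarrow> 'p) \<Rightarrow> ('p \<Rightarrow> 'v) \<Rightarrow> ('r, 'v, 'z) module_scheme \<Rightarrow> bool"
where
  "projective_resolution (TA :: 'a itself) (TB :: 'b itself) R P d \<epsilon> V \<longleftrightarrow>
     left_module R V \<and>
     (\<forall>q. projective_module TA TB R (P q)) \<and>
     (\<forall>q. d q \<in> lmod_hom R (P (Suc q)) (P q)) \<and>
     \<epsilon> \<in> lmod_hom R (P 0) V \<and>
     (\<forall>q. d (Suc q) ` carrier (P (Suc (Suc q))) = {x \<in> carrier (P (Suc q)). d q x = \<zero>\<^bsub>P q\<^esub>}) \<and>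
     d 0 ` carrier (P 1) = {x \<in> carrier (P 0). \<epsilon> x = \<zero>\<^bsub>V\<^esub>} \<and>
     \<epsilon> ` carrier (P 0) = carrier V"

text \<open>Restriction of scalars along a map \<open>h\<close> of rings.\<close>

definition inflate :: "('r \<Rightarrow> 's) \<Rightarrow> ('s, 'v) module \<Rightarrow> ('r, 'v) module" where
  "inflate h V = \<lparr>carrier = carrier V, mult = mult V, one = one V, zero = zero V, add = add V,
     smult = (\<lambda>r v. h r \<odot>\<^bsub>V\<^esub> v)\<rparr>"


section \<open>Monoid algebras\<close>

definition ring_char :: "('k, 'y) ring_scheme \<Rightarrow> nat" where
  "ring_char K = (if \<exists>n > (0 :: nat). [n] \<cdot>\<^bsub>K\<^esub> \<one>\<^bsub>K\<^esub> = \<zero>\<^bsub>K\<^esub>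
     then (LEAST n :: nat. n > 0 \<and> [n] \<cdot>\<^bsub>K\<^esub> \<one>\<^bsub>K\<^esub> = \<zero>\<^bsub>K\<^esub>) else 0)"

text \<open>The element \<open>k s\<close> of a free \<open>K\<close>-module, for a basis element \<open>s\<close> and a scalar \<open>k\<close>.\<close>

definition single :: "('k, 'y) ring_scheme \<Rightarrow> 's \<Rightarrow> 'k \<Rightarrow> 's \<Rightarrow> 'k" where
  "single K s k = (\<lambda>t. if t = s then k else \<zero>\<^bsub>K\<^esub>)"

abbreviation basis :: "('k, 'y) ring_scheme \<Rightarrow> 's \<Rightarrow> 's \<Rightarrow> 'k" where
  "basis K s \<equiv> single K s \<one>\<^bsub>K\<^esub>"

definition monoid_algebra :: "('k, 'y) ring_scheme \<Rightarrow> ('m, 'x) monoid_scheme \<Rightarrow> ('m \<Rightarrow> 'k) ring" where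
  "monoid_algebra K N =
     \<lparr>carrier = {\<alpha>. (\<forall>m. \<alpha> m \<in> carrier K) \<and>
                    finite {m. \<alpha> m \<noteq> \<zero>\<^bsub>K\<^esub>} \<and> {m. \<alpha> m \<noteq> \<zero>\<^bsub>K\<^esub>} \<subseteq> carrier N},
      mult = (\<lambda>\<alpha> \<beta> x. \<Oplus>\<^bsub>K\<^esub>p\<in>{(y, z). \<alpha> y \<noteq> \<zero>\<^bsub>K\<^esub> \<and> \<beta> z \<noteq> \<zero>\<^bsub>K\<^esub> \<and> y \<otimes>\<^bsub>N\<^esub> z = x}.
                \<alpha> (fst p) \<otimes>\<^bsub>K\<^esub> \<beta> (snd p)),
      one = basis K \<one>\<^bsub>N\<^esub>,
      zero = (\<lambda>_. \<zero>\<^bsub>K\<^esub>),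
      add = (\<lambda>\<alpha> \<beta> x. \<alpha> x \<oplus>\<^bsub>K\<^esub> \<beta> x)\<rparr>"

text \<open>For finite \<open>N\<close>, the linear extension \<open>KN \<rightarrow> KH\<close> of \<open>\<phi> : N \<rightarrow> H\<close>.\<close>

definition algebra_map ::
  "('k, 'y) ring_scheme \<Rightarrow> ('m, 'x) monoid_scheme \<Rightarrow> ('m \<Rightarrow> 'h) \<Rightarrow> ('m \<Rightarrow> 'k) \<Rightarrow> 'h \<Rightarrow> 'k"
where
  "algebra_map K N \<phi> \<alpha> = (\<lambda>g. \<Oplus>\<^bsub>K\<^esub>m\<in>{m \<in> carrier N. \<phi> m = g}. \<alpha> m)"


section \<open>Regular left duo monoids\<close>

definition regular_monoid :: "('m, 'x) monoid_scheme \<Rightarrow> bool" where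
  "regular_monoid M \<longleftrightarrow> (\<forall>m \<in> carrier M. \<exists>a \<in> carrier M. m \<otimes>\<^bsub>M\<^esub> a \<otimes>\<^bsub>M\<^esub> m = m)"

definition left_duo :: "('m, 'x) monoid_scheme \<Rightarrow> bool" where
  "left_duo M \<longleftrightarrow> (\<forall>m \<in> carrier M. m <#\<^bsub>M\<^esub> carrier M \<subseteq> carrier M #>\<^bsub>M\<^esub> m)"

definition idems :: "('m, 'x) monoid_scheme \<Rightarrow> 'm set" where
  "idems M = {e \<in> carrier M. e \<otimes>\<^bsub>M\<^esub> e = e}"

definition idem_le :: "('m, 'x) monoid_scheme \<Rightarrow> 'm \<Rightarrow> 'm \<Rightarrow> bool" where
  "idem_le M e f \<longleftrightarrow> f \<otimes>\<^bsub>M\<^esub> e = e"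

definition support_lattice :: "('m, 'x) monoid_scheme \<Rightarrow> 'm set set" where
  "support_lattice M = {idems M #>\<^bsub>M\<^esub> e | e. e \<in> idems M}"

definition omega :: "('m, 'x) monoid_scheme \<Rightarrow> 'm \<Rightarrow> 'm" where
  "omega M m = (THE e. e \<in> idems M \<and> (\<exists>n > 0. e = m [^]\<^bsub>M\<^esub> (n :: nat)))"

text \<open>The local monoid \<open>e M e\<close> and its group of units \<open>G\<^sub>e\<close>.\<close>

definition local_monoid :: "('m, 'x) monoid_scheme \<Rightarrow> 'm \<Rightarrow> 'm monoid" where
  "local_monoid M e =
     \<lparr>carrier = {e \<otimes>\<^bsub>M\<^esub> m \<otimes>\<^bsub>M\<^esub> e | m. m \<in> carrier M}, mult = mult M, one = e\<rparr>"

definition max_subgroup :: "('m, 'x) monoid_scheme \<Rightarrow> 'm \<Rightarrow> 'm monoid" where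
  "max_subgroup M e = units_of (local_monoid M e)"

definition dagger :: "('m, 'x) monoid_scheme \<Rightarrow> 'm \<Rightarrow> 'm" where
  "dagger M m = inv\<^bsub>max_subgroup M (omega M m)\<^esub> m"

definition sigma :: "('m, 'x) monoid_scheme \<Rightarrow> 'm \<Rightarrow> 'm set" where
  "sigma M m = idems M #>\<^bsub>M\<^esub> omega M m"

text \<open>\<open>B\<^bsub>\<ge>X\<^esub>\<close> and \<open>M\<^bsub>\<ge>X\<^esub>\<close>.\<close>

definition idems_ge :: "('m, 'x) monoid_scheme \<Rightarrow> 'm set \<Rightarrow> 'm set" where
  "idems_ge M X = {b \<in> idems M. X \<subseteq> idems M #>\<^bsub>M\<^esub> b}"

definition monoid_ge :: "('m, 'x) monoid_scheme \<Rightarrow> 'm set \<Rightarrow> 'm monoid" where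
  "monoid_ge M X = \<lparr>carrier = {m \<in> carrier M. X \<subseteq> sigma M m}, mult = mult M, one = one M\<rparr>"

definition rho ::
  "('k, 'y) ring_scheme \<Rightarrow> ('m, 'x) monoid_scheme \<Rightarrow> 'm set \<Rightarrow> ('m \<Rightarrow> 'k) \<Rightarrow> 'm \<Rightarrow> 'k"
where
  "rho K M X \<alpha> = (\<lambda>m. if m \<in> carrier (monoid_ge M X) then \<alpha> m else \<zero>\<^bsub>K\<^esub>)"

text \<open>A \<open>KG\<^sub>e\<close>-module as a \<open>KM\<^bsub>\<ge>X\<^esub>\<close>-module via \<open>m \<mapsto> e m\<close>, where \<open>X = Be\<close>.
  The maximal subgroups of the \<open>L\<close>-class of elements \<open>m\<close> with \<open>sigma M m = X\<close> are the
  \<open>G\<^sub>e\<close> with \<open>X = Be\<close>.\<close>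

definition module_ge ::
  "('k, 'y) ring_scheme \<Rightarrow> ('m, 'x) monoid_scheme \<Rightarrow> 'm set \<Rightarrow> 'm \<Rightarrow>
   ('m \<Rightarrow> 'k, 'v) module \<Rightarrow> ('m \<Rightarrow> 'k, 'v) module"
where
  "module_ge K M X e V = inflate (algebra_map K (monoid_ge M X) (\<lambda>m. e \<otimes>\<^bsub>M\<^esub> m)) V"


section \<open>Tensor products with a free module\<close>

text \<open>Functions \<open>S \<rightarrow> A\<close>, extended by zero. For finite \<open>S\<close> and \<open>A = K\<close> this is the free
  \<open>K\<close>-module with basis \<open>S\<close>.\<close>

definition fun_carrier :: "'s set \<Rightarrow> ('a, 'z) ring_scheme \<Rightarrow> ('s \<Rightarrow> 'a) set" where
  "fun_carrier S A = {f. (\<forall>s. f s \<in> carrier A) \<and> {s. f s \<noteq> \<zero>\<^bsub>A\<^esub>} \<subseteq> S}"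

text \<open>The \<open>KN\<close>-module with finite \<open>K\<close>-basis \<open>S\<close> on which \<open>m \<in> N\<close> sends \<open>s \<in> S\<close> to \<open>t\<close> if
  \<open>act m s = Some t\<close> and to \<open>0\<close> if \<open>act m s = None\<close>.\<close>

definition basis_module ::
  "('k, 'y) ring_scheme \<Rightarrow> ('m, 'x) monoid_scheme \<Rightarrow> 's set \<Rightarrow> ('m \<Rightarrow> 's \<Rightarrow> 's option) \<Rightarrow>
   ('m \<Rightarrow> 'k, 's \<Rightarrow> 'k) module"
where
  "basis_module K N S act =
     \<lparr>carrier = fun_carrier S K, mult = undefined, one = undefined,
      zero = (\<lambda>_. \<zero>\<^bsub>K\<^esub>), add = (\<lambda>a b s. a s \<oplus>\<^bsub>K\<^esub> b s),
      smult = (\<lambda>\<alpha> a t. \<Oplus>\<^bsub>K\<^esub>p\<in>{(m, s) \<in> carrier N \<times> S. act m s = Some t}.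
                 \<alpha> (fst p) \<otimes>\<^bsub>K\<^esub> a (snd p))\<rparr>"

text \<open>A module over \<open>KN\<close> is in particular a module over \<open>K\<close>.\<close>

abbreviation scalar_module ::
  "('k, 'y) ring_scheme \<Rightarrow> ('m, 'x) monoid_scheme \<Rightarrow> ('m \<Rightarrow> 'k, 'v) module \<Rightarrow> ('k, 'v) module"
where
  "scalar_module K N V \<equiv> inflate (single K \<one>\<^bsub>N\<^esub>) V"

text \<open>The tensor product over \<open>K\<close> of a \<open>KN\<close>-module \<open>A\<close> that is free over \<open>K\<close> on the finite set
  \<open>S\<close> with a \<open>KN\<close>-module \<open>V\<close>: its elements are the functions \<open>S \<rightarrow> V\<close>, with \<open>a \<otimes> v\<close> the
  function \<open>s \<mapsto> a(s) v\<close>, so that every element \<open>f\<close> is the sum of the \<open>s \<otimes> f(s)\<close>. The monoid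
  acts diagonally, \<open>m (s \<otimes> v) = ms \<otimes> mv\<close>. The universal property and the formula
  \<open>m (a \<otimes> v) = ma \<otimes> mv\<close> for all \<open>a \<in> A\<close> are proved below.\<close>

definition pure_tensor ::
  "('k, 'y) ring_scheme \<Rightarrow> ('m, 'x) monoid_scheme \<Rightarrow> ('m \<Rightarrow> 'k, 'v) module \<Rightarrow>
   ('s \<Rightarrow> 'k) \<Rightarrow> 'v \<Rightarrow> 's \<Rightarrow> 'v"
where
  "pure_tensor K N V a v = (\<lambda>s. a s \<odot>\<^bsub>scalar_module K N V\<^esub> v)"

definition free_tensor ::
  "('k, 'y) ring_scheme \<Rightarrow> ('m, 'x) monoid_scheme \<Rightarrow> 's set \<Rightarrow> ('m \<Rightarrow> 'k, 's \<Rightarrow> 'k) module \<Rightarrow>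
   ('m \<Rightarrow> 'k, 'v) module \<Rightarrow> ('m \<Rightarrow> 'k, 's \<Rightarrow> 'v) module"
where
  "free_tensor K N S A V =
     \<lparr>carrier = fun_carrier S V, mult = undefined, one = undefined,
      zero = (\<lambda>_. \<zero>\<^bsub>V\<^esub>), add = (\<lambda>f g s. f s \<oplus>\<^bsub>V\<^esub> g s),
      smult = (\<lambda>\<alpha> f t. \<Oplus>\<^bsub>V\<^esub>p\<in>carrier N \<times> S. \<alpha> (fst p) \<odot>\<^bsub>scalar_module K N V\<^esub>
                 pure_tensor K N V (basis K (fst p) \<odot>\<^bsub>A\<^esub> basis K (snd p))
                                   (basis K (fst p) \<odot>\<^bsub>V\<^esub> f (snd p)) t)\<rparr>"

text \<open>For a \<open>K\<close>-linear map \<open>h\<close> out of the free \<open>K\<close>-module on \<open>S\<close>, the map induced by \<open>h\<close>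
  on the tensor product with \<open>V\<close>: \<open>s \<otimes> v \<mapsto> h(s) \<otimes> v\<close> if \<open>h\<close> takes values in a
  free \<open>K\<close>-module, and \<open>s \<otimes> v \<mapsto> h(s) v\<close> (using \<open>K \<otimes> V = V\<close>) if \<open>h\<close> takes values in \<open>K\<close>.\<close>

definition tensor_map ::
  "('k, 'y) ring_scheme \<Rightarrow> ('m, 'x) monoid_scheme \<Rightarrow> 's set \<Rightarrow> ('m \<Rightarrow> 'k, 'v) module \<Rightarrow>
   (('s \<Rightarrow> 'k) \<Rightarrow> ('t \<Rightarrow> 'k)) \<Rightarrow> ('s \<Rightarrow> 'v) \<Rightarrow> 't \<Rightarrow> 'v"
where
  "tensor_map K N S V h f =
     (\<lambda>t. \<Oplus>\<^bsub>V\<^esub>s\<in>S. pure_tensor K N V (h (basis K s)) (f s) t)"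

definition tensor_functional ::
  "('k, 'y) ring_scheme \<Rightarrow> ('m, 'x) monoid_scheme \<Rightarrow> 's set \<Rightarrow> ('m \<Rightarrow> 'k, 'v) module \<Rightarrow>
   (('s \<Rightarrow> 'k) \<Rightarrow> 'k) \<Rightarrow> ('s \<Rightarrow> 'v) \<Rightarrow> 'v"
where
  "tensor_functional K N S V h f =
     (\<Oplus>\<^bsub>V\<^esub>s\<in>S. h (basis K s) \<odot>\<^bsub>scalar_module K N V\<^esub> f s)"


text \<open>The tensor product has the expected universal property, its action is the diagonal one, and
  the induced maps are the expected ones.\<close>

definition bilinear ::
  "('k, 'y) ring_scheme \<Rightarrow> ('k, 'a) module \<Rightarrow> ('k, 'b) module \<Rightarrow> ('k, 'c) module \<Rightarrow>
   ('a \<Rightarrow> 'b \<Rightarrow> 'c) \<Rightarrow> bool"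
where
  "bilinear K A B W \<tau> \<longleftrightarrow>
     (\<forall>b \<in> carrier B. (\<lambda>a. \<tau> a b) \<in> lmod_hom K A W) \<and>
     (\<forall>a \<in> carrier A. \<tau> a \<in> lmod_hom K B W)"

lemma finsum_inflate [simp]: "finsum (inflate h V) f S = finsum V f S"
  by (simp add: finsum_def finprod_def inflate_def)

lemma inflate_simps [simp]:
  "carrier (inflate h V) = carrier V" "add (inflate h V) = add V" "zero (inflate h V) = zero V"
  "smult (inflate h V) r v = smult V (h r) v"
  by (simp_all add: inflate_def)

lemma (in abelian_monoid) fun_carrier_expand:
  assumes "abelian_monoid W" "finite S" "f \<in> fun_carrier S G"
    and closed: "\<And>g. g \<in> fun_carrier S G \<Longrightarrow> \<phi> g \<in> carrier W"
    and add: "\<And>g h. g \<in> fun_carrier S G \<Longrightarrow> h \<in> fun_carrier S G \<Longrightarrow>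
                \<phi> (\<lambda>s. g s \<oplus> h s) = \<phi> g \<oplus>\<^bsub>W\<^esub> \<phi> h"
    and zero: "\<phi> (\<lambda>_. \<zero>) = \<zero>\<^bsub>W\<^esub>"
  shows "\<phi> f = (\<Oplus>\<^bsub>W\<^esub>s\<in>S. \<phi> (single G s (f s)))"
proof -
  interpret W: abelian_monoid W by fact
  have fc: "f s \<in> carrier G" for s using assms(3) by (auto simp: fun_carrier_def)
  have sc: "single G s (f s) \<in> fun_carrier S G" if "s \<in> S" for s
    using that fc by (auto simp: fun_carrier_def single_def)
  have "\<phi> (\<lambda>s. if s \<in> F then f s else \<zero>) = (\<Oplus>\<^bsub>W\<^esub>s\<in>F. \<phi> (single G s (f s)))"
    if "finite F" "F \<subseteq> S" for F using that
  proof (induction F)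
    case empty
    then show ?case by (simp add: zero)
  next
    case (insert x F)
    have 1: "(\<lambda>s. if s \<in> insert x F then f s else \<zero>) =
          (\<lambda>s. single G x (f x) s \<oplus> (if s \<in> F then f s else \<zero>))"
      using insert.hyps fc by (auto simp: single_def)
    have "(\<lambda>s. if s \<in> F then f s else \<zero>) \<in> fun_carrier S G"
      using insert.prems fc by (auto simp: fun_carrier_def)
    then have "\<phi> (\<lambda>s. if s \<in> insert x F then f s else \<zero>) =
        \<phi> (single G x (f x)) \<oplus>\<^bsub>W\<^esub> \<phi> (\<lambda>s. if s \<in> F then f s else \<zero>)"
      using insert.prems sc by (subst 1, subst add) auto
    then show ?case
      using insert sc closed by (subst W.finsum_insert) (auto simp: Pi_def subset_iff)
  qed
  from this[of S] have "\<phi> (\<lambda>s. if s \<in> S then f s else \<zero>) = (\<Oplus>\<^bsub>W\<^esub>s\<in>S. \<phi> (single G s (f s)))"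
    using assms(2) by simp
  moreover have "(\<lambda>s. if s \<in> S then f s else \<zero>) = f"
  proof
    fix s
    have "s \<in> S" if "f s \<noteq> \<zero>" using assms(3) that unfolding fun_carrier_def by blast
    then show "(if s \<in> S then f s else \<zero>) = f s" by metis
  qed
  ultimately show ?thesis by simp
qed

lemma single_closed:
  assumes "abelian_monoid K" "monoid N" "m \<in> carrier N" "k \<in> carrier K"
  shows "single K m k \<in> carrier (monoid_algebra K N)"
proof -
  interpret abelian_monoid K by fact
  have "{x. single K m k x \<noteq> \<zero>\<^bsub>K\<^esub>} \<subseteq> {m}" by (auto simp: single_def)
  then have "finite {x. single K m k x \<noteq> \<zero>\<^bsub>K\<^esub>}" using finite_subset by blast
  then show ?thesis using assms by (auto simp: monoid_algebra_def single_def)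
qed

lemma single_mult:
  assumes "ring K" "k \<in> carrier K" "l \<in> carrier K"
  shows "single K m k \<otimes>\<^bsub>monoid_algebra K N\<^esub> single K n l = single K (m \<otimes>\<^bsub>N\<^esub> n) (k \<otimes>\<^bsub>K\<^esub> l)"
proof
  fix x
  interpret ring K by fact
  let ?I = "{(y, z). single K m k y \<noteq> \<zero>\<^bsub>K\<^esub> \<and> single K n l z \<noteq> \<zero>\<^bsub>K\<^esub> \<and> y \<otimes>\<^bsub>N\<^esub> z = x}"
  let ?F = "\<lambda>p. single K m k (fst p) \<otimes>\<^bsub>K\<^esub> single K n l (snd p)"
  have eq: "(single K m k \<otimes>\<^bsub>monoid_algebra K N\<^esub> single K n l) x = finsum K ?F ?I"
    by (simp add: monoid_algebra_def)
  consider "k = \<zero>\<^bsub>K\<^esub> \<or> l = \<zero>\<^bsub>K\<^esub>" | "m \<otimes>\<^bsub>N\<^esub> n \<noteq> x"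
    | "k \<noteq> \<zero>\<^bsub>K\<^esub>" "l \<noteq> \<zero>\<^bsub>K\<^esub>" "m \<otimes>\<^bsub>N\<^esub> n = x" by blast
  then show "(single K m k \<otimes>\<^bsub>monoid_algebra K N\<^esub> single K n l) x =
      single K (m \<otimes>\<^bsub>N\<^esub> n) (k \<otimes>\<^bsub>K\<^esub> l) x"
  proof cases
    case 1
    then have I: "?I = {}" by (auto simp: single_def)
    have "k \<otimes>\<^bsub>K\<^esub> l = \<zero>\<^bsub>K\<^esub>" using 1 assms by auto
    then show ?thesis unfolding eq I by (simp add: single_def)
  next
    case 2
    then have I: "?I = {}" by (auto simp: single_def split: if_splits)
    show ?thesis unfolding eq I using 2 by (simp add: single_def)
  next
    case 3
    then have I: "?I = {(m, n)}" by (auto simp: single_def split: if_splits)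
    show ?thesis unfolding eq I using 3 assms by (simp add: single_def)
  qed
qed

lemma single_add:
  assumes "ring K"
  shows "single K m k \<oplus>\<^bsub>monoid_algebra K N\<^esub> single K m l = single K m (k \<oplus>\<^bsub>K\<^esub> l)"
proof -
  interpret ring K by fact
  show ?thesis by (auto simp: monoid_algebra_def single_def)
qed

locale tensor_setup =
  K: cring K + N: monoid N + A: left_module "monoid_algebra K N" A + V: left_module "monoid_algebra K N" V
  for K :: "('k, 'y) ring_scheme" and N :: "('m, 'x) monoid_scheme"
    and A :: "('m \<Rightarrow> 'k, 's \<Rightarrow> 'k) module" and V :: "('m \<Rightarrow> 'k, 'v) module" +
  fixes S :: "'s set"
  assumes finite_N: "finite (carrier N)" and finite_S: "finite S"
    and carrier_A: "carrier A = fun_carrier S K"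
    and add_A: "add A = (\<lambda>a b s. a s \<oplus>\<^bsub>K\<^esub> b s)"
    and zero_A: "zero A = (\<lambda>_. \<zero>\<^bsub>K\<^esub>)"
    and scalar_A: "\<And>k a. \<lbrakk>k \<in> carrier K; a \<in> carrier A\<rbrakk> \<Longrightarrow>
           k \<odot>\<^bsub>scalar_module K N A\<^esub> a = (\<lambda>s. k \<otimes>\<^bsub>K\<^esub> a s)"
begin

abbreviation T where "T \<equiv> free_tensor K N S A V"
abbreviation \<tau> where "\<tau> \<equiv> pure_tensor K N V"

lemma module_scalar:
  assumes "left_module (monoid_algebra K N) W"
  shows "module K (scalar_module K N W)"
proof -
  interpret W: left_module "monoid_algebra K N" W by fact
  note sc = single_closed[OF K.abelian_monoid_axioms N.monoid_axioms N.one_closed]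
  show ?thesis
  proof (rule moduleI)
    show "cring K" by (rule K.is_cring)
    show "abelian_group (scalar_module K N W)"
      by (rule abelian_groupI)
        (auto simp: W.M.a_ac intro: bexI[where x = "\<ominus>\<^bsub>W\<^esub> x" for x] W.M.l_neg)
    show "\<one>\<^bsub>K\<^esub> \<odot>\<^bsub>scalar_module K N W\<^esub> x = x" if "x \<in> carrier (scalar_module K N W)" for x
      using W.smult_one[of x] that by (simp add: monoid_algebra_def)
  next
    fix a b x assume *: "a \<in> carrier K" "b \<in> carrier K" "x \<in> carrier (scalar_module K N W)"
    show "(a \<oplus>\<^bsub>K\<^esub> b) \<odot>\<^bsub>scalar_module K N W\<^esub> x =
      a \<odot>\<^bsub>scalar_module K N W\<^esub> x \<oplus>\<^bsub>scalar_module K N W\<^esub> b \<odot>\<^bsub>scalar_module K N W\<^esub> x"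
      using W.smult_l_distr[of "single K \<one>\<^bsub>N\<^esub> a" "single K \<one>\<^bsub>N\<^esub> b" x] * sc
      by (simp add: single_add[OF K.ring_axioms])
    show "(a \<otimes>\<^bsub>K\<^esub> b) \<odot>\<^bsub>scalar_module K N W\<^esub> x =
      a \<odot>\<^bsub>scalar_module K N W\<^esub> (b \<odot>\<^bsub>scalar_module K N W\<^esub> x)"
      using W.smult_assoc1[of "single K \<one>\<^bsub>N\<^esub> a" "single K \<one>\<^bsub>N\<^esub> b" x] * sc
      by (simp add: single_mult[OF K.ring_axioms])
  qed (auto simp: sc W.smult_r_distr)
qed

sublocale V0: module K "scalar_module K N V"
  by (rule module_scalar[OF V.left_module_axioms])

abbreviation act_A where "act_A m a \<equiv> basis K m \<odot>\<^bsub>A\<^esub> a"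
abbreviation act_V where "act_V m v \<equiv> basis K m \<odot>\<^bsub>V\<^esub> v"
abbreviation sc (infixr "\<cdot>" 75) where "sc k v \<equiv> smult V (single K \<one>\<^bsub>N\<^esub> k) v"

lemmas single_cl = single_closed[OF K.abelian_monoid_axioms N.monoid_axioms]

lemma basis_closed [simp]: "m \<in> carrier N \<Longrightarrow> basis K m \<in> carrier (monoid_algebra K N)"
  by (simp add: single_cl)

lemma act_scalar:
  assumes "left_module (monoid_algebra K N) W" "m \<in> carrier N" "k \<in> carrier K" "w \<in> carrier W"
  shows "basis K m \<odot>\<^bsub>W\<^esub> (single K \<one>\<^bsub>N\<^esub> k \<odot>\<^bsub>W\<^esub> w) = single K \<one>\<^bsub>N\<^esub> k \<odot>\<^bsub>W\<^esub> (basis K m \<odot>\<^bsub>W\<^esub> w)"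
proof -
  interpret W: left_module "monoid_algebra K N" W by fact
  show ?thesis
    using assms W.smult_assoc1[of "basis K m" "single K \<one>\<^bsub>N\<^esub> k" w]
      W.smult_assoc1[of "single K \<one>\<^bsub>N\<^esub> k" "basis K m" w]
    by (simp add: single_mult[OF K.ring_axioms] single_cl)
qed

lemma basis_in_A: "s \<in> S \<Longrightarrow> basis K s \<in> carrier A"
  by (auto simp: carrier_A fun_carrier_def single_def)

lemma A_val: "a \<in> carrier A \<Longrightarrow> a s \<in> carrier K"
  by (auto simp: carrier_A fun_carrier_def)

lemma single_in_A: "s \<in> S \<Longrightarrow> k \<in> carrier K \<Longrightarrow> single K s k \<in> carrier A"
  by (auto simp: carrier_A fun_carrier_def single_def)

lemma single_A:
  "s \<in> S \<Longrightarrow> k \<in> carrier K \<Longrightarrow> single K s k = single K \<one>\<^bsub>N\<^esub> k \<odot>\<^bsub>A\<^esub> basis K s"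
  using scalar_A[of k "basis K s"] basis_in_A by (auto simp: single_def)

lemma expand_A:
  assumes "abelian_monoid W" "a \<in> carrier A"
    and "\<And>g. g \<in> carrier A \<Longrightarrow> \<phi> g \<in> carrier W"
    and "\<And>g h. g \<in> carrier A \<Longrightarrow> h \<in> carrier A \<Longrightarrow> \<phi> (g \<oplus>\<^bsub>A\<^esub> h) = \<phi> g \<oplus>\<^bsub>W\<^esub> \<phi> h"
    and "\<phi> \<zero>\<^bsub>A\<^esub> = \<zero>\<^bsub>W\<^esub>"
  shows "\<phi> a = (\<Oplus>\<^bsub>W\<^esub>s\<in>S. \<phi> (single K \<one>\<^bsub>N\<^esub> (a s) \<odot>\<^bsub>A\<^esub> basis K s))"
proof -
  interpret W: abelian_monoid W by fact
  have "\<phi> a = (\<Oplus>\<^bsub>W\<^esub>s\<in>S. \<phi> (single K s (a s)))"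
    using assms by (intro K.fun_carrier_expand finite_S) (auto simp: carrier_A add_A zero_A)
  also have "\<dots> = (\<Oplus>\<^bsub>W\<^esub>s\<in>S. \<phi> (single K \<one>\<^bsub>N\<^esub> (a s) \<odot>\<^bsub>A\<^esub> basis K s))"
    using assms A_val by (intro W.finsum_cong') (auto simp: single_A[symmetric] single_in_A)
  finally show ?thesis .
qed

lemma pure_tensor_closed: "a \<in> carrier A \<Longrightarrow> v \<in> carrier V \<Longrightarrow> \<tau> a v \<in> carrier T"
  using V0.smult_closed V0.smult_l_null
  by (auto simp: free_tensor_def pure_tensor_def carrier_A fun_carrier_def)

lemma free_tensor_smult:
  assumes m: "m \<in> carrier N" and k: "k \<in> carrier K" and f: "f \<in> carrier T"
  shows "single K m k \<odot>\<^bsub>T\<^esub> f = (\<lambda>t. \<Oplus>\<^bsub>V\<^esub>s\<in>S. k \<cdot> (act_A m (basis K s) t \<cdot> act_V m (f s)))"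
proof
  fix t
  let ?F = "\<lambda>p. single K m k (fst p) \<cdot>
              (act_A (fst p) (basis K (snd p)) t \<cdot> act_V (fst p) (f (snd p)))"
  have fV: "f s \<in> carrier V" for s using f by (auto simp: free_tensor_def fun_carrier_def)
  have aK: "act_A n (basis K s) t \<in> carrier K" if "n \<in> carrier N" "s \<in> S" for n s
    using that basis_in_A A_val by simp
  have cl: "act_A n (basis K s) t \<cdot> act_V n (f s) \<in> carrier V" if "n \<in> carrier N" "s \<in> S" for n s
    using V0.smult_closed[of "act_A n (basis K s) t" "act_V n (f s)"] aK that fV by simp
  have cl': "?F p \<in> carrier V" if "p \<in> carrier N \<times> S" for p
  proof -
    have "single K m k (fst p) \<in> carrier K" using k by (simp add: single_def)
    then show ?thesis using that cl V0.smult_closed[of "single K m k (fst p)"] by (cases p) auto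
  qed
  have "(single K m k \<odot>\<^bsub>T\<^esub> f) t = (\<Oplus>\<^bsub>V\<^esub>p\<in>carrier N \<times> S. ?F p)"
    by (simp add: free_tensor_def pure_tensor_def)
  also have "\<dots> = (\<Oplus>\<^bsub>V\<^esub>p\<in>Pair m ` S. ?F p)"
  proof (rule V.M.add.finprod_mono_neutral_cong_right)
    show "finite (carrier N \<times> S)" using finite_N finite_S by simp
    show "?F p = \<zero>\<^bsub>V\<^esub>" if "p \<in> carrier N \<times> S - Pair m ` S" for p
    proof -
      have "single K m k (fst p) = \<zero>\<^bsub>K\<^esub>" using that by (cases p) (auto simp: single_def)
      then show ?thesis using that cl V0.smult_l_null by (cases p) auto
    qed
  qed (use m cl' in auto)
  also have "\<dots> = (\<Oplus>\<^bsub>V\<^esub>s\<in>S. ?F (m, s))"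
    using cl' m by (subst V.M.finsum_reindex) (auto simp: inj_on_def)
  finally show "(single K m k \<odot>\<^bsub>T\<^esub> f) t = (\<Oplus>\<^bsub>V\<^esub>s\<in>S. k \<cdot> (act_A m (basis K s) t \<cdot> act_V m (f s)))"
    by (simp add: single_def)
qed

lemma finsum_ldistr_V:
  assumes "v \<in> carrier V" "\<And>s. s \<in> F \<Longrightarrow> g s \<in> carrier K" "finite F"
  shows "(\<Oplus>\<^bsub>K\<^esub>s\<in>F. g s) \<cdot> v = (\<Oplus>\<^bsub>V\<^esub>s\<in>F. g s \<cdot> v)"
  using assms(3,2)
proof (induction F)
  case empty
  then show ?case using V0.smult_l_null[of v] assms(1) by simp
next
  case (insert x F)
  have "(g x \<oplus>\<^bsub>K\<^esub> finsum K g F) \<cdot> v = g x \<cdot> v \<oplus>\<^bsub>V\<^esub> finsum K g F \<cdot> v"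
    using V0.smult_l_distr[of "g x" "finsum K g F" v] assms(1) insert by (simp add: Pi_def)
  moreover have "g s \<cdot> v \<in> carrier V" if "s \<in> insert x F" for s
    using V0.smult_closed[of "g s" v] that insert assms(1) by simp
  ultimately show ?case using insert by (simp add: Pi_def)
qed

theorem diagonal_action:
  assumes m: "m \<in> carrier N" and a: "a \<in> carrier A" and v: "v \<in> carrier V"
  shows "basis K m \<odot>\<^bsub>T\<^esub> \<tau> a v = \<tau> (basis K m \<odot>\<^bsub>A\<^esub> a) (basis K m \<odot>\<^bsub>V\<^esub> v)"
proof
  fix t
  have mv: "act_V m v \<in> carrier V" using m v by simp
  have b: "act_A m (basis K s) t \<in> carrier K" if "s \<in> S" for s
    using that m basis_in_A A_val by simp
  note aK = A_val[OF a]
  have "(basis K m \<odot>\<^bsub>T\<^esub> \<tau> a v) t =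
      (\<Oplus>\<^bsub>V\<^esub>s\<in>S. \<one>\<^bsub>K\<^esub> \<cdot> (act_A m (basis K s) t \<cdot> act_V m (\<tau> a v s)))"
    using m a v by (subst free_tensor_smult) (auto simp: pure_tensor_closed)
  also have "\<dots> = (\<Oplus>\<^bsub>V\<^esub>s\<in>S. (a s \<otimes>\<^bsub>K\<^esub> act_A m (basis K s) t) \<cdot> act_V m v)"
  proof (rule V.M.finsum_cong')
    fix s assume s: "s \<in> S"
    have "act_V m (\<tau> a v s) = a s \<cdot> act_V m v"
      using act_scalar[OF V.left_module_axioms m aK v] by (simp add: pure_tensor_def)
    then have "act_A m (basis K s) t \<cdot> act_V m (\<tau> a v s)
        = (a s \<otimes>\<^bsub>K\<^esub> act_A m (basis K s) t) \<cdot> act_V m v"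
      using V0.smult_assoc1[of "act_A m (basis K s) t" "a s" "act_V m v"] b[OF s] aK mv
      by (simp add: K.m_comm)
    then show "\<one>\<^bsub>K\<^esub> \<cdot> (act_A m (basis K s) t \<cdot> act_V m (\<tau> a v s))
        = (a s \<otimes>\<^bsub>K\<^esub> act_A m (basis K s) t) \<cdot> act_V m v"
      using V0.smult_one[of "(a s \<otimes>\<^bsub>K\<^esub> act_A m (basis K s) t) \<cdot> act_V m v"]
        V0.smult_closed[of "a s \<otimes>\<^bsub>K\<^esub> act_A m (basis K s) t" "act_V m v"] b[OF s] aK mv by simp
  qed (use b aK mv V0.smult_closed in auto)
  also have "\<dots> = (\<Oplus>\<^bsub>K\<^esub>s\<in>S. a s \<otimes>\<^bsub>K\<^esub> act_A m (basis K s) t) \<cdot> act_V m v"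
    using mv b aK finite_S by (subst finsum_ldistr_V) auto
  also have "(\<Oplus>\<^bsub>K\<^esub>s\<in>S. a s \<otimes>\<^bsub>K\<^esub> act_A m (basis K s) t) =
      (\<Oplus>\<^bsub>K\<^esub>s\<in>S. act_A m (single K \<one>\<^bsub>N\<^esub> (a s) \<odot>\<^bsub>A\<^esub> basis K s) t)"
  proof (rule K.finsum_cong')
    fix s assume s: "s \<in> S"
    have "act_A m (single K \<one>\<^bsub>N\<^esub> (a s) \<odot>\<^bsub>A\<^esub> basis K s) =
        single K \<one>\<^bsub>N\<^esub> (a s) \<odot>\<^bsub>A\<^esub> act_A m (basis K s)"
      using act_scalar[OF A.left_module_axioms m aK basis_in_A[OF s]] by simp
    also have "\<dots> = (\<lambda>t. a s \<otimes>\<^bsub>K\<^esub> act_A m (basis K s) t)"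
      using scalar_A[OF aK, of "act_A m (basis K s)"] m basis_in_A[OF s] by simp
    finally show "a s \<otimes>\<^bsub>K\<^esub> act_A m (basis K s) t =
        act_A m (single K \<one>\<^bsub>N\<^esub> (a s) \<odot>\<^bsub>A\<^esub> basis K s) t" by simp
  qed (use m aK basis_in_A single_cl A_val in auto)
  also have "\<dots> = act_A m a t"
  proof (rule expand_A[symmetric, OF K.abelian_monoid_axioms a])
    show "act_A m \<zero>\<^bsub>A\<^esub> t = \<zero>\<^bsub>K\<^esub>"
    proof -
      have "act_A m \<zero>\<^bsub>A\<^esub> = act_A m \<zero>\<^bsub>A\<^esub> \<oplus>\<^bsub>A\<^esub> act_A m \<zero>\<^bsub>A\<^esub>"
        using A.smult_r_distr[of "basis K m" "\<zero>\<^bsub>A\<^esub>" "\<zero>\<^bsub>A\<^esub>"] m by simp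
      then have "act_A m \<zero>\<^bsub>A\<^esub> = \<zero>\<^bsub>A\<^esub>"
        by (metis A.M.add.r_cancel_one' A.M.zero_closed A.smult_closed basis_closed m)
      then show ?thesis by (simp add: zero_A)
    qed
  next
    fix g h assume "g \<in> carrier A" "h \<in> carrier A"
    then show "act_A m (g \<oplus>\<^bsub>A\<^esub> h) t = act_A m g t \<oplus>\<^bsub>K\<^esub> act_A m h t"
      using A.smult_r_distr[of "basis K m" g h] m by (simp add: add_A)
  qed (use m A_val in auto)
  finally show "(basis K m \<odot>\<^bsub>T\<^esub> \<tau> a v) t = \<tau> (act_A m a) (act_V m v) t"
    by (simp add: pure_tensor_def)
qed

lemma scalar_T:
  assumes k: "k \<in> carrier K" and f: "f \<in> carrier T"
  shows "k \<odot>\<^bsub>scalar_module K N T\<^esub> f = (\<lambda>s. k \<cdot> f s)"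
proof
  fix t
  have fV: "f s \<in> carrier V" for s using f by (auto simp: free_tensor_def fun_carrier_def)
  have kf: "k \<cdot> f s \<in> carrier V" for s using V0.smult_closed[OF k, of "f s"] fV by simp
  have one: "act_A \<one>\<^bsub>N\<^esub> (basis K s) = basis K s" if "s \<in> S" for s
    using A.smult_one[OF basis_in_A[OF that]] by (simp add: monoid_algebra_def)
  have oneV: "act_V \<one>\<^bsub>N\<^esub> v = v" if "v \<in> carrier V" for v
    using V.smult_one[OF that] by (simp add: monoid_algebra_def)
  have "(single K \<one>\<^bsub>N\<^esub> k \<odot>\<^bsub>T\<^esub> f) t =
      (\<Oplus>\<^bsub>V\<^esub>s\<in>S. k \<cdot> (act_A \<one>\<^bsub>N\<^esub> (basis K s) t \<cdot> act_V \<one>\<^bsub>N\<^esub> (f s)))"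
    using k f by (subst free_tensor_smult) auto
  also have "\<dots> = (\<Oplus>\<^bsub>V\<^esub>s\<in>S. if s = t then k \<cdot> f s else \<zero>\<^bsub>V\<^esub>)"
  proof (rule V.M.finsum_cong')
    fix s assume s: "s \<in> S"
    show "k \<cdot> (act_A \<one>\<^bsub>N\<^esub> (basis K s) t \<cdot> act_V \<one>\<^bsub>N\<^esub> (f s)) = (if s = t then k \<cdot> f s else \<zero>\<^bsub>V\<^esub>)"
      using one[OF s] oneV[OF fV] V0.smult_one[of "f s"] V0.smult_l_null[of "f s"]
        V0.smult_r_null[OF k] fV
      by (auto simp: single_def[of K s])
  qed (use kf in auto)
  also have "\<dots> = k \<cdot> f t"
  proof (cases "t \<in> S")
    case True
    then show ?thesis using kf finite_S by (intro V.M.add.finprod_singleton_swap) auto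
  next
    case False
    then have "f t = \<zero>\<^bsub>V\<^esub>" using f by (auto simp: free_tensor_def fun_carrier_def)
    moreover have "(\<Oplus>\<^bsub>V\<^esub>s\<in>S. if s = t then k \<cdot> f s else \<zero>\<^bsub>V\<^esub>) = \<zero>\<^bsub>V\<^esub>"
      using False by (intro V.M.add.finprod_one_eqI) auto
    ultimately show ?thesis using V0.smult_r_null[OF k] by simp
  qed
  finally show "(k \<odot>\<^bsub>scalar_module K N T\<^esub> f) t = k \<cdot> f t" by simp
qed

theorem pure_tensor_bilinear:
  "bilinear K (scalar_module K N A) (scalar_module K N V) (scalar_module K N T) \<tau>"
proof -
  have 1: "\<tau> (\<lambda>s. k \<otimes>\<^bsub>K\<^esub> a s) v = (\<lambda>s. k \<cdot> \<tau> a v s)"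
    if "k \<in> carrier K" "a \<in> carrier A" "v \<in> carrier V" for k a v
    using that V0.smult_assoc1[of k _ v] A_val by (auto simp: pure_tensor_def)
  have 2: "\<tau> a (k \<cdot> v) = (\<lambda>s. k \<cdot> \<tau> a v s)"
    if "k \<in> carrier K" "a \<in> carrier A" "v \<in> carrier V" for k a v
  proof
    fix s
    show "\<tau> a (k \<cdot> v) s = k \<cdot> \<tau> a v s"
      using that V0.smult_assoc1[of k "a s" v] V0.smult_assoc1[of "a s" k v] A_val[of a s]
      by (simp add: pure_tensor_def K.m_comm)
  qed
  show ?thesis
    unfolding bilinear_def lmod_hom_def hom_def
    using pure_tensor_closed scalar_A V0.smult_closed
    apply (auto simp: scalar_T[simplified] 1 2)
     apply (auto simp: free_tensor_def pure_tensor_def add_A A_val V0.smult_l_distr[simplified]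
        V0.smult_r_distr[simplified])
    done
qed

theorem tensor_universal:
  assumes W: "module K W" and bil: "bilinear K (scalar_module K N A) (scalar_module K N V) W \<beta>"
  shows "\<exists>h \<in> lmod_hom K (scalar_module K N T) W.
           (\<forall>a \<in> carrier A. \<forall>v \<in> carrier V. h (\<tau> a v) = \<beta> a v) \<and>
           (\<forall>h' \<in> lmod_hom K (scalar_module K N T) W.
              (\<forall>a \<in> carrier A. \<forall>v \<in> carrier V. h' (\<tau> a v) = \<beta> a v) \<longrightarrow>
              (\<forall>f \<in> carrier T. h' f = h f))"
proof -
  interpret W: module K W by fact
  have bc: "\<beta> a v \<in> carrier W" if "a \<in> carrier A" "v \<in> carrier V" for a v
    using bil that by (auto simp: bilinear_def lmod_hom_def hom_def)
  have bl: "\<beta> (a \<oplus>\<^bsub>A\<^esub> b) v = \<beta> a v \<oplus>\<^bsub>W\<^esub> \<beta> b v"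
    if "a \<in> carrier A" "b \<in> carrier A" "v \<in> carrier V" for a b v
    using bil that by (auto simp: bilinear_def lmod_hom_def hom_def)
  have br: "\<beta> a (v \<oplus>\<^bsub>V\<^esub> w) = \<beta> a v \<oplus>\<^bsub>W\<^esub> \<beta> a w"
    if "a \<in> carrier A" "v \<in> carrier V" "w \<in> carrier V" for a v w
    using bil that by (auto simp: bilinear_def lmod_hom_def hom_def)
  have sl: "\<beta> (single K \<one>\<^bsub>N\<^esub> k \<odot>\<^bsub>A\<^esub> a) v = k \<odot>\<^bsub>W\<^esub> \<beta> a v"
    if "k \<in> carrier K" "a \<in> carrier A" "v \<in> carrier V" for k a v
    using bil that by (auto simp: bilinear_def lmod_hom_def hom_def)
  have sr: "\<beta> a (k \<cdot> v) = k \<odot>\<^bsub>W\<^esub> \<beta> a v"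
    if "k \<in> carrier K" "a \<in> carrier A" "v \<in> carrier V" for k a v
    using bil that by (auto simp: bilinear_def lmod_hom_def hom_def)
  have zl: "\<beta> \<zero>\<^bsub>A\<^esub> v = \<zero>\<^bsub>W\<^esub>" if "v \<in> carrier V" for v
    using bl[of "\<zero>\<^bsub>A\<^esub>" "\<zero>\<^bsub>A\<^esub>" v] bc[of "\<zero>\<^bsub>A\<^esub>" v] that
    by (metis A.M.zero_closed A.M.l_zero W.add.r_cancel_one')
  have fV: "f s \<in> carrier V" if "f \<in> carrier T" for f s
    using that by (auto simp: free_tensor_def fun_carrier_def)
  define h where "h f = (\<Oplus>\<^bsub>W\<^esub>s\<in>S. \<beta> (basis K s) (f s))" for f
  have bc': "\<beta> (basis K s) (f s) \<in> carrier W" if "f \<in> carrier T" "s \<in> S" for f s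
    using that bc basis_in_A fV by simp
  have h1: "h \<in> lmod_hom K (scalar_module K N T) W"
  proof -
    have "h f \<in> carrier W" if "f \<in> carrier T" for f
      unfolding h_def using that bc' by (intro W.finsum_closed) auto
    moreover have "h (f \<oplus>\<^bsub>T\<^esub> g) = h f \<oplus>\<^bsub>W\<^esub> h g" if "f \<in> carrier T" "g \<in> carrier T" for f g
    proof -
      have "h (f \<oplus>\<^bsub>T\<^esub> g) = (\<Oplus>\<^bsub>W\<^esub>s\<in>S. \<beta> (basis K s) (f s) \<oplus>\<^bsub>W\<^esub> \<beta> (basis K s) (g s))"
        unfolding h_def using that bc' br basis_in_A fV
        by (intro W.finsum_cong') (auto simp: free_tensor_def)
      then show ?thesis unfolding h_def using that bc' by (simp add: W.finsum_addf Pi_def)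
    qed
    moreover have "h (single K \<one>\<^bsub>N\<^esub> k \<odot>\<^bsub>T\<^esub> f) = k \<odot>\<^bsub>W\<^esub> h f" if "k \<in> carrier K" "f \<in> carrier T" for k f
    proof -
      have "h (single K \<one>\<^bsub>N\<^esub> k \<odot>\<^bsub>T\<^esub> f) = (\<Oplus>\<^bsub>W\<^esub>s\<in>S. k \<odot>\<^bsub>W\<^esub> \<beta> (basis K s) (f s))"
        unfolding h_def using that bc' sr basis_in_A fV scalar_T
        by (intro W.finsum_cong') auto
      then show ?thesis
        unfolding h_def using that bc' finite_S by (simp add: W.finsum_smult_ldistr Pi_def)
    qed
    ultimately show ?thesis by (auto simp: lmod_hom_def hom_def)
  qed
  have h2: "h (\<tau> a v) = \<beta> a v" if a: "a \<in> carrier A" and v: "v \<in> carrier V" for a v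
  proof -
    have "\<beta> a v = (\<Oplus>\<^bsub>W\<^esub>s\<in>S. \<beta> (single K \<one>\<^bsub>N\<^esub> (a s) \<odot>\<^bsub>A\<^esub> basis K s) v)"
      using a v bc bl zl by (intro expand_A[where \<phi> = "\<lambda>a. \<beta> a v"] W.abelian_monoid_axioms) auto
    also have "\<dots> = h (\<tau> a v)"
      unfolding h_def using a v sl sr A_val basis_in_A bc
      by (intro W.finsum_cong') (auto simp: pure_tensor_def)
    finally show ?thesis by simp
  qed
  have h3: "h' f = h f" if h': "h' \<in> lmod_hom K (scalar_module K N T) W"
    and *: "\<forall>a \<in> carrier A. \<forall>v \<in> carrier V. h' (\<tau> a v) = \<beta> a v" and f: "f \<in> carrier T" for h' f
  proof -
    have cT: "carrier T = fun_carrier S V" by (simp add: free_tensor_def)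
    have h'c: "h' g \<in> carrier W" if "g \<in> carrier T" for g
      using h' that by (auto simp: lmod_hom_def hom_def)
    have h'a: "h' (\<lambda>s. g s \<oplus>\<^bsub>V\<^esub> g' s) = h' g \<oplus>\<^bsub>W\<^esub> h' g'" if "g \<in> carrier T" "g' \<in> carrier T" for g g'
      using h' that by (auto simp: lmod_hom_def hom_def free_tensor_def)
    have z: "(\<lambda>_. \<zero>\<^bsub>V\<^esub>) \<in> carrier T" by (simp add: cT fun_carrier_def)
    have "h' (\<lambda>_. \<zero>\<^bsub>V\<^esub>) = \<zero>\<^bsub>W\<^esub>"
      using h'a[OF z z] h'c[OF z] by (metis V.M.l_zero V.M.zero_closed W.add.r_cancel_one')
    then have "h' f = (\<Oplus>\<^bsub>W\<^esub>s\<in>S. h' (single V s (f s)))"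
      using h'c h'a f by (intro V.M.fun_carrier_expand W.abelian_monoid_axioms finite_S) (auto simp: cT)
    also have "\<dots> = h f"
      unfolding h_def
    proof (rule W.finsum_cong')
      fix s assume s: "s \<in> S"
      have "single V s (f s) = \<tau> (basis K s) (f s)"
        using V0.smult_one[of "f s"] V0.smult_l_null[of "f s"] fV[OF f]
        by (auto simp: pure_tensor_def single_def[of V] single_def[of K s])
      then show "h' (single V s (f s)) = \<beta> (basis K s) (f s)"
        using * s basis_in_A fV[OF f] by simp
    qed (use f bc' in auto)
    finally show ?thesis .
  qed
  show ?thesis using h1 h2 h3 by (intro bexI[of _ h]) auto
qed

theorem tensor_map_pure:
  assumes a: "a \<in> carrier A" and v: "v \<in> carrier V"
    and h: "\<And>b. b \<in> carrier A \<Longrightarrow> h b \<in> fun_carrier S' K"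
    and add: "\<And>b c. \<lbrakk>b \<in> carrier A; c \<in> carrier A\<rbrakk> \<Longrightarrow> h (\<lambda>s. b s \<oplus>\<^bsub>K\<^esub> c s) = (\<lambda>t. h b t \<oplus>\<^bsub>K\<^esub> h c t)"
    and scale: "\<And>k b. \<lbrakk>k \<in> carrier K; b \<in> carrier A\<rbrakk> \<Longrightarrow> h (\<lambda>s. k \<otimes>\<^bsub>K\<^esub> b s) = (\<lambda>t. k \<otimes>\<^bsub>K\<^esub> h b t)"
  shows "tensor_map K N S V h (\<tau> a v) = \<tau> (h a) v"
proof
  fix t
  have hK: "h b t \<in> carrier K" if "b \<in> carrier A" for b using h[OF that] by (simp add: fun_carrier_def)
  have h0: "h \<zero>\<^bsub>A\<^esub> t = \<zero>\<^bsub>K\<^esub>"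
    using fun_cong[OF scale[OF K.zero_closed A.M.zero_closed], of t] hK[OF A.M.zero_closed]
    by (simp add: zero_A)
  have "h a t = (\<Oplus>\<^bsub>K\<^esub>s\<in>S. h (single K \<one>\<^bsub>N\<^esub> (a s) \<odot>\<^bsub>A\<^esub> basis K s) t)"
    using a hK h0 by (intro expand_A[where \<phi> = "\<lambda>a. h a t"] K.abelian_monoid_axioms) (auto simp: add_A add)
  also have "\<dots> = (\<Oplus>\<^bsub>K\<^esub>s\<in>S. h (basis K s) t \<otimes>\<^bsub>K\<^esub> a s)"
    using a A_val basis_in_A hK scale scalar_A
    by (intro K.finsum_cong') (auto simp: K.m_comm)
  finally have "h a t \<cdot> v = (\<Oplus>\<^bsub>V\<^esub>s\<in>S. (h (basis K s) t \<otimes>\<^bsub>K\<^esub> a s) \<cdot> v)"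
    using a v A_val basis_in_A hK finite_S by (simp add: finsum_ldistr_V)
  also have "\<dots> = (\<Oplus>\<^bsub>V\<^esub>s\<in>S. h (basis K s) t \<cdot> (a s \<cdot> v))"
    using a v A_val basis_in_A hK V0.smult_assoc1 V0.smult_closed by (intro V.M.finsum_cong') auto
  finally show "tensor_map K N S V h (\<tau> a v) t = \<tau> (h a) v t"
    by (simp add: tensor_map_def pure_tensor_def)
qed

theorem tensor_functional_pure:
  assumes a: "a \<in> carrier A" and v: "v \<in> carrier V"
    and hK: "\<And>b. b \<in> carrier A \<Longrightarrow> h b \<in> carrier K"
    and add: "\<And>b c. \<lbrakk>b \<in> carrier A; c \<in> carrier A\<rbrakk> \<Longrightarrow> h (\<lambda>s. b s \<oplus>\<^bsub>K\<^esub> c s) = h b \<oplus>\<^bsub>K\<^esub> h c"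
    and scale: "\<And>k b. \<lbrakk>k \<in> carrier K; b \<in> carrier A\<rbrakk> \<Longrightarrow> h (\<lambda>s. k \<otimes>\<^bsub>K\<^esub> b s) = k \<otimes>\<^bsub>K\<^esub> h b"
  shows "tensor_functional K N S V h (\<tau> a v) = h a \<odot>\<^bsub>scalar_module K N V\<^esub> v"
proof -
  have "tensor_map K N S V (\<lambda>b (_ :: unit). h b) (\<tau> a v) = \<tau> (\<lambda>_. h a) v"
    using assms by (intro tensor_map_pure[where S' = UNIV]) (auto simp: fun_carrier_def)
  from fun_cong[OF this, of "()"] show ?thesis
    by (simp add: tensor_map_def tensor_functional_def pure_tensor_def)
qed

end


section \<open>Order complexes\<close>

text \<open>A \<open>q\<close>-simplex \<open>b\<^sub>0 < \<dots> < b\<^sub>q\<close> of the order complex of the poset \<open>P\<close> is represented by the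
  list of its vertices in increasing order.\<close>

definition order_simplices :: "'p set \<Rightarrow> ('p \<Rightarrow> 'p \<Rightarrow> bool) \<Rightarrow> nat \<Rightarrow> 'p list set" where
  "order_simplices P leq q =
     {c. length c = Suc q \<and> set c \<subseteq> P \<and> sorted_wrt (\<lambda>a b. leq a b \<and> a \<noteq> b) c}"

definition face :: "nat \<Rightarrow> 'p list \<Rightarrow> 'p list" where
  "face i c = take i c @ drop (Suc i) c"

text \<open>\<open>boundary K P leq q\<close> goes from degree \<open>q + 1\<close> to degree \<open>q\<close>.\<close>

definition boundary ::
  "('k, 'y) ring_scheme \<Rightarrow> 'p set \<Rightarrow> ('p \<Rightarrow> 'p \<Rightarrow> bool) \<Rightarrow> nat \<Rightarrow> ('p list \<Rightarrow> 'k) \<Rightarrow> 'p list \<Rightarrow> 'k"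
where
  "boundary K P leq q a = (\<lambda>d. \<Oplus>\<^bsub>K\<^esub>p\<in>{(c, i) \<in> order_simplices P leq (Suc q) \<times> {..Suc q}. face i c = d}.
     (\<ominus>\<^bsub>K\<^esub> \<one>\<^bsub>K\<^esub>) [^]\<^bsub>K\<^esub> snd p \<otimes>\<^bsub>K\<^esub> a (fst p))"

definition augmentation ::
  "('k, 'y) ring_scheme \<Rightarrow> 'p set \<Rightarrow> ('p \<Rightarrow> 'p \<Rightarrow> bool) \<Rightarrow> ('p list \<Rightarrow> 'k) \<Rightarrow> 'k"
where
  "augmentation K P leq a = (\<Oplus>\<^bsub>K\<^esub>c\<in>order_simplices P leq 0. a c)"


section \<open>The complex of a simple module\<close>

definition simplices_ge :: "('m, 'x) monoid_scheme \<Rightarrow> 'm set \<Rightarrow> nat \<Rightarrow> 'm list set" where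
  "simplices_ge M X q = order_simplices (idems_ge M X) (idem_le M) q"

definition simplex_act :: "('m, 'x) monoid_scheme \<Rightarrow> 'm \<Rightarrow> 'm list \<Rightarrow> 'm list option" where
  "simplex_act M m c =
     (let c' = map (\<lambda>b. m \<otimes>\<^bsub>M\<^esub> b \<otimes>\<^bsub>M\<^esub> dagger M m) c in if distinct c' then Some c' else None)"

definition chain_module ::
  "('k, 'y) ring_scheme \<Rightarrow> ('m, 'x) monoid_scheme \<Rightarrow> 'm set \<Rightarrow> nat \<Rightarrow> ('m \<Rightarrow> 'k, 'm list \<Rightarrow> 'k) module"
where
  "chain_module K M X q = basis_module K (monoid_ge M X) (simplices_ge M X q) (simplex_act M)"

text \<open>For a \<open>KM\<^bsub>\<ge>X\<^esub>\<close>-module \<open>V\<close>, the \<open>KM\<^bsub>\<ge>X\<^esub>\<close>-module \<open>C\<^sub>q(\<Delta>(B\<^bsub>\<ge>X\<^esub>), V)\<close> together with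
  its differential and augmentation.\<close>

definition coeff_chain_module ::
  "('k, 'y) ring_scheme \<Rightarrow> ('m, 'x) monoid_scheme \<Rightarrow> 'm set \<Rightarrow> ('m \<Rightarrow> 'k, 'v) module \<Rightarrow> nat \<Rightarrow>
   ('m \<Rightarrow> 'k, 'm list \<Rightarrow> 'v) module"
where
  "coeff_chain_module K M X V q =
     free_tensor K (monoid_ge M X) (simplices_ge M X q) (chain_module K M X q) V"

definition coeff_boundary ::
  "('k, 'y) ring_scheme \<Rightarrow> ('m, 'x) monoid_scheme \<Rightarrow> 'm set \<Rightarrow> ('m \<Rightarrow> 'k, 'v) module \<Rightarrow> nat \<Rightarrow>
   ('m list \<Rightarrow> 'v) \<Rightarrow> 'm list \<Rightarrow> 'v"
where
  "coeff_boundary K M X V q =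
     tensor_map K (monoid_ge M X) (simplices_ge M X (Suc q)) V
       (boundary K (idems_ge M X) (idem_le M) q)"

definition coeff_augmentation ::
  "('k, 'y) ring_scheme \<Rightarrow> ('m, 'x) monoid_scheme \<Rightarrow> 'm set \<Rightarrow> ('m \<Rightarrow> 'k, 'v) module \<Rightarrow>
   ('m list \<Rightarrow> 'v) \<Rightarrow> 'v"
where
  "coeff_augmentation K M X V =
     tensor_functional K (monoid_ge M X) (simplices_ge M X 0) V
       (augmentation K (idems_ge M X) (idem_le M))"

end

theory Submission
  imports Defs
begin

text \<open>Exactness is geometric: \<open>\<one>\<close> is the greatest element of \<open>B\<^bsub>\<ge>X\<^esub>\<close>, so the order complex is a
  cone and the augmented complex, with coefficients in any \<open>V\<close>, has the contraction that appends
  the vertex \<open>\<one>\<close> (\<open>cone_homotopy\<close>). The differentials are equivariant because the two faces of a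
  collapsed simplex that could survive cancel (\<open>face_sum_map\<close>).

  The substance is projectivity of \<open>C\<^sub>q \<otimes> V\<close>. Let \<open>t\<close> be the greatest vertex of a simplex \<open>c\<close>. If
  \<open>\<sigma> m \<ge> Bt\<close>, then \<open>m\<close> takes \<open>c\<close> to a simplex whose greatest vertex \<open>m t m\<^sup>\<dagger>\<close> has the same support
  \<open>Bt\<close>; otherwise \<open>mc\<close> is zero or its greatest vertex has smaller support. In particular the elements
  outside \<open>M\<^bsub>\<ge>X\<^esub>\<close>, which act as zero, belong to the second kind. Filtering by the support of the
  greatest vertex thus gives a filtration by submodules. In the layer of the support \<open>Y\<close>, choose an
  idempotent \<open>\<beta>\<close> with \<open>B\<beta> = Y\<close>, with maximal subgroup \<open>G\<close>. The layer is induced from the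
  \<open>KG\<close>-module spanned by the \<open>c \<otimes> v\<close> such that \<open>c\<close> has greatest vertex \<open>\<beta>\<close>: it is the tensor product
  over \<open>KG\<close> of this module with the span of the \<open>L\<close>-class \<open>\<sigma>\<^sup>-\<^sup>1(Y)\<close>, on which the \<open>m\<close> with
  \<open>\<sigma> m\<close> not above \<open>Y\<close> act as zero. That span is a projective \<open>KM\<close>-module: it is isomorphic to
  \<open>KM \<beta> z\<close> for an element \<open>z\<close> that is congruent to \<open>1\<close> modulo the span of these \<open>m\<close> and satisfies
  \<open>m z = 0\<close> for all of them (\<open>annihilated_element\<close>). By the hypothesis on the characteristic
  and Maschke's theorem, every \<open>KG\<close>-module is projective. So the layers are projective and the
  filtration splits. The rank, an integer that is strictly monotone in the support, treats all
  supports of the same rank in one step.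

  Written out, this says that every \<open>K\<close>-linear map \<open>\<mu>\<close> from \<open>P = C\<^sub>q \<otimes> V\<close> to a \<open>KM\<close>-module induces,
  on the part of \<open>P\<close> up to the support \<open>Y\<close>, the homomorphism that kills the lower part and maps
  \<open>c \<otimes> v\<close> in the layer of \<open>Y\<close> to the sum of the \<open>t k\<^sup>\<dagger> z \<mu> (k (c \<otimes> v))\<close>, over \<open>k \<in> G\<close>, divided by the
  order of \<open>G\<close> (\<open>spread_equivariant\<close>). The construction is natural in \<open>\<mu>\<close>, and for \<open>\<mu> = id\<close> it is
  the identity modulo the lower part (\<open>spread_complement\<close>). Applied to a \<open>K\<close>-linear lift of a given
  homomorphism, it therefore reduces the lifting problem to the lower part of the filtration
  (\<open>projective_from_lower_rank\<close>). The argument is carried out for any finite set with a partial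
  action of \<open>M\<close> and an equivariant map to the idempotents in place of the greatest vertex.\<close>

section \<open>Additive maps and finite sums\<close>

lemma (in abelian_monoid) finsum_delta:
  assumes "finite A" "\<And>a. a \<in> A \<Longrightarrow> f a \<in> carrier G"
  shows "(\<Oplus>a\<in>A. if a = x then f a else \<zero>) = (if x \<in> A then f x else \<zero>)"
proof (cases "x \<in> A")
  case True
  then show ?thesis using assms by (simp add: add.finprod_singleton_swap)
next
  case False
  then show ?thesis by (intro trans[OF add.finprod_one_eqI]) auto
qed

lemma (in abelian_monoid) finsum_if:
  assumes "finite A" "\<And>a. a \<in> A \<Longrightarrow> P a \<Longrightarrow> f a \<in> carrier G"
  shows "(\<Oplus>a\<in>A. if P a then f a else \<zero>) = (\<Oplus>a\<in>{a \<in> A. P a}. f a)"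
  using assms by (intro add.finprod_mono_neutral_cong_right) auto

lemma (in abelian_monoid) finsum_Times:
  assumes "finite A" "finite B" "\<And>a b. a \<in> A \<Longrightarrow> b \<in> B \<Longrightarrow> f (a, b) \<in> carrier G"
  shows "(\<Oplus>p\<in>A \<times> B. f p) = (\<Oplus>a\<in>A. \<Oplus>b\<in>B. f (a, b))"
  using assms(1,3)
proof (induction A rule: finite_induct)
  case (insert x A)
  have "(\<Oplus>p\<in>insert x A \<times> B. f p) = (\<Oplus>p\<in>Pair x ` B \<union> A \<times> B. f p)"
    by (rule arg_cong[where f = "finsum G f"]) auto
  also have "\<dots> = (\<Oplus>p\<in>Pair x ` B. f p) \<oplus> (\<Oplus>p\<in>A \<times> B. f p)"
    using insert assms(2) by (intro finsum_Un_disjoint) auto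
  also have "(\<Oplus>p\<in>Pair x ` B. f p) = (\<Oplus>b\<in>B. f (x, b))"
    using insert by (intro finsum_reindex) (auto simp: inj_on_def)
  finally show ?case
    using insert by (subst finsum_insert) (auto intro!: finsum_closed)
qed simp

lemma (in abelian_monoid) finsum2_add:
  assumes "\<And>a b. a \<in> A \<Longrightarrow> b \<in> B \<Longrightarrow> f a b \<in> carrier G"
    and "\<And>a b. a \<in> A \<Longrightarrow> b \<in> B \<Longrightarrow> g a b \<in> carrier G"
    and "\<And>a b. a \<in> A \<Longrightarrow> b \<in> B \<Longrightarrow> h a b = f a b \<oplus> g a b"
  shows "(\<Oplus>a\<in>A. \<Oplus>b\<in>B. h a b) = (\<Oplus>a\<in>A. \<Oplus>b\<in>B. f a b) \<oplus> (\<Oplus>a\<in>A. \<Oplus>b\<in>B. g a b)"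
proof -
  have "(\<Oplus>b\<in>B. h a b) = (\<Oplus>b\<in>B. f a b) \<oplus> (\<Oplus>b\<in>B. g a b)" if "a \<in> A" for a
  proof -
    have "(\<Oplus>b\<in>B. h a b) = (\<Oplus>b\<in>B. f a b \<oplus> g a b)"
      using that assms by (intro finsum_cong') auto
    also have "\<dots> = (\<Oplus>b\<in>B. f a b) \<oplus> (\<Oplus>b\<in>B. g a b)"
      using that assms by (intro finsum_addf) auto
    finally show ?thesis .
  qed
  then have "(\<Oplus>a\<in>A. \<Oplus>b\<in>B. h a b) = (\<Oplus>a\<in>A. (\<Oplus>b\<in>B. f a b) \<oplus> (\<Oplus>b\<in>B. g a b))"
    using assms by (intro finsum_cong') (auto intro!: finsum_closed)
  also have "\<dots> = (\<Oplus>a\<in>A. \<Oplus>b\<in>B. f a b) \<oplus> (\<Oplus>a\<in>A. \<Oplus>b\<in>B. g a b)"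
    using assms by (intro finsum_addf) (auto intro!: finsum_closed)
  finally show ?thesis .
qed

locale additive_map = A: abelian_group A + B: abelian_group B
  for A :: "('a, 'x) ring_scheme" and B :: "('b, 'y) ring_scheme" and h :: "'a \<Rightarrow> 'b" +
  assumes closed: "a \<in> carrier A \<Longrightarrow> h a \<in> carrier B"
    and add: "\<lbrakk>a \<in> carrier A; a' \<in> carrier A\<rbrakk> \<Longrightarrow> h (a \<oplus>\<^bsub>A\<^esub> a') = h a \<oplus>\<^bsub>B\<^esub> h a'"
begin

lemma zero: "h \<zero>\<^bsub>A\<^esub> = \<zero>\<^bsub>B\<^esub>"
  using add[of "\<zero>\<^bsub>A\<^esub>" "\<zero>\<^bsub>A\<^esub>"] closed[of "\<zero>\<^bsub>A\<^esub>"] by simp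

lemma minus: "a \<in> carrier A \<Longrightarrow> h (\<ominus>\<^bsub>A\<^esub> a) = \<ominus>\<^bsub>B\<^esub> h a"
  using add[of "\<ominus>\<^bsub>A\<^esub> a" a] closed[of a] closed[of "\<ominus>\<^bsub>A\<^esub> a"] zero
  by (intro B.minus_equality[symmetric]) (simp_all add: A.l_neg)

lemma diff: "\<lbrakk>a \<in> carrier A; b \<in> carrier A\<rbrakk> \<Longrightarrow> h (a \<ominus>\<^bsub>A\<^esub> b) = h a \<ominus>\<^bsub>B\<^esub> h b"
  by (simp add: A.minus_eq B.minus_eq add minus)

lemma finsum:
  assumes "\<And>i. i \<in> I \<Longrightarrow> F i \<in> carrier A"
  shows "h (\<Oplus>\<^bsub>A\<^esub>i\<in>I. F i) = (\<Oplus>\<^bsub>B\<^esub>i\<in>I. h (F i))"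
proof (cases "finite I")
  case True
  then show ?thesis using assms
    by (induction I rule: finite_induct) (auto simp: zero add closed Pi_def A.finsum_closed)
next
  case False
  then show ?thesis by (simp add: zero A.finsum_infinite B.finsum_infinite)
qed

end

lemma additive_mapD_lmod_hom:
  assumes "abelian_group A" "abelian_group B" "h \<in> lmod_hom R A B"
  shows "additive_map A B h"
  using assms by (auto simp: additive_map_def additive_map_axioms_def lmod_hom_def hom_def)

lemma additive_comp:
  "\<lbrakk>additive_map A B f; additive_map B C g\<rbrakk> \<Longrightarrow> additive_map A C (\<lambda>x. g (f x))"
  by (simp add: additive_map_def additive_map_axioms_def)

lemma additive_map_zero:
  assumes "abelian_group C" "abelian_group G"
  shows "additive_map C G (\<lambda>_. \<zero>\<^bsub>G\<^esub>)"
proof -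
  interpret C: abelian_group C by fact
  interpret G: abelian_group G by fact
  show ?thesis by unfold_locales simp_all
qed

lemma additive_map_add:
  assumes "additive_map C G f" "additive_map C G g"
  shows "additive_map C G (\<lambda>v. f v \<oplus>\<^bsub>G\<^esub> g v)"
proof -
  interpret f: additive_map C G f by fact
  interpret g: additive_map C G g by fact
  show ?thesis by unfold_locales (simp_all add: f.closed g.closed f.add g.add f.B.a_ac)
qed

lemma additive_map_diff:
  assumes "additive_map C G f" "additive_map C G g"
  shows "additive_map C G (\<lambda>v. f v \<ominus>\<^bsub>G\<^esub> g v)"
proof -
  interpret f: additive_map C G f by fact
  interpret g: additive_map C G g by fact
  show ?thesis
    by unfold_locales (simp_all add: f.closed g.closed f.add g.add f.B.minus_eq f.B.minus_add f.B.a_ac)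
qed

lemma additive_finsum_maps:
  assumes "abelian_group C" "abelian_group D" "\<And>i. i \<in> J \<Longrightarrow> additive_map C D (F i)"
  shows "additive_map C D (\<lambda>x. \<Oplus>\<^bsub>D\<^esub>i\<in>J. F i x)"
proof -
  interpret C: abelian_group C by fact
  interpret D: abelian_group D by fact
  note cl = additive_map.closed[OF assms(3)] and ad = additive_map.add[OF assms(3)]
  show ?thesis
  proof
    fix x y assume xy: "x \<in> carrier C" "y \<in> carrier C"
    have "(\<Oplus>\<^bsub>D\<^esub>i\<in>J. F i (x \<oplus>\<^bsub>C\<^esub> y)) = (\<Oplus>\<^bsub>D\<^esub>i\<in>J. F i x \<oplus>\<^bsub>D\<^esub> F i y)"
      using xy cl ad by (intro D.finsum_cong') auto
    also have "\<dots> = (\<Oplus>\<^bsub>D\<^esub>i\<in>J. F i x) \<oplus>\<^bsub>D\<^esub> (\<Oplus>\<^bsub>D\<^esub>i\<in>J. F i y)"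
      using xy cl by (intro D.finsum_addf) auto
    finally show "(\<Oplus>\<^bsub>D\<^esub>i\<in>J. F i (x \<oplus>\<^bsub>C\<^esub> y)) = (\<Oplus>\<^bsub>D\<^esub>i\<in>J. F i x) \<oplus>\<^bsub>D\<^esub> (\<Oplus>\<^bsub>D\<^esub>i\<in>J. F i y)" .
  qed (use cl in \<open>auto intro!: D.finsum_closed\<close>)
qed

text \<open>The functions \<open>S \<rightarrow> V\<close>, extended by zero, form an abelian group whenever \<open>V\<close> does; any
  record that carries the pointwise operations is an instance.\<close>

locale function_group = V: abelian_group V
  for V :: "('v, 'x) ring_scheme" and S :: "'s set" and P :: "('s \<Rightarrow> 'v, 'y) ring_scheme" +
  assumes finite_S: "finite S"
    and carrier_P: "carrier P = fun_carrier S V"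
    and add_P: "add P = (\<lambda>f g s. f s \<oplus>\<^bsub>V\<^esub> g s)"
    and zero_P: "zero P = (\<lambda>_. \<zero>\<^bsub>V\<^esub>)"
begin

lemma val_closed: "f \<in> carrier P \<Longrightarrow> f s \<in> carrier V"
  by (auto simp: carrier_P fun_carrier_def)

lemma val_outside: "f \<in> carrier P \<Longrightarrow> s \<notin> S \<Longrightarrow> f s = \<zero>\<^bsub>V\<^esub>"
  by (auto simp: carrier_P fun_carrier_def)

lemma in_carrierI: "\<lbrakk>\<And>s. f s \<in> carrier V; \<And>s. s \<notin> S \<Longrightarrow> f s = \<zero>\<^bsub>V\<^esub>\<rbrakk> \<Longrightarrow> f \<in> carrier P"
  by (auto simp: carrier_P fun_carrier_def)

lemma single_in: "s \<in> S \<Longrightarrow> v \<in> carrier V \<Longrightarrow> single V s v \<in> carrier P"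
  by (rule in_carrierI) (auto simp: single_def)

sublocale P: abelian_group P
proof (rule abelian_groupI)
  show "x \<oplus>\<^bsub>P\<^esub> y \<in> carrier P" if "x \<in> carrier P" "y \<in> carrier P" for x y
    using that by (intro in_carrierI) (simp_all add: add_P val_closed val_outside)
  show "\<zero>\<^bsub>P\<^esub> \<in> carrier P" by (intro in_carrierI) (simp_all add: zero_P)
  show "x \<oplus>\<^bsub>P\<^esub> y \<oplus>\<^bsub>P\<^esub> z = x \<oplus>\<^bsub>P\<^esub> (y \<oplus>\<^bsub>P\<^esub> z)"
    if "x \<in> carrier P" "y \<in> carrier P" "z \<in> carrier P" for x y z
    using that by (simp add: add_P V.a_assoc val_closed)
  show "x \<oplus>\<^bsub>P\<^esub> y = y \<oplus>\<^bsub>P\<^esub> x" if "x \<in> carrier P" "y \<in> carrier P" for x y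
    using that by (simp add: add_P V.a_comm val_closed)
  show "\<zero>\<^bsub>P\<^esub> \<oplus>\<^bsub>P\<^esub> x = x" if "x \<in> carrier P" for x
    using that by (simp add: add_P zero_P val_closed)
  show "\<exists>y\<in>carrier P. y \<oplus>\<^bsub>P\<^esub> x = \<zero>\<^bsub>P\<^esub>" if x: "x \<in> carrier P" for x
  proof
    show "(\<lambda>s. \<ominus>\<^bsub>V\<^esub> x s) \<in> carrier P"
      using x by (intro in_carrierI) (simp_all add: val_closed val_outside)
    show "(\<lambda>s. \<ominus>\<^bsub>V\<^esub> x s) \<oplus>\<^bsub>P\<^esub> x = \<zero>\<^bsub>P\<^esub>"
      using x by (simp add: add_P zero_P V.l_neg val_closed)
  qed
qed

lemma additive_val: "additive_map P V (\<lambda>f. f s)"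
  by unfold_locales (simp_all add: val_closed add_P)

lemma finsum_val:
  assumes "\<And>i. i \<in> I \<Longrightarrow> F i \<in> carrier P"
  shows "(\<Oplus>\<^bsub>P\<^esub>i\<in>I. F i) s = (\<Oplus>\<^bsub>V\<^esub>i\<in>I. F i s)"
  using additive_map.finsum[OF additive_val assms] .

lemma minus_val: "f \<in> carrier P \<Longrightarrow> (\<ominus>\<^bsub>P\<^esub> f) s = \<ominus>\<^bsub>V\<^esub> f s"
  using additive_map.minus[OF additive_val] .

lemma additive_single: "s \<in> S \<Longrightarrow> additive_map V P (single V s)"
  by unfold_locales (simp add: single_in, rule ext, simp add: add_P single_def)

lemma additive_expand:
  assumes "additive_map P W \<phi>" "f \<in> carrier P"
  shows "\<phi> f = (\<Oplus>\<^bsub>W\<^esub>s\<in>S. \<phi> (single V s (f s)))"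
proof -
  interpret \<phi>: additive_map P W \<phi> by fact
  show ?thesis
    using assms(2) \<phi>.closed \<phi>.add \<phi>.zero
    by (intro V.fun_carrier_expand finite_S \<phi>.B.abelian_monoid_axioms)
      (auto simp: carrier_P add_P zero_P)
qed

lemma additive_eqI:
  assumes "additive_map P W \<phi>" "additive_map P W \<psi>"
    and "\<And>s v. \<lbrakk>s \<in> S; v \<in> carrier V\<rbrakk> \<Longrightarrow> \<phi> (single V s v) = \<psi> (single V s v)"
    and "f \<in> carrier P"
  shows "\<phi> f = \<psi> f"
proof -
  interpret \<psi>: additive_map P W \<psi> by fact
  show ?thesis
    unfolding additive_expand[OF assms(1,4)] additive_expand[OF assms(2,4)]
    using assms(3,4) \<psi>.closed single_in val_closed by (intro \<psi>.B.finsum_cong') auto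
qed

text \<open>\<open>P\<close> is a direct sum of copies of \<open>V\<close>, so additive maps out of \<open>P\<close> can be prescribed freely on
  the elements \<open>single V s v\<close>.\<close>

lemma additive_family:
  assumes "abelian_group W" "\<And>s. s \<in> S \<Longrightarrow> additive_map V W (\<psi> s)"
  shows "additive_map P W (\<lambda>f. \<Oplus>\<^bsub>W\<^esub>s\<in>S. \<psi> s (f s))"
proof -
  interpret W: abelian_group W by fact
  have cl: "\<psi> s v \<in> carrier W" if "s \<in> S" "v \<in> carrier V" for s v
    using assms(2) that by (auto dest: additive_map.closed)
  show ?thesis
  proof
    fix f assume f: "f \<in> carrier P"
    then show "(\<Oplus>\<^bsub>W\<^esub>s\<in>S. \<psi> s (f s)) \<in> carrier W" using cl val_closed by (intro W.finsum_closed) auto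
  next
    fix f g assume fg: "f \<in> carrier P" "g \<in> carrier P"
    have "(\<Oplus>\<^bsub>W\<^esub>s\<in>S. \<psi> s ((f \<oplus>\<^bsub>P\<^esub> g) s)) = (\<Oplus>\<^bsub>W\<^esub>s\<in>S. \<psi> s (f s) \<oplus>\<^bsub>W\<^esub> \<psi> s (g s))"
      using fg cl val_closed additive_map.add[OF assms(2)] by (intro W.finsum_cong') (auto simp: add_P)
    also have "\<dots> = (\<Oplus>\<^bsub>W\<^esub>s\<in>S. \<psi> s (f s)) \<oplus>\<^bsub>W\<^esub> (\<Oplus>\<^bsub>W\<^esub>s\<in>S. \<psi> s (g s))"
      using fg cl val_closed by (intro W.finsum_addf) auto
    finally show "(\<Oplus>\<^bsub>W\<^esub>s\<in>S. \<psi> s ((f \<oplus>\<^bsub>P\<^esub> g) s)) =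
        (\<Oplus>\<^bsub>W\<^esub>s\<in>S. \<psi> s (f s)) \<oplus>\<^bsub>W\<^esub> (\<Oplus>\<^bsub>W\<^esub>s\<in>S. \<psi> s (g s))" .
  qed
qed

lemma family_single:
  assumes "\<And>s. s \<in> S \<Longrightarrow> additive_map V W (\<psi> s)" "s \<in> S" "v \<in> carrier V"
  shows "(\<Oplus>\<^bsub>W\<^esub>t\<in>S. \<psi> t (single V s v t)) = \<psi> s v"
proof -
  interpret W: abelian_group W using assms by (meson additive_map.axioms(2))
  have "(\<Oplus>\<^bsub>W\<^esub>t\<in>S. \<psi> t (single V s v t)) = (\<Oplus>\<^bsub>W\<^esub>t\<in>S. if t = s then \<psi> t v else \<zero>\<^bsub>W\<^esub>)"
    using assms additive_map.zero[OF assms(1)] additive_map.closed[OF assms(1)]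
    by (intro W.finsum_cong') (auto simp: single_def)
  also have "\<dots> = \<psi> s v"
    using assms finite_S additive_map.closed[OF assms(1)] by (subst W.finsum_delta) auto
  finally show ?thesis .
qed

end

section \<open>Modules over the algebra of a finite monoid\<close>

locale finite_monoid_algebra = K: cring K + N: monoid N
  for K :: "('k, 'y) ring_scheme" and N :: "('m, 'x) monoid_scheme" +
  assumes finite_N: "finite (carrier N)"
begin

abbreviation R where "R \<equiv> monoid_algebra K N"

sublocale KN: function_group K "carrier N" R
proof
  have "finite {m. \<alpha> m \<noteq> \<zero>\<^bsub>K\<^esub>}" if "{m. \<alpha> m \<noteq> \<zero>\<^bsub>K\<^esub>} \<subseteq> carrier N" for \<alpha> :: "'m \<Rightarrow> 'k"
    using that finite_N finite_subset by blast
  then show "carrier R = fun_carrier (carrier N) K"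
    by (auto simp: monoid_algebra_def fun_carrier_def)
qed (simp_all add: monoid_algebra_def finite_N)

lemma mult_val:
  assumes "\<alpha> \<in> carrier R" "\<beta> \<in> carrier R"
  shows "(\<alpha> \<otimes>\<^bsub>R\<^esub> \<beta>) x =
    (\<Oplus>\<^bsub>K\<^esub>y\<in>carrier N. \<Oplus>\<^bsub>K\<^esub>z\<in>carrier N. if y \<otimes>\<^bsub>N\<^esub> z = x then \<alpha> y \<otimes>\<^bsub>K\<^esub> \<beta> z else \<zero>\<^bsub>K\<^esub>)"
proof -
  note cl = KN.val_closed[OF assms(1)] KN.val_closed[OF assms(2)]
  note out = KN.val_outside[OF assms(1)] KN.val_outside[OF assms(2)]
  have "(\<alpha> \<otimes>\<^bsub>R\<^esub> \<beta>) x = (\<Oplus>\<^bsub>K\<^esub>p\<in>{(y, z). \<alpha> y \<noteq> \<zero>\<^bsub>K\<^esub> \<and> \<beta> z \<noteq> \<zero>\<^bsub>K\<^esub> \<and> y \<otimes>\<^bsub>N\<^esub> z = x}.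
      \<alpha> (fst p) \<otimes>\<^bsub>K\<^esub> \<beta> (snd p))"
    by (simp add: monoid_algebra_def)
  also have "\<dots> = (\<Oplus>\<^bsub>K\<^esub>p\<in>carrier N \<times> carrier N.
      if fst p \<otimes>\<^bsub>N\<^esub> snd p = x then \<alpha> (fst p) \<otimes>\<^bsub>K\<^esub> \<beta> (snd p) else \<zero>\<^bsub>K\<^esub>)"
  proof (rule K.add.finprod_mono_neutral_cong_left)
    show "finite (carrier N \<times> carrier N)" using finite_N by simp
    show "{(y, z). \<alpha> y \<noteq> \<zero>\<^bsub>K\<^esub> \<and> \<beta> z \<noteq> \<zero>\<^bsub>K\<^esub> \<and> y \<otimes>\<^bsub>N\<^esub> z = x} \<subseteq> carrier N \<times> carrier N"
      using out by blast
    show "(if fst p \<otimes>\<^bsub>N\<^esub> snd p = x then \<alpha> (fst p) \<otimes>\<^bsub>K\<^esub> \<beta> (snd p) else \<zero>\<^bsub>K\<^esub>) = \<zero>\<^bsub>K\<^esub>"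
      if "p \<in> carrier N \<times> carrier N - {(y, z). \<alpha> y \<noteq> \<zero>\<^bsub>K\<^esub> \<and> \<beta> z \<noteq> \<zero>\<^bsub>K\<^esub> \<and> y \<otimes>\<^bsub>N\<^esub> z = x}" for p
      using that cl by (cases p) auto
  qed (use cl in auto)
  also have "\<dots> = (\<Oplus>\<^bsub>K\<^esub>y\<in>carrier N. \<Oplus>\<^bsub>K\<^esub>z\<in>carrier N. if y \<otimes>\<^bsub>N\<^esub> z = x then \<alpha> y \<otimes>\<^bsub>K\<^esub> \<beta> z else \<zero>\<^bsub>K\<^esub>)"
    using finite_N cl by (subst K.finsum_Times) (auto cong: if_cong)
  finally show ?thesis .
qed

lemma mult_closed: "\<lbrakk>\<alpha> \<in> carrier R; \<beta> \<in> carrier R\<rbrakk> \<Longrightarrow> \<alpha> \<otimes>\<^bsub>R\<^esub> \<beta> \<in> carrier R"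
proof (rule KN.in_carrierI)
  fix x assume *: "\<alpha> \<in> carrier R" "\<beta> \<in> carrier R"
  note cl = KN.val_closed[OF *(1)] KN.val_closed[OF *(2)]
  show "(\<alpha> \<otimes>\<^bsub>R\<^esub> \<beta>) x \<in> carrier K"
    unfolding mult_val[OF *] using cl by (intro K.finsum_closed) (auto intro!: K.finsum_closed)
  show "(\<alpha> \<otimes>\<^bsub>R\<^esub> \<beta>) x = \<zero>\<^bsub>K\<^esub>" if "x \<notin> carrier N"
    unfolding mult_val[OF *] using that
    by (intro K.add.finprod_one_eqI) (auto simp: N.m_closed intro!: K.add.finprod_one_eqI)
qed

lemma mult_add:
  assumes "\<alpha> \<in> carrier R" "\<beta> \<in> carrier R" "\<gamma> \<in> carrier R"
  shows "(\<alpha> \<oplus>\<^bsub>R\<^esub> \<beta>) \<otimes>\<^bsub>R\<^esub> \<gamma> = \<alpha> \<otimes>\<^bsub>R\<^esub> \<gamma> \<oplus>\<^bsub>R\<^esub> \<beta> \<otimes>\<^bsub>R\<^esub> \<gamma>"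
    and "\<gamma> \<otimes>\<^bsub>R\<^esub> (\<alpha> \<oplus>\<^bsub>R\<^esub> \<beta>) = \<gamma> \<otimes>\<^bsub>R\<^esub> \<alpha> \<oplus>\<^bsub>R\<^esub> \<gamma> \<otimes>\<^bsub>R\<^esub> \<beta>"
proof -
  note cl = KN.val_closed[OF assms(1)] KN.val_closed[OF assms(2)] KN.val_closed[OF assms(3)]
  note ca = KN.P.a_closed[OF assms(1,2)]
  show "(\<alpha> \<oplus>\<^bsub>R\<^esub> \<beta>) \<otimes>\<^bsub>R\<^esub> \<gamma> = \<alpha> \<otimes>\<^bsub>R\<^esub> \<gamma> \<oplus>\<^bsub>R\<^esub> \<beta> \<otimes>\<^bsub>R\<^esub> \<gamma>"
  proof
    fix x
    have "((\<alpha> \<oplus>\<^bsub>R\<^esub> \<beta>) \<otimes>\<^bsub>R\<^esub> \<gamma>) x = (\<alpha> \<otimes>\<^bsub>R\<^esub> \<gamma>) x \<oplus>\<^bsub>K\<^esub> (\<beta> \<otimes>\<^bsub>R\<^esub> \<gamma>) x"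
      unfolding mult_val[OF ca assms(3)] mult_val[OF assms(1,3)] mult_val[OF assms(2,3)]
      by (rule K.finsum2_add) (auto simp: KN.add_P cl K.l_distr)
    then show "((\<alpha> \<oplus>\<^bsub>R\<^esub> \<beta>) \<otimes>\<^bsub>R\<^esub> \<gamma>) x = (\<alpha> \<otimes>\<^bsub>R\<^esub> \<gamma> \<oplus>\<^bsub>R\<^esub> \<beta> \<otimes>\<^bsub>R\<^esub> \<gamma>) x"
      by (simp add: KN.add_P)
  qed
  show "\<gamma> \<otimes>\<^bsub>R\<^esub> (\<alpha> \<oplus>\<^bsub>R\<^esub> \<beta>) = \<gamma> \<otimes>\<^bsub>R\<^esub> \<alpha> \<oplus>\<^bsub>R\<^esub> \<gamma> \<otimes>\<^bsub>R\<^esub> \<beta>"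
  proof
    fix x
    have "(\<gamma> \<otimes>\<^bsub>R\<^esub> (\<alpha> \<oplus>\<^bsub>R\<^esub> \<beta>)) x = (\<gamma> \<otimes>\<^bsub>R\<^esub> \<alpha>) x \<oplus>\<^bsub>K\<^esub> (\<gamma> \<otimes>\<^bsub>R\<^esub> \<beta>) x"
      unfolding mult_val[OF assms(3) ca] mult_val[OF assms(3,1)] mult_val[OF assms(3,2)]
      by (rule K.finsum2_add) (auto simp: KN.add_P cl K.r_distr)
    then show "(\<gamma> \<otimes>\<^bsub>R\<^esub> (\<alpha> \<oplus>\<^bsub>R\<^esub> \<beta>)) x = (\<gamma> \<otimes>\<^bsub>R\<^esub> \<alpha> \<oplus>\<^bsub>R\<^esub> \<gamma> \<otimes>\<^bsub>R\<^esub> \<beta>) x"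
      by (simp add: KN.add_P)
  qed
qed

lemma additive_mult_left: "\<gamma> \<in> carrier R \<Longrightarrow> additive_map R R (\<lambda>\<alpha>. \<gamma> \<otimes>\<^bsub>R\<^esub> \<alpha>)"
  by unfold_locales (simp_all add: mult_closed mult_add)

lemma additive_mult_right: "\<gamma> \<in> carrier R \<Longrightarrow> additive_map R R (\<lambda>\<alpha>. \<alpha> \<otimes>\<^bsub>R\<^esub> \<gamma>)"
  by unfold_locales (simp_all add: mult_closed mult_add)

lemmas mult_single = single_mult[OF K.ring_axioms, of _ _ N]

lemma one_R: "\<one>\<^bsub>R\<^esub> = basis K \<one>\<^bsub>N\<^esub>"
  by (simp add: monoid_algebra_def)

lemma additive_id: "additive_map R R (\<lambda>\<alpha>. \<alpha>)"
  by unfold_locales simp_all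

text \<open>All ring laws are additive in each argument, so it suffices to check them on multiples of
  monoid elements.\<close>

sublocale R: ring R
proof (rule ringI)
  show "abelian_group R" by (rule KN.P.abelian_group_axioms)
  note s = KN.single_in
  have sss: "(\<alpha> \<otimes>\<^bsub>R\<^esub> \<beta>) \<otimes>\<^bsub>R\<^esub> \<gamma> = \<alpha> \<otimes>\<^bsub>R\<^esub> (\<beta> \<otimes>\<^bsub>R\<^esub> \<gamma>)"
    if a: "\<alpha> \<in> carrier R" and b: "\<beta> \<in> carrier R" and c: "\<gamma> \<in> carrier R" for \<alpha> \<beta> \<gamma>
  proof (rule KN.additive_eqI[OF _ _ _ a])
    show "additive_map R R (\<lambda>\<alpha>. (\<alpha> \<otimes>\<^bsub>R\<^esub> \<beta>) \<otimes>\<^bsub>R\<^esub> \<gamma>)"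
      by (rule additive_comp[OF additive_mult_right[OF b] additive_mult_right[OF c]])
    show "additive_map R R (\<lambda>\<alpha>. \<alpha> \<otimes>\<^bsub>R\<^esub> (\<beta> \<otimes>\<^bsub>R\<^esub> \<gamma>))"
      by (rule additive_mult_right[OF mult_closed[OF b c]])
    fix m k assume m: "m \<in> carrier N" "k \<in> carrier K"
    show "(single K m k \<otimes>\<^bsub>R\<^esub> \<beta>) \<otimes>\<^bsub>R\<^esub> \<gamma> = single K m k \<otimes>\<^bsub>R\<^esub> (\<beta> \<otimes>\<^bsub>R\<^esub> \<gamma>)"
    proof (rule KN.additive_eqI[OF _ _ _ b])
      show "additive_map R R (\<lambda>\<beta>. (single K m k \<otimes>\<^bsub>R\<^esub> \<beta>) \<otimes>\<^bsub>R\<^esub> \<gamma>)"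
        by (rule additive_comp[OF additive_mult_left[OF s[OF m]] additive_mult_right[OF c]])
      show "additive_map R R (\<lambda>\<beta>. single K m k \<otimes>\<^bsub>R\<^esub> (\<beta> \<otimes>\<^bsub>R\<^esub> \<gamma>))"
        by (rule additive_comp[OF additive_mult_right[OF c] additive_mult_left[OF s[OF m]]])
      fix n l assume n: "n \<in> carrier N" "l \<in> carrier K"
      have mn: "m \<otimes>\<^bsub>N\<^esub> n \<in> carrier N" "k \<otimes>\<^bsub>K\<^esub> l \<in> carrier K" using m n by auto
      show "(single K m k \<otimes>\<^bsub>R\<^esub> single K n l) \<otimes>\<^bsub>R\<^esub> \<gamma> = single K m k \<otimes>\<^bsub>R\<^esub> (single K n l \<otimes>\<^bsub>R\<^esub> \<gamma>)"
        unfolding mult_single[OF m(2) n(2)]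
      proof (rule KN.additive_eqI[OF _ _ _ c])
        show "additive_map R R (\<lambda>\<gamma>. single K (m \<otimes>\<^bsub>N\<^esub> n) (k \<otimes>\<^bsub>K\<^esub> l) \<otimes>\<^bsub>R\<^esub> \<gamma>)"
          by (rule additive_mult_left[OF s[OF mn]])
        show "additive_map R R (\<lambda>\<gamma>. single K m k \<otimes>\<^bsub>R\<^esub> (single K n l \<otimes>\<^bsub>R\<^esub> \<gamma>))"
          by (rule additive_comp[OF additive_mult_left[OF s[OF n]] additive_mult_left[OF s[OF m]]])
        fix p j assume p: "p \<in> carrier N" "j \<in> carrier K"
        then show "single K (m \<otimes>\<^bsub>N\<^esub> n) (k \<otimes>\<^bsub>K\<^esub> l) \<otimes>\<^bsub>R\<^esub> single K p j =
            single K m k \<otimes>\<^bsub>R\<^esub> (single K n l \<otimes>\<^bsub>R\<^esub> single K p j)"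
          using m n mn by (simp add: mult_single N.m_assoc K.m_assoc)
      qed
    qed
  qed
  have oc: "\<one>\<^bsub>R\<^esub> \<in> carrier R" unfolding one_R by (rule s) auto
  show "monoid R"
  proof (rule monoidI)
    fix \<alpha> assume a: "\<alpha> \<in> carrier R"
    show "\<one>\<^bsub>R\<^esub> \<otimes>\<^bsub>R\<^esub> \<alpha> = \<alpha>"
      by (rule KN.additive_eqI[OF additive_mult_left[OF oc] additive_id _ a])
        (simp add: one_R mult_single)
    show "\<alpha> \<otimes>\<^bsub>R\<^esub> \<one>\<^bsub>R\<^esub> = \<alpha>"
      by (rule KN.additive_eqI[OF additive_mult_right[OF oc] additive_id _ a])
        (simp add: one_R mult_single)
  qed (use sss oc mult_closed in auto)
qed (simp_all add: mult_add)

lemma basis_in: "m \<in> carrier N \<Longrightarrow> basis K m \<in> carrier R"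
  by (simp add: KN.single_in)

lemma left_moduleI:
  assumes "abelian_group W"
    and cl: "\<And>\<alpha> w. \<lbrakk>\<alpha> \<in> carrier R; w \<in> carrier W\<rbrakk> \<Longrightarrow> \<alpha> \<odot>\<^bsub>W\<^esub> w \<in> carrier W"
    and l: "\<And>\<alpha> \<beta> w. \<lbrakk>\<alpha> \<in> carrier R; \<beta> \<in> carrier R; w \<in> carrier W\<rbrakk> \<Longrightarrow>
      (\<alpha> \<oplus>\<^bsub>R\<^esub> \<beta>) \<odot>\<^bsub>W\<^esub> w = \<alpha> \<odot>\<^bsub>W\<^esub> w \<oplus>\<^bsub>W\<^esub> \<beta> \<odot>\<^bsub>W\<^esub> w"
    and r: "\<And>\<alpha> w w'. \<lbrakk>\<alpha> \<in> carrier R; w \<in> carrier W; w' \<in> carrier W\<rbrakk> \<Longrightarrow>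
      \<alpha> \<odot>\<^bsub>W\<^esub> (w \<oplus>\<^bsub>W\<^esub> w') = \<alpha> \<odot>\<^bsub>W\<^esub> w \<oplus>\<^bsub>W\<^esub> \<alpha> \<odot>\<^bsub>W\<^esub> w'"
    and one: "\<And>w. w \<in> carrier W \<Longrightarrow> basis K \<one>\<^bsub>N\<^esub> \<odot>\<^bsub>W\<^esub> w = w"
    and mult: "\<And>m n k j w. \<lbrakk>m \<in> carrier N; n \<in> carrier N; k \<in> carrier K; j \<in> carrier K; w \<in> carrier W\<rbrakk> \<Longrightarrow>
      single K (m \<otimes>\<^bsub>N\<^esub> n) (k \<otimes>\<^bsub>K\<^esub> j) \<odot>\<^bsub>W\<^esub> w = single K m k \<odot>\<^bsub>W\<^esub> (single K n j \<odot>\<^bsub>W\<^esub> w)"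
  shows "left_module R W"
proof -
  interpret W: abelian_group W by fact
  have aw: "additive_map R W (\<lambda>\<alpha>. \<alpha> \<odot>\<^bsub>W\<^esub> w)" if "w \<in> carrier W" for w
    using that by unfold_locales (simp_all add: cl l)
  have sw: "additive_map W W (\<lambda>w. \<alpha> \<odot>\<^bsub>W\<^esub> w)" if "\<alpha> \<in> carrier R" for \<alpha>
    using that by unfold_locales (simp_all add: cl r)
  have "(\<alpha> \<otimes>\<^bsub>R\<^esub> \<beta>) \<odot>\<^bsub>W\<^esub> w = \<alpha> \<odot>\<^bsub>W\<^esub> (\<beta> \<odot>\<^bsub>W\<^esub> w)"
    if a: "\<alpha> \<in> carrier R" and b: "\<beta> \<in> carrier R" and w: "w \<in> carrier W" for \<alpha> \<beta> w
  proof (rule KN.additive_eqI[OF _ _ _ a])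
    show "additive_map R W (\<lambda>\<alpha>. (\<alpha> \<otimes>\<^bsub>R\<^esub> \<beta>) \<odot>\<^bsub>W\<^esub> w)"
      by (rule additive_comp[OF additive_mult_right[OF b] aw[OF w]])
    show "additive_map R W (\<lambda>\<alpha>. \<alpha> \<odot>\<^bsub>W\<^esub> (\<beta> \<odot>\<^bsub>W\<^esub> w))"
      by (rule aw[OF cl[OF b w]])
    fix m k assume m: "m \<in> carrier N" "k \<in> carrier K"
    note sm = KN.single_in[OF m]
    show "(single K m k \<otimes>\<^bsub>R\<^esub> \<beta>) \<odot>\<^bsub>W\<^esub> w = single K m k \<odot>\<^bsub>W\<^esub> (\<beta> \<odot>\<^bsub>W\<^esub> w)"
    proof (rule KN.additive_eqI[OF _ _ _ b])
      show "additive_map R W (\<lambda>\<beta>. (single K m k \<otimes>\<^bsub>R\<^esub> \<beta>) \<odot>\<^bsub>W\<^esub> w)"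
        by (rule additive_comp[OF additive_mult_left[OF sm] aw[OF w]])
      show "additive_map R W (\<lambda>\<beta>. single K m k \<odot>\<^bsub>W\<^esub> (\<beta> \<odot>\<^bsub>W\<^esub> w))"
        by (rule additive_comp[OF aw[OF w] sw[OF sm]])
    qed (use m w mult mult_single in auto)
  qed
  then show ?thesis
    using cl l r one
    by (intro left_module.intro left_module_axioms.intro R.ring_axioms assms(1)) (auto simp: one_R)
qed

end

text \<open>A module over \<open>KN\<close> is determined by its scalar multiplication and the operators given by the
  elements of \<open>N\<close>; all later verifications are made on these two.\<close>

locale algebra_module = finite_monoid_algebra K N + A: left_module "monoid_algebra K N" A
  for K :: "('k, 'y) ring_scheme" and N :: "('m, 'x) monoid_scheme"
    and A :: "('m \<Rightarrow> 'k, 'a) module"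
begin

abbreviation sc (infixr "\<cdot>" 75) where "sc k a \<equiv> single K \<one>\<^bsub>N\<^esub> k \<odot>\<^bsub>A\<^esub> a"
abbreviation op (infixr "\<star>" 75) where "op m a \<equiv> basis K m \<odot>\<^bsub>A\<^esub> a"

lemma additive_smult: "\<alpha> \<in> carrier R \<Longrightarrow> additive_map A A (\<lambda>a. \<alpha> \<odot>\<^bsub>A\<^esub> a)"
  by unfold_locales (simp_all add: A.smult_r_distr)

lemma additive_algebra: "a \<in> carrier A \<Longrightarrow> additive_map R A (\<lambda>\<alpha>. \<alpha> \<odot>\<^bsub>A\<^esub> a)"
  by unfold_locales (simp_all add: A.smult_l_distr)

lemma sc_closed [simp]: "k \<in> carrier K \<Longrightarrow> a \<in> carrier A \<Longrightarrow> k \<cdot> a \<in> carrier A"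
  by (simp add: KN.single_in)

lemma op_closed [simp]: "m \<in> carrier N \<Longrightarrow> a \<in> carrier A \<Longrightarrow> m \<star> a \<in> carrier A"
  by (simp add: KN.single_in)

lemma single_smult:
  "\<lbrakk>m \<in> carrier N; k \<in> carrier K; a \<in> carrier A\<rbrakk> \<Longrightarrow> single K m k \<odot>\<^bsub>A\<^esub> a = k \<cdot> (m \<star> a)"
  using A.smult_assoc1[of "single K \<one>\<^bsub>N\<^esub> k" "basis K m" a]
  by (simp add: KN.single_in mult_single)

lemma op_mult: "\<lbrakk>m \<in> carrier N; n \<in> carrier N; a \<in> carrier A\<rbrakk> \<Longrightarrow> (m \<otimes>\<^bsub>N\<^esub> n) \<star> a = m \<star> (n \<star> a)"
  using A.smult_assoc1[of "basis K m" "basis K n" a] by (simp add: KN.single_in mult_single)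

lemma op_one: "a \<in> carrier A \<Longrightarrow> \<one>\<^bsub>N\<^esub> \<star> a = a"
  using A.smult_one[of a] by (simp add: one_R)

lemma smult_expand:
  "\<lbrakk>\<alpha> \<in> carrier R; a \<in> carrier A\<rbrakk> \<Longrightarrow> \<alpha> \<odot>\<^bsub>A\<^esub> a = (\<Oplus>\<^bsub>A\<^esub>m\<in>carrier N. single K m (\<alpha> m) \<odot>\<^bsub>A\<^esub> a)"
  by (rule KN.additive_expand[OF additive_algebra])

lemma scalars: "module K (scalar_module K N A)"
proof (rule moduleI)
  show "cring K" by (rule K.is_cring)
  show "abelian_group (scalar_module K N A)"
    by (rule abelian_groupI)
      (auto simp: A.M.a_ac intro: bexI[where x = "\<ominus>\<^bsub>A\<^esub> x" for x] A.M.l_neg)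
  fix k j a assume *: "k \<in> carrier K" "j \<in> carrier K" "a \<in> carrier (scalar_module K N A)"
  have "k \<cdot> (j \<cdot> a) = (k \<otimes>\<^bsub>K\<^esub> j) \<cdot> a"
    using A.smult_assoc1[of "single K \<one>\<^bsub>N\<^esub> k" "single K \<one>\<^bsub>N\<^esub> j" a] *
    by (simp add: KN.single_in mult_single)
  then show "(k \<otimes>\<^bsub>K\<^esub> j) \<odot>\<^bsub>scalar_module K N A\<^esub> a =
      k \<odot>\<^bsub>scalar_module K N A\<^esub> (j \<odot>\<^bsub>scalar_module K N A\<^esub> a)" by simp
  have "single K \<one>\<^bsub>N\<^esub> (k \<oplus>\<^bsub>K\<^esub> j) = single K \<one>\<^bsub>N\<^esub> k \<oplus>\<^bsub>R\<^esub> single K \<one>\<^bsub>N\<^esub> j"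
    by (simp add: single_add[OF K.ring_axioms])
  then show "(k \<oplus>\<^bsub>K\<^esub> j) \<odot>\<^bsub>scalar_module K N A\<^esub> a =
      k \<odot>\<^bsub>scalar_module K N A\<^esub> a \<oplus>\<^bsub>scalar_module K N A\<^esub> j \<odot>\<^bsub>scalar_module K N A\<^esub> a"
    using * by (simp add: KN.single_in A.smult_l_distr)
qed (auto simp: op_one KN.single_in A.smult_r_distr)

sublocale SC: module K "scalar_module K N A"
  rewrites "carrier (scalar_module K N A) = carrier A"
  and "add (scalar_module K N A) = add A"
  and "zero (scalar_module K N A) = zero A"
  and "\<And>k a. smult (scalar_module K N A) k a = k \<cdot> a"
  by (rule scalars) simp_all

end

lemma (in finite_monoid_algebra) lmod_homI:
  fixes A :: "('m \<Rightarrow> 'k, 'a) module" and B :: "('m \<Rightarrow> 'k, 'b) module"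
  assumes "left_module R A" "left_module R B" "additive_map A B h"
    and sc: "\<And>k a. \<lbrakk>k \<in> carrier K; a \<in> carrier A\<rbrakk> \<Longrightarrow>
      h (single K \<one>\<^bsub>N\<^esub> k \<odot>\<^bsub>A\<^esub> a) = single K \<one>\<^bsub>N\<^esub> k \<odot>\<^bsub>B\<^esub> h a"
    and op: "\<And>m a. \<lbrakk>m \<in> carrier N; a \<in> carrier A\<rbrakk> \<Longrightarrow>
      h (basis K m \<odot>\<^bsub>A\<^esub> a) = basis K m \<odot>\<^bsub>B\<^esub> h a"
  shows "h \<in> lmod_hom R A B"
proof -
  interpret A: algebra_module K N A
    by (intro algebra_module.intro assms(1) finite_monoid_algebra_axioms)
  interpret B: algebra_module K N B
    by (intro algebra_module.intro assms(2) finite_monoid_algebra_axioms)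
  interpret h: additive_map A B h by fact
  have "h (\<alpha> \<odot>\<^bsub>A\<^esub> a) = \<alpha> \<odot>\<^bsub>B\<^esub> h a" if \<alpha>: "\<alpha> \<in> carrier R" and a: "a \<in> carrier A" for \<alpha> a
  proof (rule KN.additive_eqI[OF _ _ _ \<alpha>])
    show "additive_map R B (\<lambda>\<alpha>. h (\<alpha> \<odot>\<^bsub>A\<^esub> a))"
      by (rule additive_comp[OF A.additive_algebra[OF a] h.additive_map_axioms])
    show "additive_map R B (\<lambda>\<alpha>. \<alpha> \<odot>\<^bsub>B\<^esub> h a)"
      by (rule B.additive_algebra[OF h.closed[OF a]])
    show "h (single K m k \<odot>\<^bsub>A\<^esub> a) = single K m k \<odot>\<^bsub>B\<^esub> h a" if "m \<in> carrier N" "k \<in> carrier K" for m k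
      using that a h.closed A.single_smult[OF that a] B.single_smult[OF that h.closed[OF a]]
      by (simp add: sc op)
  qed
  then show ?thesis using h.closed h.add by (auto simp: lmod_hom_def hom_def)
qed

lemma lmod_hom_cong:
  assumes "left_module R A" "h \<in> lmod_hom R A B" "\<And>a. a \<in> carrier A \<Longrightarrow> h' a = h a"
  shows "h' \<in> lmod_hom R A B"
proof -
  interpret A: left_module R A by fact
  show ?thesis using assms(2,3) by (auto simp: lmod_hom_def hom_def)
qed

section \<open>Linear algebra over a field\<close>

lemma (in module) lincomb_diff:
  assumes "\<And>i. i \<in> J \<Longrightarrow> x i \<in> carrier R" "\<And>i. i \<in> J \<Longrightarrow> y i \<in> carrier R"
    "\<And>i. i \<in> J \<Longrightarrow> b i \<in> carrier M"
  shows "(\<Oplus>\<^bsub>M\<^esub>i\<in>J. (x i \<ominus>\<^bsub>R\<^esub> y i) \<odot>\<^bsub>M\<^esub> b i) = (\<Oplus>\<^bsub>M\<^esub>i\<in>J. x i \<odot>\<^bsub>M\<^esub> b i) \<ominus>\<^bsub>M\<^esub> (\<Oplus>\<^bsub>M\<^esub>i\<in>J. y i \<odot>\<^bsub>M\<^esub> b i)"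
proof -
  have "(\<Oplus>\<^bsub>M\<^esub>i\<in>J. ((x i \<ominus>\<^bsub>R\<^esub> y i) \<oplus>\<^bsub>R\<^esub> y i) \<odot>\<^bsub>M\<^esub> b i) =
      (\<Oplus>\<^bsub>M\<^esub>i\<in>J. (x i \<ominus>\<^bsub>R\<^esub> y i) \<odot>\<^bsub>M\<^esub> b i \<oplus>\<^bsub>M\<^esub> y i \<odot>\<^bsub>M\<^esub> b i)"
    using assms by (intro M.finsum_cong') (auto simp: smult_l_distr)
  also have "\<dots> = (\<Oplus>\<^bsub>M\<^esub>i\<in>J. (x i \<ominus>\<^bsub>R\<^esub> y i) \<odot>\<^bsub>M\<^esub> b i) \<oplus>\<^bsub>M\<^esub> (\<Oplus>\<^bsub>M\<^esub>i\<in>J. y i \<odot>\<^bsub>M\<^esub> b i)"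
    using assms by (intro M.finsum_addf) auto
  also have "(\<Oplus>\<^bsub>M\<^esub>i\<in>J. ((x i \<ominus>\<^bsub>R\<^esub> y i) \<oplus>\<^bsub>R\<^esub> y i) \<odot>\<^bsub>M\<^esub> b i) = (\<Oplus>\<^bsub>M\<^esub>i\<in>J. x i \<odot>\<^bsub>M\<^esub> b i)"
    using assms by (intro M.finsum_cong') (auto simp: R.minus_eq R.a_assoc R.l_neg)
  finally have "(\<Oplus>\<^bsub>M\<^esub>i\<in>J. x i \<odot>\<^bsub>M\<^esub> b i) =
      (\<Oplus>\<^bsub>M\<^esub>i\<in>J. (x i \<ominus>\<^bsub>R\<^esub> y i) \<odot>\<^bsub>M\<^esub> b i) \<oplus>\<^bsub>M\<^esub> (\<Oplus>\<^bsub>M\<^esub>i\<in>J. y i \<odot>\<^bsub>M\<^esub> b i)" .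
  moreover have "(\<Oplus>\<^bsub>M\<^esub>i\<in>J. (x i \<ominus>\<^bsub>R\<^esub> y i) \<odot>\<^bsub>M\<^esub> b i) \<in> carrier M" "(\<Oplus>\<^bsub>M\<^esub>i\<in>J. y i \<odot>\<^bsub>M\<^esub> b i) \<in> carrier M"
    using assms by (auto intro!: M.finsum_closed)
  ultimately show ?thesis by (simp add: M.minus_eq M.a_assoc M.r_neg)
qed

lemma (in module) lincomb_smult:
  assumes "finite J" "k \<in> carrier R" "\<And>i. i \<in> J \<Longrightarrow> x i \<in> carrier R" "\<And>i. i \<in> J \<Longrightarrow> b i \<in> carrier M"
  shows "(\<Oplus>\<^bsub>M\<^esub>i\<in>J. (k \<otimes>\<^bsub>R\<^esub> x i) \<odot>\<^bsub>M\<^esub> b i) = k \<odot>\<^bsub>M\<^esub> (\<Oplus>\<^bsub>M\<^esub>i\<in>J. x i \<odot>\<^bsub>M\<^esub> b i)"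
  using assms by (subst finsum_smult_ldistr) (auto simp: smult_assoc1 intro!: M.finsum_cong')

lemma (in module) lincomb_add:
  assumes "\<And>i. i \<in> J \<Longrightarrow> x i \<in> carrier R" "\<And>i. i \<in> J \<Longrightarrow> y i \<in> carrier R"
    "\<And>i. i \<in> J \<Longrightarrow> b i \<in> carrier M"
  shows "(\<Oplus>\<^bsub>M\<^esub>i\<in>J. (x i \<oplus>\<^bsub>R\<^esub> y i) \<odot>\<^bsub>M\<^esub> b i) = (\<Oplus>\<^bsub>M\<^esub>i\<in>J. x i \<odot>\<^bsub>M\<^esub> b i) \<oplus>\<^bsub>M\<^esub> (\<Oplus>\<^bsub>M\<^esub>i\<in>J. y i \<odot>\<^bsub>M\<^esub> b i)"
proof -
  have "(\<Oplus>\<^bsub>M\<^esub>i\<in>J. (x i \<oplus>\<^bsub>R\<^esub> y i) \<odot>\<^bsub>M\<^esub> b i) = (\<Oplus>\<^bsub>M\<^esub>i\<in>J. x i \<odot>\<^bsub>M\<^esub> b i \<oplus>\<^bsub>M\<^esub> y i \<odot>\<^bsub>M\<^esub> b i)"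
    using assms by (intro M.finsum_cong') (auto simp: smult_l_distr)
  then show ?thesis using assms by (simp add: M.finsum_addf Pi_def)
qed

text \<open>A dependence relation with a nonzero coefficient at \<open>j\<close> would make \<open>b j\<close> superfluous.\<close>

lemma minimal_spanning_independent:
  fixes V :: "('k, 'v, 'z) module_scheme"
  assumes "field K" "module K V" "finite J" and b: "\<And>i. i \<in> J \<Longrightarrow> b i \<in> carrier V"
    and span: "\<And>v. v \<in> carrier V \<Longrightarrow> \<exists>x. (\<forall>i\<in>J. x i \<in> carrier K) \<and> v = (\<Oplus>\<^bsub>V\<^esub>i\<in>J. x i \<odot>\<^bsub>V\<^esub> b i)"
    and minimal: "\<And>j. j \<in> J \<Longrightarrow> \<exists>v\<in>carrier V. \<forall>x. (\<forall>i\<in>J - {j}. x i \<in> carrier K) \<longrightarrow>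
      v \<noteq> (\<Oplus>\<^bsub>V\<^esub>i\<in>J - {j}. x i \<odot>\<^bsub>V\<^esub> b i)"
    and x: "\<And>i. i \<in> J \<Longrightarrow> x i \<in> carrier K" and y: "\<And>i. i \<in> J \<Longrightarrow> y i \<in> carrier K"
    and eq: "(\<Oplus>\<^bsub>V\<^esub>i\<in>J. x i \<odot>\<^bsub>V\<^esub> b i) = (\<Oplus>\<^bsub>V\<^esub>i\<in>J. y i \<odot>\<^bsub>V\<^esub> b i)"
    and j: "j \<in> J"
  shows "x j = y j"
proof (rule ccontr)
  interpret K: field K by fact
  interpret V: module K V by fact
  assume ne: "x j \<noteq> y j"
  define c where "c i = x i \<ominus>\<^bsub>K\<^esub> y i" for i
  have cK: "c i \<in> carrier K" if "i \<in> J" for i using that x y by (simp add: c_def)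
  have c0: "(\<Oplus>\<^bsub>V\<^esub>i\<in>J. c i \<odot>\<^bsub>V\<^esub> b i) = \<zero>\<^bsub>V\<^esub>"
    unfolding c_def using x y b eq V.lincomb_diff[of J x y b]
    by (simp add: V.M.minus_eq V.M.r_neg V.M.finsum_closed Pi_def)
  have "c j \<noteq> \<zero>\<^bsub>K\<^esub>" 
  proof
    assume "c j = \<zero>\<^bsub>K\<^esub>"
    moreover have "x j = c j \<oplus>\<^bsub>K\<^esub> y j" using x y j by (simp add: c_def K.minus_eq K.a_assoc K.l_neg)
    ultimately show False using ne y j by simp
  qed
  then have cj: "c j \<in> Units K" using cK j K.field_Units by auto
  obtain v where v: "v \<in> carrier V" and nv: "\<And>z. (\<forall>i\<in>J - {j}. z i \<in> carrier K) \<Longrightarrow>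
      v \<noteq> (\<Oplus>\<^bsub>V\<^esub>i\<in>J - {j}. z i \<odot>\<^bsub>V\<^esub> b i)"
    using minimal[OF j] by blast
  obtain w where w: "\<forall>i\<in>J. w i \<in> carrier K" and vw: "v = (\<Oplus>\<^bsub>V\<^esub>i\<in>J. w i \<odot>\<^bsub>V\<^esub> b i)"
    using span[OF v] by blast
  \<comment> \<open>subtracting a multiple of the relation removes the coefficient at \<open>j\<close>\<close>
  define d where "d = w j \<otimes>\<^bsub>K\<^esub> inv\<^bsub>K\<^esub> c j"
  have d: "d \<in> carrier K" using w j cj by (simp add: d_def)
  define z where "z i = w i \<ominus>\<^bsub>K\<^esub> d \<otimes>\<^bsub>K\<^esub> c i" for i
  have zK: "z i \<in> carrier K" if "i \<in> J" for i using that w d cK by (simp add: z_def)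
  have "d \<otimes>\<^bsub>K\<^esub> c j = w j" 
    using w j cj K.Units_closed[OF cj] by (simp add: d_def K.m_assoc K.Units_l_inv)
  then have zj: "z j = \<zero>\<^bsub>K\<^esub>" using w j by (simp add: z_def K.minus_eq K.r_neg)
  have "(\<Oplus>\<^bsub>V\<^esub>i\<in>J. z i \<odot>\<^bsub>V\<^esub> b i) =
      (\<Oplus>\<^bsub>V\<^esub>i\<in>J. w i \<odot>\<^bsub>V\<^esub> b i) \<ominus>\<^bsub>V\<^esub> (\<Oplus>\<^bsub>V\<^esub>i\<in>J. (d \<otimes>\<^bsub>K\<^esub> c i) \<odot>\<^bsub>V\<^esub> b i)"
    unfolding z_def using w d cK b by (intro V.lincomb_diff) auto
  also have "\<dots> = v"
    using V.lincomb_smult[of J d c b] assms(3) d cK b c0 v vw by (simp add: V.M.minus_eq)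
  also have "(\<Oplus>\<^bsub>V\<^esub>i\<in>J. z i \<odot>\<^bsub>V\<^esub> b i) = (\<Oplus>\<^bsub>V\<^esub>i\<in>J - {j}. z i \<odot>\<^bsub>V\<^esub> b i)"
    using assms(3) zj zK b j by (intro V.M.add.finprod_mono_neutral_cong_right) auto
  finally show False using nv[of z] zK by auto
qed

text \<open>A spanning subfamily of least size is a basis, and it suffices to lift the values on it.\<close>

lemma linear_lift:
  fixes V :: "('k, 'v, 'z) module_scheme" and A :: "('k, 'a, 'u) module_scheme"
    and B :: "('k, 'b, 'w) module_scheme"
  assumes "field K" "module K V" "module K A" "module K B"
    and "finite I" and bI: "\<And>i. i \<in> I \<Longrightarrow> b i \<in> carrier V"
    and spanI: "\<And>v. v \<in> carrier V \<Longrightarrow> \<exists>x. (\<forall>i\<in>I. x i \<in> carrier K) \<and> v = (\<Oplus>\<^bsub>V\<^esub>i\<in>I. x i \<odot>\<^bsub>V\<^esub> b i)"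
    and f: "f \<in> lmod_hom K A B" and surj: "f ` carrier A = carrier B" and g: "g \<in> lmod_hom K V B"
  shows "\<exists>h \<in> lmod_hom K V A. \<forall>v\<in>carrier V. f (h v) = g v"
proof -
  interpret K: field K by fact
  interpret V: module K V by fact
  interpret A: module K A by fact
  interpret B: module K B by fact
  define spans where "spans J \<longleftrightarrow> J \<subseteq> I \<and> (\<forall>v\<in>carrier V.
    \<exists>x. (\<forall>i\<in>J. x i \<in> carrier K) \<and> v = (\<Oplus>\<^bsub>V\<^esub>i\<in>J. x i \<odot>\<^bsub>V\<^esub> b i))" for J
  have "spans I" using spanI by (simp add: spans_def)
  then obtain J where J: "spans J" and minJ: "\<And>J'. spans J' \<Longrightarrow> card J \<le> card J'"
    using ex_has_least_nat[of spans I card] by blast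
  have JI: "J \<subseteq> I" and finJ: "finite J" using J assms(5) finite_subset by (auto simp: spans_def)
  have bJ: "b i \<in> carrier V" if "i \<in> J" for i using that JI bI by auto
  have span: "\<exists>x. (\<forall>i\<in>J. x i \<in> carrier K) \<and> v = (\<Oplus>\<^bsub>V\<^esub>i\<in>J. x i \<odot>\<^bsub>V\<^esub> b i)" if "v \<in> carrier V" for v
    using J that by (auto simp: spans_def)
  have minimal: "\<exists>v\<in>carrier V. \<forall>x. (\<forall>i\<in>J - {j}. x i \<in> carrier K) \<longrightarrow>
      v \<noteq> (\<Oplus>\<^bsub>V\<^esub>i\<in>J - {j}. x i \<odot>\<^bsub>V\<^esub> b i)" if "j \<in> J" for j
  proof -
    have "card (J - {j}) < card J" using that finJ by (rule card_Diff1_less[rotated])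
    then have "\<not> spans (J - {j})" using minJ[of "J - {j}"] by linarith
    then show ?thesis using JI unfolding spans_def by blast
  qed
  note unique = minimal_spanning_independent[OF assms(1,2) finJ bJ span minimal]
  define coord where "coord v = (SOME x. (\<forall>i\<in>J. x i \<in> carrier K) \<and> v = (\<Oplus>\<^bsub>V\<^esub>i\<in>J. x i \<odot>\<^bsub>V\<^esub> b i))" for v
  have coord: "(\<forall>i\<in>J. coord v i \<in> carrier K) \<and> v = (\<Oplus>\<^bsub>V\<^esub>i\<in>J. coord v i \<odot>\<^bsub>V\<^esub> b i)"
    if "v \<in> carrier V" for v
    unfolding coord_def using span[OF that] by (rule someI_ex)
  have cK: "coord v i \<in> carrier K" if "v \<in> carrier V" "i \<in> J" for v i using coord that by blast
  have coord_eq: "coord v j = x j"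
    if "v \<in> carrier V" "\<And>i. i \<in> J \<Longrightarrow> x i \<in> carrier K" "v = (\<Oplus>\<^bsub>V\<^esub>i\<in>J. x i \<odot>\<^bsub>V\<^esub> b i)" "j \<in> J" for v x j
    using that cK[OF that(1)] coord[OF that(1)] by (intro unique[of "coord v" x]) auto
  interpret f: additive_map A B f
    by (rule additive_mapD_lmod_hom[OF A.abelian_group_axioms B.abelian_group_axioms f])
  interpret g: additive_map V B g
    by (rule additive_mapD_lmod_hom[OF V.abelian_group_axioms B.abelian_group_axioms g])
  have fs: "f (k \<odot>\<^bsub>A\<^esub> a) = k \<odot>\<^bsub>B\<^esub> f a" if "k \<in> carrier K" "a \<in> carrier A" for k a
    using f that by (auto simp: lmod_hom_def)
  have gs: "g (k \<odot>\<^bsub>V\<^esub> a) = k \<odot>\<^bsub>B\<^esub> g a" if "k \<in> carrier K" "a \<in> carrier V" for k a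
    using g that by (auto simp: lmod_hom_def)
  have "\<exists>a \<in> carrier A. f a = g (b i)" if "i \<in> J" for i
    using surj g.closed[OF bJ[OF that]] by (metis imageE)
  then obtain l where l: "\<And>i. i \<in> J \<Longrightarrow> l i \<in> carrier A" "\<And>i. i \<in> J \<Longrightarrow> f (l i) = g (b i)"
    by metis
  define h where "h v = (\<Oplus>\<^bsub>A\<^esub>i\<in>J. coord v i \<odot>\<^bsub>A\<^esub> l i)" for v
  have hc: "h v \<in> carrier A" if "v \<in> carrier V" for v
    unfolding h_def using that cK l by (intro A.M.finsum_closed) auto
  have ha: "h (v \<oplus>\<^bsub>V\<^esub> w) = h v \<oplus>\<^bsub>A\<^esub> h w" if vw: "v \<in> carrier V" "w \<in> carrier V" for v w
  proof -
    have "v \<oplus>\<^bsub>V\<^esub> w = (\<Oplus>\<^bsub>V\<^esub>i\<in>J. (coord v i \<oplus>\<^bsub>K\<^esub> coord w i) \<odot>\<^bsub>V\<^esub> b i)"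
      using V.lincomb_add[of J "coord v" "coord w" b] vw cK bJ coord[OF vw(1)] coord[OF vw(2)] by simp
    then have "coord (v \<oplus>\<^bsub>V\<^esub> w) i = coord v i \<oplus>\<^bsub>K\<^esub> coord w i" if "i \<in> J" for i
      using vw cK that by (intro coord_eq[OF V.M.a_closed[OF vw]]) auto
    then have "h (v \<oplus>\<^bsub>V\<^esub> w) = (\<Oplus>\<^bsub>A\<^esub>i\<in>J. (coord v i \<oplus>\<^bsub>K\<^esub> coord w i) \<odot>\<^bsub>A\<^esub> l i)"
      unfolding h_def using vw cK l by (intro A.M.finsum_cong') auto
    then show ?thesis
      using A.lincomb_add[of J "coord v" "coord w" l] vw cK l by (simp add: h_def)
  qed
  have hs: "h (k \<odot>\<^bsub>V\<^esub> v) = k \<odot>\<^bsub>A\<^esub> h v" if k: "k \<in> carrier K" and v: "v \<in> carrier V" for k v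
  proof -
    have "k \<odot>\<^bsub>V\<^esub> v = (\<Oplus>\<^bsub>V\<^esub>i\<in>J. (k \<otimes>\<^bsub>K\<^esub> coord v i) \<odot>\<^bsub>V\<^esub> b i)"
      using V.lincomb_smult[of J k "coord v" b] finJ v k cK bJ coord[OF v] by simp
    then have "coord (k \<odot>\<^bsub>V\<^esub> v) i = k \<otimes>\<^bsub>K\<^esub> coord v i" if "i \<in> J" for i
      using v k cK that by (intro coord_eq[OF V.smult_closed[OF k v]]) auto
    then have "h (k \<odot>\<^bsub>V\<^esub> v) = (\<Oplus>\<^bsub>A\<^esub>i\<in>J. (k \<otimes>\<^bsub>K\<^esub> coord v i) \<odot>\<^bsub>A\<^esub> l i)"
      unfolding h_def using v k cK l by (intro A.M.finsum_cong') auto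
    then show ?thesis
      using A.lincomb_smult[of J k "coord v" l] finJ v k cK l by (simp add: h_def)
  qed
  have "f (h v) = g v" if v: "v \<in> carrier V" for v
  proof -
    have "f (h v) = (\<Oplus>\<^bsub>B\<^esub>i\<in>J. f (coord v i \<odot>\<^bsub>A\<^esub> l i))"
      unfolding h_def using v cK l by (intro f.finsum) auto
    also have "\<dots> = (\<Oplus>\<^bsub>B\<^esub>i\<in>J. g (coord v i \<odot>\<^bsub>V\<^esub> b i))"
      using v cK l bJ fs gs g.closed by (intro B.M.finsum_cong') auto
    also have "\<dots> = g (\<Oplus>\<^bsub>V\<^esub>i\<in>J. coord v i \<odot>\<^bsub>V\<^esub> b i)"
      using v cK bJ by (intro g.finsum[symmetric]) auto
    finally show ?thesis using coord[OF v] by simp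
  qed
  then show ?thesis using hc ha hs by (intro bexI[of _ h]) (auto simp: lmod_hom_def hom_def)
qed

lemma ring_char_not_dvd:
  assumes "ring K" "\<not> ring_char K dvd n"
  shows "[n] \<cdot>\<^bsub>K\<^esub> \<one>\<^bsub>K\<^esub> \<noteq> \<zero>\<^bsub>K\<^esub>"
proof
  interpret ring K by fact
  assume n: "[n] \<cdot>\<^bsub>K\<^esub> \<one>\<^bsub>K\<^esub> = \<zero>\<^bsub>K\<^esub>"
  have "n \<noteq> 0" using assms(2) by (intro notI) simp
  then have ex: "\<exists>p > (0 :: nat). [p] \<cdot>\<^bsub>K\<^esub> \<one>\<^bsub>K\<^esub> = \<zero>\<^bsub>K\<^esub>" using n by blast
  define p where "p = ring_char K"
  have p_eq: "p = (LEAST n :: nat. n > 0 \<and> [n] \<cdot>\<^bsub>K\<^esub> \<one>\<^bsub>K\<^esub> = \<zero>\<^bsub>K\<^esub>)"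
    using ex by (simp add: p_def ring_char_def)
  have p: "p > 0" "[p] \<cdot>\<^bsub>K\<^esub> \<one>\<^bsub>K\<^esub> = \<zero>\<^bsub>K\<^esub>"
    using LeastI_ex[OF ex[unfolded Bex_def]] unfolding p_eq by auto
  have "[n] \<cdot>\<^bsub>K\<^esub> \<one>\<^bsub>K\<^esub> = [(p * (n div p))] \<cdot>\<^bsub>K\<^esub> \<one>\<^bsub>K\<^esub> \<oplus>\<^bsub>K\<^esub> [(n mod p)] \<cdot>\<^bsub>K\<^esub> \<one>\<^bsub>K\<^esub>"
    using add.nat_pow_mult[of "\<one>\<^bsub>K\<^esub>" "p * (n div p)" "n mod p"] by simp
  also have "[(p * (n div p))] \<cdot>\<^bsub>K\<^esub> \<one>\<^bsub>K\<^esub> = \<zero>\<^bsub>K\<^esub>"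
    using add.nat_pow_pow[of "\<one>\<^bsub>K\<^esub>" "n div p" p] p(2) by simp
  finally have "[(n mod p)] \<cdot>\<^bsub>K\<^esub> \<one>\<^bsub>K\<^esub> = \<zero>\<^bsub>K\<^esub>" using n by simp
  then have "\<not> n mod p > 0"
    using not_less_Least[of "n mod p" "\<lambda>n. n > 0 \<and> [n] \<cdot>\<^bsub>K\<^esub> \<one>\<^bsub>K\<^esub> = \<zero>\<^bsub>K\<^esub>"] p(1) unfolding p_eq[symmetric]
    by auto
  then show False using assms(2) by (auto simp: p_def dvd_eq_mod_eq_0)
qed

section \<open>Coefficient modules of partial actions\<close>

text \<open>The tensor product with \<open>V\<close> of the free \<open>K\<close>-module on a finite set \<open>S\<close> with a partial action:
  \<open>m (s \<otimes> v) = ms \<otimes> mv\<close>, which is zero where \<open>ms\<close> is undefined. The module \<open>P\<close> is given only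
  through the values of its operations, so that modules constructed in other ways are instances.\<close>

locale partial_action = finite_monoid_algebra K N + V: algebra_module K N V + function_group V S P
  for K :: "('k, 'y) ring_scheme" and N :: "('m, 'x) monoid_scheme"
    and V :: "('m \<Rightarrow> 'k, 'v) module" and S :: "'s set"
    and P :: "('m \<Rightarrow> 'k, 's \<Rightarrow> 'v) module" +
  fixes act :: "'m \<Rightarrow> 's \<Rightarrow> 's option"
  assumes act_closed: "\<lbrakk>m \<in> carrier N; s \<in> S; act m s = Some t\<rbrakk> \<Longrightarrow> t \<in> S"
    and act_one: "s \<in> S \<Longrightarrow> act \<one>\<^bsub>N\<^esub> s = Some s"
    and act_mult: "\<lbrakk>m \<in> carrier N; n \<in> carrier N; s \<in> S\<rbrakk> \<Longrightarrow>
      act (m \<otimes>\<^bsub>N\<^esub> n) s = Option.bind (act n s) (act m)"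
    and smult_P: "\<lbrakk>\<alpha> \<in> carrier R; f \<in> carrier P\<rbrakk> \<Longrightarrow>
      (\<alpha> \<odot>\<^bsub>P\<^esub> f) t = (\<Oplus>\<^bsub>V\<^esub>m\<in>carrier N. \<Oplus>\<^bsub>V\<^esub>s\<in>S.
        if act m s = Some t then single K m (\<alpha> m) \<odot>\<^bsub>V\<^esub> f s else \<zero>\<^bsub>V\<^esub>)"
begin

lemma single_V: "\<lbrakk>m \<in> carrier N; k \<in> carrier K; v \<in> carrier V\<rbrakk> \<Longrightarrow> single K m k \<odot>\<^bsub>V\<^esub> v \<in> carrier V"
  by (simp add: KN.single_in)

lemma smult_closed_P:
  assumes "\<alpha> \<in> carrier R" "f \<in> carrier P"
  shows "\<alpha> \<odot>\<^bsub>P\<^esub> f \<in> carrier P"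
proof (rule in_carrierI)
  fix t
  note cl = single_V[OF _ KN.val_closed[OF assms(1)] val_closed[OF assms(2)]]
  show "(\<alpha> \<odot>\<^bsub>P\<^esub> f) t \<in> carrier V"
    unfolding smult_P[OF assms] using cl by (intro V.A.M.finsum_closed) (auto intro!: V.A.M.finsum_closed)
  show "(\<alpha> \<odot>\<^bsub>P\<^esub> f) t = \<zero>\<^bsub>V\<^esub>" if "t \<notin> S"
    unfolding smult_P[OF assms] using act_closed that
    by (intro V.A.M.add.finprod_one_eqI) auto
qed

lemma smult_single:
  assumes m: "m \<in> carrier N" and k: "k \<in> carrier K" and s: "s \<in> S" and v: "v \<in> carrier V"
  shows "single K m k \<odot>\<^bsub>P\<^esub> single V s v =
    (case act m s of None \<Rightarrow> \<zero>\<^bsub>P\<^esub> | Some t \<Rightarrow> single V t (single K m k \<odot>\<^bsub>V\<^esub> v))"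
proof
  fix t
  let ?w = "single K m k \<odot>\<^bsub>V\<^esub> v"
  note w = single_V[OF m k v]
  note mk = KN.single_in[OF m k] and sv = single_in[OF s v]
  have summand: "single K n (single K m k n) \<odot>\<^bsub>V\<^esub> single V s v r =
      (if n = m then if r = s then ?w else \<zero>\<^bsub>V\<^esub> else \<zero>\<^bsub>V\<^esub>)" if n: "n \<in> carrier N" for n r
  proof -
    have "(\<lambda>_. \<zero>\<^bsub>K\<^esub>) \<odot>\<^bsub>V\<^esub> u = \<zero>\<^bsub>V\<^esub>" if "u \<in> carrier V" for u
      using additive_map.zero[OF V.additive_algebra[OF that]] by (simp add: KN.zero_P)
    moreover have "single K n \<zero>\<^bsub>K\<^esub> = (\<lambda>_. \<zero>\<^bsub>K\<^esub>)" by (auto simp: single_def)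
    moreover have "single K m k \<odot>\<^bsub>V\<^esub> \<zero>\<^bsub>V\<^esub> = \<zero>\<^bsub>V\<^esub>"
      by (rule additive_map.zero[OF V.additive_smult[OF mk]])
    ultimately show ?thesis
      using v V.A.M.zero_closed by (auto simp: single_def[of K m k] single_def[of V])
  qed
  have "(single K m k \<odot>\<^bsub>P\<^esub> single V s v) t = (\<Oplus>\<^bsub>V\<^esub>n\<in>carrier N. \<Oplus>\<^bsub>V\<^esub>r\<in>S.
      if r = s then if n = m then if act m s = Some t then ?w else \<zero>\<^bsub>V\<^esub> else \<zero>\<^bsub>V\<^esub> else \<zero>\<^bsub>V\<^esub>)"
    unfolding smult_P[OF mk sv] using w
    by (intro V.A.M.finsum_cong' refl) (auto simp: summand intro!: V.A.M.finsum_cong' V.A.M.finsum_closed)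
  also have "\<dots> = (\<Oplus>\<^bsub>V\<^esub>n\<in>carrier N. if n = m then if act m s = Some t then ?w else \<zero>\<^bsub>V\<^esub> else \<zero>\<^bsub>V\<^esub>)"
    using w finite_S s by (intro V.A.M.finsum_cong') (auto simp: V.A.M.finsum_delta)
  also have "\<dots> = (if act m s = Some t then ?w else \<zero>\<^bsub>V\<^esub>)"
    using w finite_N m by (simp add: V.A.M.finsum_delta)
  finally show "(single K m k \<odot>\<^bsub>P\<^esub> single V s v) t =
      (case act m s of None \<Rightarrow> \<zero>\<^bsub>P\<^esub> | Some t \<Rightarrow> single V t ?w) t"
    by (auto simp: zero_P single_def[of V] split: option.splits)
qed

lemma smult_add_P:
  assumes "\<alpha> \<in> carrier R" "\<beta> \<in> carrier R" "f \<in> carrier P"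
  shows "(\<alpha> \<oplus>\<^bsub>R\<^esub> \<beta>) \<odot>\<^bsub>P\<^esub> f = \<alpha> \<odot>\<^bsub>P\<^esub> f \<oplus>\<^bsub>P\<^esub> \<beta> \<odot>\<^bsub>P\<^esub> f"
proof
  fix t
  note v = KN.val_closed[OF assms(1)] KN.val_closed[OF assms(2)] val_closed[OF assms(3)]
  have "single K m ((\<alpha> \<oplus>\<^bsub>R\<^esub> \<beta>) m) = single K m (\<alpha> m) \<oplus>\<^bsub>R\<^esub> single K m (\<beta> m)" for m
    unfolding single_add[OF K.ring_axioms] by (simp add: KN.add_P)
  then have *: "single K m ((\<alpha> \<oplus>\<^bsub>R\<^esub> \<beta>) m) \<odot>\<^bsub>V\<^esub> f s =
      single K m (\<alpha> m) \<odot>\<^bsub>V\<^esub> f s \<oplus>\<^bsub>V\<^esub> single K m (\<beta> m) \<odot>\<^bsub>V\<^esub> f s"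
    if "m \<in> carrier N" for m s
    using that v by (simp add: V.A.smult_l_distr KN.single_in)
  show "((\<alpha> \<oplus>\<^bsub>R\<^esub> \<beta>) \<odot>\<^bsub>P\<^esub> f) t = (\<alpha> \<odot>\<^bsub>P\<^esub> f \<oplus>\<^bsub>P\<^esub> \<beta> \<odot>\<^bsub>P\<^esub> f) t"
    unfolding add_P smult_P[OF assms(1,3)] smult_P[OF assms(2,3)]
      smult_P[OF KN.P.a_closed[OF assms(1,2)] assms(3)]
    using v by (intro V.A.M.finsum2_add) (auto simp: * single_V)
qed

lemma smult_r_add_P:
  assumes "\<alpha> \<in> carrier R" "f \<in> carrier P" "g \<in> carrier P"
  shows "\<alpha> \<odot>\<^bsub>P\<^esub> (f \<oplus>\<^bsub>P\<^esub> g) = \<alpha> \<odot>\<^bsub>P\<^esub> f \<oplus>\<^bsub>P\<^esub> \<alpha> \<odot>\<^bsub>P\<^esub> g"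
proof
  fix t
  note v = KN.val_closed[OF assms(1)] val_closed[OF assms(2)] val_closed[OF assms(3)]
  have *: "single K m (\<alpha> m) \<odot>\<^bsub>V\<^esub> (f s \<oplus>\<^bsub>V\<^esub> g s) =
      single K m (\<alpha> m) \<odot>\<^bsub>V\<^esub> f s \<oplus>\<^bsub>V\<^esub> single K m (\<alpha> m) \<odot>\<^bsub>V\<^esub> g s"
    if "m \<in> carrier N" for m s
    using that v by (simp add: V.A.smult_r_distr KN.single_in)
  show "(\<alpha> \<odot>\<^bsub>P\<^esub> (f \<oplus>\<^bsub>P\<^esub> g)) t = (\<alpha> \<odot>\<^bsub>P\<^esub> f \<oplus>\<^bsub>P\<^esub> \<alpha> \<odot>\<^bsub>P\<^esub> g) t"
    unfolding add_P smult_P[OF assms(1,2)] smult_P[OF assms(1,3)]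
      smult_P[OF assms(1) P.a_closed[OF assms(2,3)], unfolded add_P]
    using v by (intro V.A.M.finsum2_add) (auto simp: * single_V)
qed

text \<open>On the generators \<open>s \<otimes> v\<close> the module laws are the laws of a partial action.\<close>

lemma left_module_P: "left_module R P"
proof (rule left_moduleI)
  have sm: "additive_map P P (\<lambda>f. \<alpha> \<odot>\<^bsub>P\<^esub> f)" if "\<alpha> \<in> carrier R" for \<alpha>
    using that by unfold_locales (simp_all add: smult_closed_P smult_r_add_P)
  show "basis K \<one>\<^bsub>N\<^esub> \<odot>\<^bsub>P\<^esub> f = f" if f: "f \<in> carrier P" for f
  proof (rule additive_eqI[OF _ _ _ f])
    show "additive_map P P (\<lambda>f. basis K \<one>\<^bsub>N\<^esub> \<odot>\<^bsub>P\<^esub> f)" by (rule sm) (simp add: KN.single_in)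
    show "additive_map P P (\<lambda>f. f)" by unfold_locales simp_all
    show "basis K \<one>\<^bsub>N\<^esub> \<odot>\<^bsub>P\<^esub> single V s v = single V s v" if "s \<in> S" "v \<in> carrier V" for s v
      using that by (simp add: smult_single act_one V.op_one)
  qed
  fix m n k j f
  assume m: "m \<in> carrier N" "k \<in> carrier K" and n: "n \<in> carrier N" "j \<in> carrier K"
    and f: "f \<in> carrier P"
  have mn: "m \<otimes>\<^bsub>N\<^esub> n \<in> carrier N" "k \<otimes>\<^bsub>K\<^esub> j \<in> carrier K" using m n by auto
  note mk = KN.single_in[OF m] and nj = KN.single_in[OF n]
  have zero: "single K m k \<odot>\<^bsub>P\<^esub> \<zero>\<^bsub>P\<^esub> = \<zero>\<^bsub>P\<^esub>" by (rule additive_map.zero[OF sm[OF mk]])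
  show "single K (m \<otimes>\<^bsub>N\<^esub> n) (k \<otimes>\<^bsub>K\<^esub> j) \<odot>\<^bsub>P\<^esub> f = single K m k \<odot>\<^bsub>P\<^esub> (single K n j \<odot>\<^bsub>P\<^esub> f)"
  proof (rule additive_eqI[OF sm[OF KN.single_in[OF mn]] additive_comp[OF sm[OF nj] sm[OF mk]] _ f])
    fix s v assume s: "s \<in> S" and v: "v \<in> carrier V"
    have "single K (m \<otimes>\<^bsub>N\<^esub> n) (k \<otimes>\<^bsub>K\<^esub> j) \<odot>\<^bsub>V\<^esub> v = single K m k \<odot>\<^bsub>V\<^esub> (single K n j \<odot>\<^bsub>V\<^esub> v)"
      using V.A.smult_assoc1[OF mk nj v] by (simp add: mult_single m n)
    then show "single K (m \<otimes>\<^bsub>N\<^esub> n) (k \<otimes>\<^bsub>K\<^esub> j) \<odot>\<^bsub>P\<^esub> single V s v =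
        single K m k \<odot>\<^bsub>P\<^esub> (single K n j \<odot>\<^bsub>P\<^esub> single V s v)"
      using s v m n mn single_V[OF n v] zero act_closed[OF n(1) s]
      by (auto simp: smult_single act_mult split: option.splits bind_splits)
  qed
qed (simp_all add: smult_closed_P smult_add_P smult_r_add_P P.abelian_group_axioms)

sublocale PM: algebra_module K N P
  by (intro algebra_module.intro left_module_P finite_monoid_algebra_axioms)

text \<open>A homomorphism out of \<open>P\<close> is an equivariant family of linear maps \<open>V \<rightarrow> A\<close> indexed by \<open>S\<close>.\<close>

lemma equivariant_family_hom:
  fixes A :: "('m \<Rightarrow> 'k, 'a) module"
  assumes "left_module R A"
    and add: "\<And>s. s \<in> S \<Longrightarrow> additive_map V A (\<psi> s)"
    and sc: "\<And>k s v. \<lbrakk>k \<in> carrier K; s \<in> S; v \<in> carrier V\<rbrakk> \<Longrightarrow>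
      \<psi> s (V.sc k v) = single K \<one>\<^bsub>N\<^esub> k \<odot>\<^bsub>A\<^esub> \<psi> s v"
    and op: "\<And>m s v. \<lbrakk>m \<in> carrier N; s \<in> S; v \<in> carrier V\<rbrakk> \<Longrightarrow>
      basis K m \<odot>\<^bsub>A\<^esub> \<psi> s v = (case act m s of None \<Rightarrow> \<zero>\<^bsub>A\<^esub> | Some t \<Rightarrow> \<psi> t (V.op m v))"
  shows "(\<lambda>f. \<Oplus>\<^bsub>A\<^esub>s\<in>S. \<psi> s (f s)) \<in> lmod_hom R P A"
proof (rule lmod_homI[OF left_module_P assms(1)])
  interpret A: algebra_module K N A
    by (intro algebra_module.intro assms(1) finite_monoid_algebra_axioms)
  let ?h = "\<lambda>f. \<Oplus>\<^bsub>A\<^esub>s\<in>S. \<psi> s (f s)"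
  show h: "additive_map P A ?h"
    by (rule additive_family[OF A.A.M.abelian_group_axioms add])
  have hs: "?h (single V s v) = \<psi> s v" if "s \<in> S" "v \<in> carrier V" for s v
    by (rule family_single[OF add that])
  have h0: "?h \<zero>\<^bsub>P\<^esub> = \<zero>\<^bsub>A\<^esub>" by (rule additive_map.zero[OF h])
  fix f assume f: "f \<in> carrier P"
  show "?h (single K \<one>\<^bsub>N\<^esub> k \<odot>\<^bsub>P\<^esub> f) = single K \<one>\<^bsub>N\<^esub> k \<odot>\<^bsub>A\<^esub> ?h f" if k: "k \<in> carrier K" for k
  proof -
    have 1: "single K \<one>\<^bsub>N\<^esub> k \<in> carrier R" using k by (simp add: KN.single_in)
    show ?thesis
    proof (rule additive_eqI[OF additive_comp[OF PM.additive_smult[OF 1] h]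
          additive_comp[OF h A.additive_smult[OF 1]] _ f])
      fix s v assume "s \<in> S" "v \<in> carrier V"
      then show "?h (single K \<one>\<^bsub>N\<^esub> k \<odot>\<^bsub>P\<^esub> single V s v) = single K \<one>\<^bsub>N\<^esub> k \<odot>\<^bsub>A\<^esub> ?h (single V s v)"
        using k by (simp add: smult_single act_one hs sc)
    qed
  qed
  show "?h (basis K m \<odot>\<^bsub>P\<^esub> f) = basis K m \<odot>\<^bsub>A\<^esub> ?h f" if m: "m \<in> carrier N" for m
  proof (rule additive_eqI[OF additive_comp[OF PM.additive_smult[OF basis_in[OF m]] h]
        additive_comp[OF h A.additive_smult[OF basis_in[OF m]]] _ f])
    fix s v assume s: "s \<in> S" "v \<in> carrier V"
    show "?h (basis K m \<odot>\<^bsub>P\<^esub> single V s v) = basis K m \<odot>\<^bsub>A\<^esub> ?h (single V s v)"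
    proof (cases "act m s")
      case None
      then show ?thesis using s m op[OF m s] by (simp add: smult_single hs h0)
    next
      case (Some t)
      then show ?thesis
        using s m op[OF m s] act_closed[OF m s(1)] by (simp add: smult_single hs)
    qed
  qed
qed

end

section \<open>Finite regular left duo monoids\<close>

lemma (in monoid) idempotent_power:
  assumes "finite (carrier G)" "m \<in> carrier G"
  shows "\<exists>n>0. m [^] (n :: nat) \<otimes> m [^] n = m [^] n"
proof -
  have "\<not> inj (\<lambda>n :: nat. m [^] n)"
    using assms finite_imageD[of "\<lambda>n :: nat. m [^] n" UNIV] finite_subset[of "range (\<lambda>n :: nat. m [^] n)"]
    by auto
  then obtain i p :: nat where p: "p > 0" and eq: "m [^] i = m [^] (i + p)"
    by (metis (no_types, lifting) injI linorder_neqE_nat less_imp_add_positive)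
  have step: "m [^] (i + a + p) = m [^] (i + a)" for a
    using eq assms nat_pow_mult[of m "i + p" a] nat_pow_mult[of m i a] by (simp add: ac_simps)
  have steps: "m [^] (i + a + k * p) = m [^] (i + a)" for a k
  proof (induction k)
    case (Suc k)
    have "m [^] (i + (a + k * p) + p) = m [^] (i + (a + k * p))" by (rule step)
    then show ?case using Suc by (simp add: ac_simps)
  qed simp
  have "i \<le> Suc i * p" using p by (cases p) auto
  then obtain a where a: "Suc i * p = i + a" using le_Suc_ex by blast
  have "m [^] (Suc i * p + Suc i * p) = m [^] (Suc i * p)" unfolding a using steps[of a "Suc i"] a by simp
  then have "m [^] (Suc i * p) \<otimes> m [^] (Suc i * p) = m [^] (Suc i * p)"
    using assms by (simp add: nat_pow_mult)
  then show ?thesis using p by (intro exI[of _ "Suc i * p"]) auto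
qed

locale regular_left_duo_monoid = monoid M for M :: "('m, 'x) monoid_scheme" (structure) +
  assumes finite_M: "finite (carrier M)" and regular: "regular_monoid M" and duo: "left_duo M"
begin

abbreviation B where "B \<equiv> idems M"
abbreviation \<omega> where "\<omega> \<equiv> omega M"
abbreviation dg ("_\<^sup>\<dagger>" [1000] 999) where "dg \<equiv> dagger M"

lemma idemD: "e \<in> B \<Longrightarrow> e \<in> carrier M" "e \<in> B \<Longrightarrow> e \<otimes> e = e"
  by (auto simp: idems_def)

lemma finite_B: "finite B"
  using finite_M by (auto simp: idems_def)

text \<open>The form in which the left duo law is used: \<open>em\<close> lies in \<open>eM \<subseteq> Me\<close>, where \<open>e\<close> is neutral on
  the right.\<close>

lemma absorb:
  assumes "e \<in> B" "m \<in> carrier M"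
  shows "e \<otimes> m \<otimes> e = e \<otimes> m"
proof -
  note e = idemD[OF assms(1)]
  have "e \<otimes> m \<in> e <# carrier M" using assms(2) by (auto simp: l_coset_def)
  then have "e \<otimes> m \<in> carrier M #> e" using duo e by (auto simp: left_duo_def)
  then obtain x where "x \<in> carrier M" "e \<otimes> m = x \<otimes> e" by (auto simp: r_coset_def)
  then show ?thesis using e by (simp add: m_assoc)
qed

lemma absorb': "\<lbrakk>e \<in> B; m \<in> carrier M\<rbrakk> \<Longrightarrow> e \<otimes> (m \<otimes> e) = e \<otimes> m"
  using absorb idemD by (simp add: m_assoc[symmetric])

lemma absorb'': "\<lbrakk>e \<in> B; m \<in> carrier M; n \<in> carrier M\<rbrakk> \<Longrightarrow> e \<otimes> (m \<otimes> (e \<otimes> n)) = e \<otimes> (m \<otimes> n)"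
  using absorb[of e m] idemD[of e] by (simp add: m_assoc[symmetric])

lemma idem_mult:
  assumes "e \<in> B" "f \<in> B"
  shows "e \<otimes> f \<in> B"
proof -
  note e = idemD[OF assms(1)] and f = idemD[OF assms(2)]
  have "e \<otimes> f \<otimes> (e \<otimes> f) = e \<otimes> (f \<otimes> (e \<otimes> f))" using e f by (simp only: m_assoc m_closed)
  also have "\<dots> = e \<otimes> f" using absorb''[OF assms(1) f(1) f(1)] f(2) by simp
  finally show ?thesis using e f by (simp add: idems_def)
qed

lemma below_trans:
  assumes "x \<in> carrier M" "y \<in> carrier M" "z \<in> carrier M" "x \<otimes> y = x" "y \<otimes> z = y"
  shows "x \<otimes> z = x"
proof -
  have "x \<otimes> z = x \<otimes> y \<otimes> z" using assms by simp
  also have "\<dots> = x \<otimes> y" using assms(1-3,5) by (simp add: m_assoc)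
  finally show ?thesis using assms by simp
qed

lemma one_idem: "\<one> \<in> B" by (simp add: idems_def)

lemma omega_power: "m \<in> carrier M \<Longrightarrow> \<omega> m \<in> B \<and> (\<exists>n>0. \<omega> m = m [^] (n :: nat))"
proof -
  assume m: "m \<in> carrier M"
  have "\<exists>!e. e \<in> B \<and> (\<exists>n>0. e = m [^] (n :: nat))"
  proof (rule ex_ex1I)
    show "\<exists>e. e \<in> B \<and> (\<exists>n>0. e = m [^] (n :: nat))"
      using idempotent_power[OF finite_M m] m by (auto simp: idems_def)
    fix e f assume "e \<in> B \<and> (\<exists>n>0. e = m [^] (n :: nat))" "f \<in> B \<and> (\<exists>n>0. f = m [^] (n :: nat))"
    then obtain n k :: nat where *: "e \<in> B" "f \<in> B" "n > 0" "k > 0" "e = m [^] n" "f = m [^] k" by blast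
    have pow: "g [^] j = g" if "g \<in> B" "j > 0" for g and j :: nat
      using that(2,1) by (induction j rule: nat_induct_non_zero) (auto simp: idems_def)
    have "e = m [^] (n * k)" using pow[OF *(1,4)] *(5) m by (simp add: nat_pow_pow)
    also have "\<dots> = f" using pow[OF *(2,3)] *(6) m by (simp add: nat_pow_pow mult.commute)
    finally show "e = f" .
  qed
  then show ?thesis unfolding omega_def by (rule theI')
qed

lemma omega_idem: "m \<in> carrier M \<Longrightarrow> \<omega> m \<in> B" using omega_power by blast

lemma omega_closed [simp]: "m \<in> carrier M \<Longrightarrow> \<omega> m \<in> carrier M" using omega_idem idemD by blast

text \<open>If \<open>mam = m\<close>, then \<open>g = ma\<close> is idempotent and \<open>m = gm = gmg = m\<^sup>2a\<close>. So \<open>m\<close> and \<open>m\<^sup>2\<close> generate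
  the same right ideal, and as \<open>M\<close> is finite, \<open>m\<close> lies in a subgroup.\<close>

lemma omega_neutral:
  assumes m: "m \<in> carrier M"
  shows "\<omega> m \<otimes> m = m" "m \<otimes> \<omega> m = m"
proof -
  obtain a where a: "a \<in> carrier M" "m \<otimes> a \<otimes> m = m" using regular m by (auto simp: regular_monoid_def)
  then have "m \<otimes> a \<in> B" using m by (simp add: idems_def m_assoc[symmetric])
  then have "(m \<otimes> a) \<otimes> m \<otimes> (m \<otimes> a) = (m \<otimes> a) \<otimes> m" using absorb m by simp
  then have sq: "m = m \<otimes> m \<otimes> a" using a m by (simp add: m_assoc)
  have pw: "m = m [^] Suc n \<otimes> a [^] n" for n :: nat
  proof (induction n)
    case (Suc n)
    have "m [^] Suc n = m [^] Suc (Suc n) \<otimes> a"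
    proof -
      have "m [^] Suc (Suc n) \<otimes> a = m [^] n \<otimes> (m \<otimes> m \<otimes> a)" using m a by (simp add: m_assoc)
      also have "\<dots> = m [^] Suc n" using sq by simp
      finally show ?thesis by simp
    qed
    then have "m = m [^] Suc (Suc n) \<otimes> a \<otimes> a [^] n" using Suc by simp
    then show ?case
      using m a nat_pow_mult[of a 1 n] by (simp add: m_assoc)
  qed (use m in simp)
  obtain n :: nat where n: "n > 0" "\<omega> m = m [^] n" using omega_power[OF m] by blast
  have "m = \<omega> m \<otimes> (m \<otimes> a [^] n)"
    using pw[of n] m a n by (simp add: m_assoc)
  moreover have "\<omega> m \<otimes> (\<omega> m \<otimes> (m \<otimes> a [^] n)) = \<omega> m \<otimes> (m \<otimes> a [^] n)"
    using idemD[OF omega_idem[OF m]] m a by (simp add: m_assoc[symmetric])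
  ultimately show left: "\<omega> m \<otimes> m = m" by metis
  have "m \<otimes> m [^] n = m [^] n \<otimes> m" using nat_pow_comm[of m 1 n] m by simp
  then show "m \<otimes> \<omega> m = m" using left n by simp
qed

lemma local_carrier:
  assumes "e \<in> B"
  shows "x \<in> carrier (local_monoid M e) \<longleftrightarrow> x \<in> carrier M \<and> e \<otimes> x = x \<and> x \<otimes> e = x"
proof
  assume "x \<in> carrier (local_monoid M e)"
  then obtain m where m: "m \<in> carrier M" "x = e \<otimes> m \<otimes> e" by (auto simp: local_monoid_def)
  have "e \<otimes> x = x" "x \<otimes> e = x"
    using idemD[OF assms] m absorb[OF assms m(1)] by (simp_all add: m_assoc[symmetric])
  then show "x \<in> carrier M \<and> e \<otimes> x = x \<and> x \<otimes> e = x" using idemD[OF assms] m by simp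
next
  assume "x \<in> carrier M \<and> e \<otimes> x = x \<and> x \<otimes> e = x"
  then have "x = e \<otimes> x \<otimes> e" "x \<in> carrier M" by simp_all
  then show "x \<in> carrier (local_monoid M e)" unfolding local_monoid_def by auto
qed

lemma local_monoid:
  assumes "e \<in> B"
  shows "monoid (local_monoid M e)"
proof (rule monoidI)
  note c = local_carrier[OF assms] and eM = idemD[OF assms]
  have [simp]: "x \<otimes>\<^bsub>local_monoid M e\<^esub> y = x \<otimes> y" "\<one>\<^bsub>local_monoid M e\<^esub> = e" for x y
    by (simp_all add: local_monoid_def)
  show "x \<otimes>\<^bsub>local_monoid M e\<^esub> y \<in> carrier (local_monoid M e)"
    if "x \<in> carrier (local_monoid M e)" "y \<in> carrier (local_monoid M e)" for x y
  proof -
    have "e \<otimes> (x \<otimes> y) = x \<otimes> y"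
      using that eM unfolding c by (simp add: m_assoc[symmetric])
    moreover have "x \<otimes> y \<otimes> e = x \<otimes> y"
      using that eM unfolding c by (simp add: m_assoc)
    ultimately show ?thesis using that unfolding c by simp
  qed
qed (use idemD[OF assms] local_carrier[OF assms] in \<open>simp_all add: local_monoid_def m_assoc\<close>)

lemma group_max_subgroup: "e \<in> B \<Longrightarrow> group (max_subgroup M e)"
  unfolding max_subgroup_def by (intro monoid.units_group local_monoid)

lemma max_subgroup_simps [simp]: "mult (max_subgroup M e) = mult M" "one (max_subgroup M e) = e"
  by (simp_all add: max_subgroup_def units_of_def local_monoid_def)

lemma in_max_subgroup:
  assumes "e \<in> B"
  shows "x \<in> carrier (max_subgroup M e) \<longleftrightarrow> x \<in> carrier M \<and> e \<otimes> x = x \<and> x \<otimes> e = x \<and>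
    (\<exists>y\<in>carrier M. e \<otimes> y = y \<and> y \<otimes> e = y \<and> x \<otimes> y = e \<and> y \<otimes> x = e)"
  using local_carrier[OF assms]
  by (auto simp: max_subgroup_def units_of_carrier Units_def) (auto simp: local_monoid_def)

lemma in_subgroup_omega:
  assumes m: "m \<in> carrier M"
  shows "m \<in> carrier (max_subgroup M (\<omega> m))"
proof -
  note w = omega_idem[OF m]
  obtain j :: nat where j: "\<omega> m = m [^] Suc j"
    using omega_power[OF m] by (metis gr0_conv_Suc)
  define y where "y = m [^] Suc (j + j)"
  have y: "y \<in> carrier M" using m by (simp add: y_def)
  have "y \<otimes> m = m [^] (Suc j + Suc j)" by (simp add: y_def)
  also have "\<dots> = m [^] Suc j \<otimes> m [^] Suc j" using m by (simp only: nat_pow_mult)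
  also have "\<dots> = \<omega> m" using idemD(2)[OF w] j by simp
  finally have ym: "y \<otimes> m = \<omega> m" .
  have com: "m [^] i \<otimes> y = y \<otimes> m [^] i" for i :: nat
    unfolding y_def using nat_pow_comm[of m i "Suc (j + j)"] m by simp
  have my: "m \<otimes> y = \<omega> m" using com[of 1] ym m by simp
  have "y \<otimes> \<omega> m = y" using omega_neutral(2)[OF m] m by (simp add: y_def m_assoc)
  moreover have "\<omega> m \<otimes> y = y \<otimes> \<omega> m" using com[of "Suc j"] unfolding j .
  ultimately have "\<omega> m \<otimes> y = y" "y \<otimes> \<omega> m = y" by simp_all
  then show ?thesis
    unfolding in_max_subgroup[OF w] using y ym my omega_neutral[OF m] m by blast
qed

lemma dagger_facts:
  assumes m: "m \<in> carrier M"
  shows "m\<^sup>\<dagger> \<in> carrier M" "m \<otimes> m\<^sup>\<dagger> = \<omega> m" "m\<^sup>\<dagger> \<otimes> m = \<omega> m" "\<omega> m \<otimes> m\<^sup>\<dagger> = m\<^sup>\<dagger>" "m\<^sup>\<dagger> \<otimes> \<omega> m = m\<^sup>\<dagger>"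
proof -
  interpret G: group "max_subgroup M (\<omega> m)" by (rule group_max_subgroup[OF omega_idem[OF m]])
  note i = G.inv_closed[OF in_subgroup_omega[OF m]]
  show "m\<^sup>\<dagger> \<in> carrier M" "\<omega> m \<otimes> m\<^sup>\<dagger> = m\<^sup>\<dagger>" "m\<^sup>\<dagger> \<otimes> \<omega> m = m\<^sup>\<dagger>"
    using i unfolding in_max_subgroup[OF omega_idem[OF m]] dagger_def by auto
  show "m \<otimes> m\<^sup>\<dagger> = \<omega> m" "m\<^sup>\<dagger> \<otimes> m = \<omega> m"
    using G.r_inv[OF in_subgroup_omega[OF m]] G.l_inv[OF in_subgroup_omega[OF m]]
    by (simp_all add: dagger_def)
qed

lemma dagger_closed [simp]: "m \<in> carrier M \<Longrightarrow> m\<^sup>\<dagger> \<in> carrier M" by (rule dagger_facts)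

text \<open>Idempotents that generate the same right ideal are equal, because \<open>efe = ef\<close>; so \<open>\<omega> m\<close> is
  the only idempotent that generates the right ideal \<open>mM\<close>.\<close>

lemma omega_eqI:
  assumes "f \<in> B" "x \<in> carrier M" "f \<otimes> x = x" "y \<in> carrier M" "x \<otimes> y = f"
  shows "\<omega> x = f"
proof -
  note w = omega_idem[OF assms(2)] and f = idemD[OF assms(1)]
  note W = idemD[OF w]
  have "f \<otimes> (x \<otimes> x\<^sup>\<dagger>) = x \<otimes> x\<^sup>\<dagger>"
    using dagger_facts(1)[OF assms(2)] assms(2,3) f by (simp add: m_assoc[symmetric])
  then have 1: "f \<otimes> \<omega> x = \<omega> x" using dagger_facts(2)[OF assms(2)] by simp
  have "\<omega> x \<otimes> (x \<otimes> y) = x \<otimes> y"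
    using omega_neutral(1)[OF assms(2)] assms(2,4) W by (simp add: m_assoc[symmetric])
  then have "\<omega> x \<otimes> f = f" using assms(5) by simp
  then show ?thesis using 1 absorb[OF assms(1) W(1)] by simp
qed

lemma omega_of_idem: "b \<in> B \<Longrightarrow> \<omega> b = b"
  using idemD[of b] by (intro omega_eqI[of b b b]) auto

lemma max_subgroup_iff: "e \<in> B \<Longrightarrow> x \<in> carrier (max_subgroup M e) \<longleftrightarrow> x \<in> carrier M \<and> \<omega> x = e"
  using in_subgroup_omega[of x] omega_eqI[of e x] by (auto simp: in_max_subgroup)

text \<open>The action on idempotents \<open>b \<mapsto> m b m\<^sup>\<dagger>\<close> is the left multiplication of right ideals: \<open>m b m\<^sup>\<dagger>\<close> is
  the idempotent that generates \<open>mbM\<close>. In this form it is visibly an action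
  (\<open>omega_mult_omega\<close>) and monotone (\<open>idem_le_conj\<close>).\<close>

lemma omega_mult_idem:
  assumes m: "m \<in> carrier M" and b: "b \<in> B"
  shows "\<omega> (m \<otimes> b) = m \<otimes> b \<otimes> m\<^sup>\<dagger>" (is "_ = ?f")
proof (rule omega_eqI)
  note d = dagger_facts[OF m] and bM = idemD[OF b] and w = omega_idem[OF m]
  note W = idemD[OF w]
  have mb: "m \<otimes> (b \<otimes> \<omega> m) = m \<otimes> b"
  proof -
    have "m \<otimes> (b \<otimes> \<omega> m) = \<omega> m \<otimes> (m \<otimes> b) \<otimes> \<omega> m" using omega_neutral(1)[OF m] m bM W by (simp add: m_assoc[symmetric])
    also have "\<dots> = \<omega> m \<otimes> (m \<otimes> b)" using m bM w by (intro absorb) auto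
    finally show ?thesis using omega_neutral(1)[OF m] m bM W by (simp add: m_assoc[symmetric])
  qed
  show fmb: "?f \<otimes> (m \<otimes> b) = m \<otimes> b"
  proof -
    have "?f \<otimes> (m \<otimes> b) = m \<otimes> (b \<otimes> (m\<^sup>\<dagger> \<otimes> m) \<otimes> b)" using m bM(1) d(1) by (simp add: m_assoc)
    also have "\<dots> = m \<otimes> (b \<otimes> \<omega> m)" using absorb[OF b W(1)] d by simp
    finally show ?thesis using mb by simp
  qed
  have "?f \<otimes> ?f = ?f \<otimes> (m \<otimes> b) \<otimes> m\<^sup>\<dagger>" using m bM d by (simp add: m_assoc)
  then show "?f \<in> B" using m bM d fmb by (simp add: idems_def)
qed (use m b idemD in auto)

lemma omega_mult_omega:
  assumes "m \<in> carrier M" "n \<in> carrier M"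
  shows "\<omega> (m \<otimes> \<omega> n) = \<omega> (m \<otimes> n)"
proof (rule omega_eqI[of _ _ "n \<otimes> (m \<otimes> n)\<^sup>\<dagger>"])
  note mn = m_closed[OF assms]
  show "\<omega> (m \<otimes> n) \<in> B" by (rule omega_idem[OF mn])
  have "\<omega> (m \<otimes> n) \<otimes> (m \<otimes> \<omega> n) = \<omega> (m \<otimes> n) \<otimes> (m \<otimes> n) \<otimes> n\<^sup>\<dagger>"
    using assms dagger_facts(2)[OF assms(2)] by (simp add: m_assoc)
  also have "\<dots> = m \<otimes> \<omega> n"
    using assms dagger_facts(2)[OF assms(2)] omega_neutral(1)[OF mn] by (simp add: m_assoc)
  finally show "\<omega> (m \<otimes> n) \<otimes> (m \<otimes> \<omega> n) = m \<otimes> \<omega> n" .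
  have "m \<otimes> \<omega> n \<otimes> (n \<otimes> (m \<otimes> n)\<^sup>\<dagger>) = m \<otimes> (\<omega> n \<otimes> n) \<otimes> (m \<otimes> n)\<^sup>\<dagger>"
    using assms by (simp add: m_assoc)
  then show "m \<otimes> \<omega> n \<otimes> (n \<otimes> (m \<otimes> n)\<^sup>\<dagger>) = \<omega> (m \<otimes> n)"
    using assms omega_neutral(1)[OF assms(2)] dagger_facts(2)[OF mn] by simp
qed (use assms in auto)

text \<open>The elements \<open>m\<close> with \<open>\<sigma> m \<ge> Bb\<close>.\<close>

definition above :: "'m \<Rightarrow> 'm \<Rightarrow> bool" where
  "above b m \<longleftrightarrow> b \<otimes> \<omega> m = b"

text \<open>A description of \<open>above\<close> without \<open>\<omega>\<close>, from which its multiplicativity can be read off.\<close>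

lemma above_iff:
  assumes b: "b \<in> B" and m: "m \<in> carrier M"
  shows "above b m \<longleftrightarrow> (\<exists>y\<in>carrier M. b \<otimes> m \<otimes> y = b)"
proof
  show "\<exists>y\<in>carrier M. b \<otimes> m \<otimes> y = b" if "above b m"
    using that dagger_facts[OF m] idemD[OF b] m
    by (intro bexI[of _ "m\<^sup>\<dagger>"]) (auto simp: above_def m_assoc)
  assume "\<exists>y\<in>carrier M. b \<otimes> m \<otimes> y = b"
  then obtain y where y: "y \<in> carrier M" "b \<otimes> m \<otimes> y = b" by blast
  note w = omega_idem[OF m] and bM = idemD[OF b]
  have my: "m \<otimes> y \<otimes> \<omega> m = m \<otimes> y"
    using absorb[OF w, of "m \<otimes> y"] omega_neutral(1)[OF m] m y idemD[OF w] by (simp add: m_assoc[symmetric])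
  have "b \<otimes> \<omega> m = b \<otimes> (m \<otimes> y \<otimes> \<omega> m)" 
  proof -
    have "b \<otimes> (m \<otimes> y \<otimes> \<omega> m) = (b \<otimes> m \<otimes> y) \<otimes> \<omega> m" using y(1) bM m by (simp add: m_assoc)
    then show ?thesis using y(2) by simp
  qed
  also have "\<dots> = b" unfolding my using y m bM by (simp add: m_assoc)
  finally show "above b m" by (simp add: above_def)
qed

lemma above_subgroup:
  assumes "b \<in> B" "m \<in> carrier M" "above b m"
  shows "\<omega> (b \<otimes> m) = b"
proof -
  obtain y where "y \<in> carrier M" "b \<otimes> m \<otimes> y = b" using assms above_iff by blast
  then show ?thesis
    using assms idemD[OF assms(1)] by (intro omega_eqI[of b _ y]) (simp_all add: m_assoc[symmetric])
qed

text \<open>The elements above \<open>b\<close> are those for which \<open>bm\<close> lies in the group of units of \<open>bMb\<close>, and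
  \<open>bmn = (bm)(bn)\<close>. So they form a submonoid whose complement is an ideal.\<close>

lemma above_mult:
  assumes b: "b \<in> B" and m: "m \<in> carrier M" and n: "n \<in> carrier M"
  shows "above b (m \<otimes> n) \<longleftrightarrow> above b m \<and> above b n"
proof -
  note bM = idemD[OF b]
  have bm: "b \<otimes> m \<in> carrier M" using bM m by simp
  have *: "above b (m \<otimes> n) \<longleftrightarrow> above b n" if am: "above b m"
  proof -
    let ?g = "b \<otimes> m"
    note w = above_subgroup[OF b m am] and d = dagger_facts[OF bm]
    show ?thesis
    proof
      assume "above b (m \<otimes> n)"
      then obtain y where y: "y \<in> carrier M" "b \<otimes> (m \<otimes> n) \<otimes> y = b"
        using above_iff[OF b] m n by auto
      have gn: "?g \<otimes> n = ?g \<otimes> (b \<otimes> n)" 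
        using absorb[OF b m] bM m n by (simp add: m_assoc[symmetric])
      have "?g \<otimes> (b \<otimes> n) \<otimes> y = b"
        unfolding gn[symmetric] using y bM(1) m n by (simp add: m_assoc)
      then have "?g\<^sup>\<dagger> \<otimes> (?g \<otimes> (b \<otimes> n) \<otimes> y \<otimes> ?g) = ?g\<^sup>\<dagger> \<otimes> (b \<otimes> ?g)" by simp
      moreover have "?g\<^sup>\<dagger> \<otimes> (?g \<otimes> (b \<otimes> n) \<otimes> y \<otimes> ?g) = (?g\<^sup>\<dagger> \<otimes> ?g) \<otimes> (b \<otimes> n \<otimes> y \<otimes> ?g)"
        using bM m n y d(1) by (simp add: m_assoc)
      moreover have "b \<otimes> ?g = ?g" using bM m by (simp add: m_assoc[symmetric])
      ultimately have "b \<otimes> (b \<otimes> n \<otimes> y \<otimes> ?g) = b" using d(3) w by simp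
      then have "b \<otimes> n \<otimes> (y \<otimes> ?g) = b" using bM m n y by (simp add: m_assoc[symmetric])
      then show "above b n" using above_iff[OF b n] y bm by auto
    next
      assume an: "above b n"
      have "b \<otimes> (m \<otimes> n) \<otimes> (n\<^sup>\<dagger> \<otimes> m\<^sup>\<dagger>) = b \<otimes> m \<otimes> (n \<otimes> n\<^sup>\<dagger>) \<otimes> m\<^sup>\<dagger>"
        using bM m n by (simp add: m_assoc)
      also have "\<dots> = b \<otimes> m \<otimes> b \<otimes> \<omega> n \<otimes> m\<^sup>\<dagger>"
        using absorb[OF b m] dagger_facts(2)[OF n] by simp
      also have "\<dots> = b \<otimes> m \<otimes> (b \<otimes> \<omega> n) \<otimes> m\<^sup>\<dagger>" using bM m n by (simp add: m_assoc)
      also have "\<dots> = b \<otimes> m \<otimes> m\<^sup>\<dagger>" using an absorb[OF b m] by (simp add: above_def)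
      also have "\<dots> = b" using am bM m dagger_facts(2)[OF m] by (simp add: m_assoc above_def)
      finally show "above b (m \<otimes> n)" using above_iff[OF b] m n by auto
    qed
  qed
  have "above b m" if mn: "above b (m \<otimes> n)"
  proof -
    obtain y where y: "y \<in> carrier M" "b \<otimes> (m \<otimes> n) \<otimes> y = b"
      using mn above_iff[OF b] m n by auto
    then have "b \<otimes> m \<otimes> (n \<otimes> y) = b" using bM m n by (simp add: m_assoc)
    then show ?thesis using above_iff[OF b m] n y by auto
  qed
  then show ?thesis using * by blast
qed

lemma above_one: "b \<in> B \<Longrightarrow> above b \<one>"
  using idemD[of b] by (simp add: above_def omega_of_idem one_idem)

lemma above_idem: "c \<in> B \<Longrightarrow> above b c \<longleftrightarrow> b \<otimes> c = b"
  by (simp add: above_def omega_of_idem)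

lemma above_omega: "m \<in> carrier M \<Longrightarrow> above b (\<omega> m) \<longleftrightarrow> above b m"
  by (simp add: above_def omega_of_idem omega_idem)

lemma above_trans:
  assumes "a \<in> B" "b \<in> B" "m \<in> carrier M" "a \<otimes> b = a" "above b m"
  shows "above a m"
  using assms below_trans[of a b "\<omega> m"] idemD(1) by (simp add: above_def)

text \<open>The support of \<open>m t m\<^sup>\<dagger>\<close> is the meet of \<open>Bt\<close> and \<open>\<sigma> m\<close>: it equals \<open>Bt\<close> if \<open>m\<close> is above \<open>t\<close>
  and is strictly smaller otherwise.\<close>

lemma conj_support:
  assumes m: "m \<in> carrier M" and t: "t \<in> B"
  shows "\<omega> (m \<otimes> t) \<otimes> t = \<omega> (m \<otimes> t)" "t \<otimes> \<omega> (m \<otimes> t) = t \<otimes> \<omega> m"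
proof -
  note d = dagger_facts[OF m] and tM = idemD[OF t]
  show "\<omega> (m \<otimes> t) \<otimes> t = \<omega> (m \<otimes> t)"
    unfolding omega_mult_idem[OF m t] using m tM absorb'[OF t d(1)] by (simp add: m_assoc)
  show "t \<otimes> \<omega> (m \<otimes> t) = t \<otimes> \<omega> m"
    unfolding omega_mult_idem[OF m t] using m tM d absorb''[OF t m d(1)] by (simp add: m_assoc)
qed

text \<open>The rank of \<open>b\<close> is a strictly monotone function of the support \<open>Bb\<close>.\<close>

definition rank :: "'m \<Rightarrow> nat" where
  "rank b = card {a \<in> B. a \<otimes> b = a}"

lemma rank_mono: "\<lbrakk>a \<in> B; b \<in> B; a \<otimes> b = a\<rbrakk> \<Longrightarrow> rank a \<le> rank b"
  unfolding rank_def using finite_B idemD[of a] idemD[of b]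
  by (intro card_mono) (auto intro: below_trans[of _ a b] idemD)

lemma rank_strict_mono: "\<lbrakk>a \<in> B; b \<in> B; a \<otimes> b = a; b \<otimes> a \<noteq> b\<rbrakk> \<Longrightarrow> rank a < rank b"
  unfolding rank_def using finite_B idemD[of a] idemD[of b]
  by (intro psubset_card_mono psubsetI) (auto intro: below_trans[of _ a b] idemD)

text \<open>A common choice of one idempotent in each class of idempotents with the same support.\<close>

definition base :: "'m \<Rightarrow> 'm" where
  "base t = (SOME a. a \<in> B \<and> a \<otimes> t = a \<and> t \<otimes> a = t)"

lemma base: "t \<in> B \<Longrightarrow> base t \<in> B \<and> base t \<otimes> t = base t \<and> t \<otimes> base t = t"
  unfolding base_def by (rule someI[of _ t]) (simp add: idemD)

lemma base_cong:
  assumes "s \<in> B" "t \<in> B" "s \<otimes> t = s" "t \<otimes> s = t"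
  shows "base s = base t"
proof -
  have "a \<otimes> s = a \<and> s \<otimes> a = s \<longleftrightarrow> a \<otimes> t = a \<and> t \<otimes> a = t" if "a \<in> B" for a
    using that assms idemD(1) below_trans[of a s t] below_trans[of t s a]
      below_trans[of a t s] below_trans[of s t a] by auto
  then show ?thesis unfolding base_def by (metis (no_types, opaque_lifting))
qed

lemma coset_le_iff:
  assumes "a \<in> B" "b \<in> B"
  shows "B #> a \<subseteq> B #> b \<longleftrightarrow> a \<otimes> b = a"
proof
  assume sub: "B #> a \<subseteq> B #> b"
  have "a \<in> B #> a" using idemD[OF assms(1)] assms(1) unfolding r_coset_def by force
  then obtain x where x: "x \<in> B" "a = x \<otimes> b" using sub by (auto simp: r_coset_def)
  then show "a \<otimes> b = a" using idemD[OF x(1)] idemD[OF assms(2)] by (simp add: m_assoc)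
next
  assume ab: "a \<otimes> b = a"
  show "B #> a \<subseteq> B #> b"
  proof
    fix y assume "y \<in> B #> a"
    then obtain x where x: "x \<in> B" "y = x \<otimes> a" by (auto simp: r_coset_def)
    have "y = (x \<otimes> a) \<otimes> b" using x ab idemD[OF x(1)] idemD[OF assms(1)] idemD[OF assms(2)] by (simp add: m_assoc)
    then show "y \<in> B #> b" using idem_mult[OF x(1) assms(1)] by (auto simp: r_coset_def)
  qed
qed

lemma in_monoid_ge:
  "e \<in> B \<Longrightarrow> m \<in> carrier (monoid_ge M (B #> e)) \<longleftrightarrow> m \<in> carrier M \<and> above e m"
  using coset_le_iff[OF _ omega_idem] by (auto simp: monoid_ge_def sigma_def above_def)

lemma in_idems_ge: "e \<in> B \<Longrightarrow> b \<in> idems_ge M (B #> e) \<longleftrightarrow> b \<in> B \<and> e \<otimes> b = e"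
  using coset_le_iff by (auto simp: idems_ge_def)

lemma idem_le_refl: "a \<in> B \<Longrightarrow> idem_le M a a"
  by (simp add: idem_le_def idemD)

lemma idem_le_antisym: "\<lbrakk>a \<in> B; b \<in> B; idem_le M a b; idem_le M b a\<rbrakk> \<Longrightarrow> a = b"
  using absorb[of a b] idemD[of a] idemD[of b] by (auto simp: idem_le_def)

text \<open>\<open>e \<le> f\<close> holds iff \<open>e\<close> lies in the right ideal \<open>fM\<close>, so the action preserves the order.\<close>

lemma idem_le_conj:
  assumes m: "m \<in> carrier M" and a: "a \<in> B" and b: "b \<in> B" and le: "idem_le M a b"
  shows "idem_le M (\<omega> (m \<otimes> a)) (\<omega> (m \<otimes> b))"
proof -
  note aM = idemD(1)[OF a] and bM = idemD(1)[OF b]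
  have w: "\<omega> (m \<otimes> b) \<in> carrier M" using m bM by simp
  have "\<omega> (m \<otimes> a) = m \<otimes> b \<otimes> (a \<otimes> m\<^sup>\<dagger>)"
    using omega_mult_idem[OF m a] le m aM bM by (simp add: idem_le_def m_assoc[symmetric]) (simp add: m_assoc)
  then have "\<omega> (m \<otimes> b) \<otimes> \<omega> (m \<otimes> a) = (\<omega> (m \<otimes> b) \<otimes> (m \<otimes> b)) \<otimes> (a \<otimes> m\<^sup>\<dagger>)"
    using w m aM bM by (simp add: m_assoc)
  also have "\<omega> (m \<otimes> b) \<otimes> (m \<otimes> b) = m \<otimes> b" using omega_neutral(1)[of "m \<otimes> b"] m bM by simp
  finally show ?thesis using \<open>\<omega> (m \<otimes> a) = m \<otimes> b \<otimes> (a \<otimes> m\<^sup>\<dagger>)\<close> by (simp add: idem_le_def)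
qed

lemma conj_ge:
  assumes e: "e \<in> B" and m: "m \<in> carrier M" "above e m" and b: "b \<in> B" "e \<otimes> b = e"
  shows "e \<otimes> \<omega> (m \<otimes> b) = e"
proof -
  have "above e b" using b by (simp add: above_idem)
  then have "above e (m \<otimes> b)" using above_mult[OF e m(1) idemD(1)[OF b(1)]] m(2) by simp
  then show ?thesis by (simp add: above_def)
qed

end

section \<open>Projectivity\<close>

locale left_duo_algebra = regular_left_duo_monoid M + finite_monoid_algebra K M
  for K :: "('k, 'y) ring_scheme" and M :: "('m, 'x) monoid_scheme" (structure)
begin

lemma support_mult_basis:
  assumes "\<alpha> \<in> carrier R" "c \<in> carrier M" "(\<alpha> \<otimes>\<^bsub>R\<^esub> basis K c) x \<noteq> \<zero>\<^bsub>K\<^esub>"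
  shows "\<exists>y\<in>carrier M. x = y \<otimes> c"
proof (rule ccontr)
  assume no: "\<not> (\<exists>y\<in>carrier M. x = y \<otimes> c)"
  note bc = basis_in[OF assms(2)]
  have "(\<alpha> \<otimes>\<^bsub>R\<^esub> basis K c) x = \<zero>\<^bsub>K\<^esub>"
    unfolding mult_val[OF assms(1) bc]
  proof (intro K.add.finprod_one_eqI)
    fix y z assume y: "y \<in> carrier M" and z: "z \<in> carrier M"
    show "(if y \<otimes> z = x then \<alpha> y \<otimes>\<^bsub>K\<^esub> basis K c z else \<zero>\<^bsub>K\<^esub>) = \<zero>\<^bsub>K\<^esub>"
      using no y KN.val_closed[OF assms(1), of y] by (auto simp: single_def)
  qed
  then show False using assms(3) by simp
qed

lemma algebra_absorb:
  assumes "c \<in> B" "\<alpha> \<in> carrier R"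
  shows "basis K c \<otimes>\<^bsub>R\<^esub> (\<alpha> \<otimes>\<^bsub>R\<^esub> basis K c) = basis K c \<otimes>\<^bsub>R\<^esub> \<alpha>"
proof -
  note c = idemD(1)[OF assms(1)]
  note bc = basis_in[OF c]
  show ?thesis
  proof (rule KN.additive_eqI[OF _ _ _ assms(2)])
    show "additive_map R R (\<lambda>\<alpha>. basis K c \<otimes>\<^bsub>R\<^esub> (\<alpha> \<otimes>\<^bsub>R\<^esub> basis K c))"
      by (rule additive_comp[OF additive_mult_right[OF bc] additive_mult_left[OF bc]])
    show "additive_map R R (\<lambda>\<alpha>. basis K c \<otimes>\<^bsub>R\<^esub> \<alpha>)" by (rule additive_mult_left[OF bc])
  qed (use c absorb'[OF assms(1)] in \<open>simp add: mult_single\<close>)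
qed

text \<open>The element \<open>1 - u\<close> is the product, in any order, of the factors \<open>1 - c\<close> for the idempotents \<open>c\<close>
  that are not above \<open>b\<close>. If \<open>m\<close> is not above \<open>b\<close>, then \<open>c = \<omega> m\<close> is one of these \<open>c\<close> and \<open>m = mc\<close>.
  For all \<open>w\<close> between \<open>m\<close> and the factor \<open>1 - c\<close> we get \<open>m w (1 - c) = m (c w - c w c) = 0\<close>, as
  \<open>c w c = c w\<close>.\<close>

lemma annihilated_element:
  assumes b: "b \<in> B"
  shows "\<exists>u\<in>carrier R. (\<forall>m. u m \<noteq> \<zero>\<^bsub>K\<^esub> \<longrightarrow> \<not> above b m) \<and>
    (\<forall>m\<in>carrier M. \<not> above b m \<longrightarrow> basis K m \<otimes>\<^bsub>R\<^esub> (\<one>\<^bsub>R\<^esub> \<ominus>\<^bsub>R\<^esub> u) = \<zero>\<^bsub>R\<^esub>)"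
proof -
  have "\<exists>u\<in>carrier R. (\<forall>m. u m \<noteq> \<zero>\<^bsub>K\<^esub> \<longrightarrow> \<not> above b m) \<and>
      (\<forall>c\<in>F. \<forall>m\<in>carrier M. m \<otimes> c = m \<longrightarrow> basis K m \<otimes>\<^bsub>R\<^esub> (\<one>\<^bsub>R\<^esub> \<ominus>\<^bsub>R\<^esub> u) = \<zero>\<^bsub>R\<^esub>)"
    if "finite F" "F \<subseteq> {c \<in> B. \<not> above b c}" for F
    using that
  proof (induction F rule: finite_induct)
    case empty
    show ?case by (rule bexI[OF _ KN.P.zero_closed]) (simp add: KN.zero_P)
  next
    case (insert c F)
    then obtain u where u: "u \<in> carrier R" "\<And>m. u m \<noteq> \<zero>\<^bsub>K\<^esub> \<Longrightarrow> \<not> above b m"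
      "\<And>c m. \<lbrakk>c \<in> F; m \<in> carrier M; m \<otimes> c = m\<rbrakk> \<Longrightarrow> basis K m \<otimes>\<^bsub>R\<^esub> (\<one>\<^bsub>R\<^esub> \<ominus>\<^bsub>R\<^esub> u) = \<zero>\<^bsub>R\<^esub>"
      by blast
    have c: "c \<in> B" "\<not> above b c" using insert by auto
    note cM = idemD(1)[OF c(1)]
    note bc = basis_in[OF cM]
    define z where "z = \<one>\<^bsub>R\<^esub> \<ominus>\<^bsub>R\<^esub> u"
    have z: "z \<in> carrier R" using u by (simp add: z_def)
    define u' where "u' = u \<oplus>\<^bsub>R\<^esub> z \<otimes>\<^bsub>R\<^esub> basis K c"
    have zc: "z \<otimes>\<^bsub>R\<^esub> basis K c \<in> carrier R" using z bc by simp
    have z': "\<one>\<^bsub>R\<^esub> \<ominus>\<^bsub>R\<^esub> u' = z \<ominus>\<^bsub>R\<^esub> z \<otimes>\<^bsub>R\<^esub> basis K c"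
      unfolding u'_def using u(1) zc
      by (simp add: z_def[symmetric] KN.P.minus_eq KN.P.minus_add KN.P.a_assoc[symmetric]) (simp add: z_def KN.P.minus_eq)
    show ?case
    proof (intro bexI[of _ u'] conjI allI ballI impI)
      show "u' \<in> carrier R" using u z bc by (simp add: u'_def)
      show "\<not> above b m" if "u' m \<noteq> \<zero>\<^bsub>K\<^esub>" for m
      proof -
        have "u m \<noteq> \<zero>\<^bsub>K\<^esub> \<or> (z \<otimes>\<^bsub>R\<^esub> basis K c) m \<noteq> \<zero>\<^bsub>K\<^esub>"
          using that by (auto simp: u'_def KN.add_P)
        then show ?thesis
        proof
          assume "(z \<otimes>\<^bsub>R\<^esub> basis K c) m \<noteq> \<zero>\<^bsub>K\<^esub>"
          then obtain y where "y \<in> carrier M" "m = y \<otimes> c" using support_mult_basis[OF z cM] by blast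
          then show ?thesis using above_mult[OF b _ cM] c by simp
        qed (use u in blast)
      qed
      fix c' m assume c': "c' \<in> insert c F" and m: "m \<in> carrier M" "m \<otimes> c' = m"
      note bm = basis_in[OF m(1)]
      have "basis K m \<otimes>\<^bsub>R\<^esub> z \<ominus>\<^bsub>R\<^esub> basis K m \<otimes>\<^bsub>R\<^esub> z \<otimes>\<^bsub>R\<^esub> basis K c = \<zero>\<^bsub>R\<^esub>"
      proof (cases "c' = c")
        case True
        then have "basis K m = basis K m \<otimes>\<^bsub>R\<^esub> basis K c" using m by (simp add: mult_single)
        then have "basis K m \<otimes>\<^bsub>R\<^esub> (z \<otimes>\<^bsub>R\<^esub> basis K c) = basis K m \<otimes>\<^bsub>R\<^esub> (basis K c \<otimes>\<^bsub>R\<^esub> (z \<otimes>\<^bsub>R\<^esub> basis K c))"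
          using bm bc zc by (metis R.m_assoc)
        also have "\<dots> = basis K m \<otimes>\<^bsub>R\<^esub> basis K c \<otimes>\<^bsub>R\<^esub> z"
          unfolding algebra_absorb[OF c(1) z] using bm bc z by (simp add: R.m_assoc)
        also have "\<dots> = basis K m \<otimes>\<^bsub>R\<^esub> z" using m True by (simp add: mult_single)
        finally show ?thesis using bm bc z by (simp add: R.m_assoc KN.P.minus_eq KN.P.r_neg)
      next
        case False
        then have "basis K m \<otimes>\<^bsub>R\<^esub> z = \<zero>\<^bsub>R\<^esub>" using u(3)[of c' m] c' m by (simp add: z_def)
        then show ?thesis using bc by (simp add: KN.P.minus_eq)
      qed
      then show "basis K m \<otimes>\<^bsub>R\<^esub> (\<one>\<^bsub>R\<^esub> \<ominus>\<^bsub>R\<^esub> u') = \<zero>\<^bsub>R\<^esub>"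
        unfolding z' using bm bc z by (simp add: KN.P.minus_eq R.r_distr R.r_minus R.m_assoc)
    qed
  qed
  from this[of "{c \<in> B. \<not> above b c}"] obtain u where u: "u \<in> carrier R"
    "\<And>m. u m \<noteq> \<zero>\<^bsub>K\<^esub> \<Longrightarrow> \<not> above b m"
    "\<And>c m. \<lbrakk>c \<in> B; \<not> above b c; m \<in> carrier M; m \<otimes> c = m\<rbrakk> \<Longrightarrow>
      basis K m \<otimes>\<^bsub>R\<^esub> (\<one>\<^bsub>R\<^esub> \<ominus>\<^bsub>R\<^esub> u) = \<zero>\<^bsub>R\<^esub>"
    using finite_B by auto
  then show ?thesis using omega_idem omega_neutral(2) above_omega by blast
qed

lemma scalar_central:
  assumes "k \<in> carrier K" "\<alpha> \<in> carrier R"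
  shows "single K \<one> k \<otimes>\<^bsub>R\<^esub> \<alpha> = \<alpha> \<otimes>\<^bsub>R\<^esub> single K \<one> k"
proof -
  have k: "single K \<one> k \<in> carrier R" using assms by (simp add: KN.single_in)
  show ?thesis
    by (rule KN.additive_eqI[OF additive_mult_left[OF k] additive_mult_right[OF k] _ assms(2)])
      (use assms in \<open>simp add: mult_single K.m_comm\<close>)
qed

end

text \<open>A projectivity criterion: if \<open>p \<mapsto> p - s p\<close> takes \<open>P\<close> into a projective submodule and all
  \<open>g \<circ> s\<close> can be lifted, then so can all \<open>g = g \<circ> (1 - s) + g \<circ> s\<close>.\<close>

lemma projective_extension:
  fixes P :: "('r, 'p) module" and R :: "('r, 'w) ring_scheme"
  assumes P: "left_module R P"
    and P': "projective_module TYPE('a) TYPE('b) R (P\<lparr>carrier := C\<rparr>)"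
    and C: "C \<subseteq> carrier P"
    and s: "s \<in> lmod_hom R P P" and sC: "\<And>p. p \<in> carrier P \<Longrightarrow> p \<ominus>\<^bsub>P\<^esub> s p \<in> C"
    and lift: "\<And>(A :: ('r, 'a) module) (B :: ('r, 'b) module) f g.
      \<lbrakk>left_module R A; left_module R B; f \<in> lmod_hom R A B; f ` carrier A = carrier B;
       g \<in> lmod_hom R P B\<rbrakk> \<Longrightarrow> \<exists>h \<in> lmod_hom R P A. \<forall>p \<in> carrier P. f (h p) = g (s p)"
  shows "projective_module TYPE('a) TYPE('b) R P"
  unfolding projective_module_def
proof (intro conjI allI impI P)
  fix A :: "('r, 'a) module" and B :: "('r, 'b) module" and f g
  assume "left_module R A \<and> left_module R B \<and> f \<in> lmod_hom R A B \<and> f ` carrier A = carrier B \<and>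
    g \<in> lmod_hom R P B"
  then have A: "left_module R A" and B: "left_module R B" and f: "f \<in> lmod_hom R A B"
    and surj: "f ` carrier A = carrier B" and g: "g \<in> lmod_hom R P B" by auto
  interpret P: left_module R P by fact
  interpret A: left_module R A by fact
  interpret B: left_module R B by fact
  interpret f: additive_map A B f
    by (rule additive_mapD_lmod_hom[OF A.M.abelian_group_axioms B.M.abelian_group_axioms f])
  interpret g: additive_map P B g
    by (rule additive_mapD_lmod_hom[OF P.M.abelian_group_axioms B.M.abelian_group_axioms g])
  interpret s: additive_map P P s
    by (rule additive_mapD_lmod_hom[OF P.M.abelian_group_axioms P.M.abelian_group_axioms s])
  have ss: "s (r \<odot>\<^bsub>P\<^esub> p) = r \<odot>\<^bsub>P\<^esub> s p" if "r \<in> carrier R" "p \<in> carrier P" for r p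
    using s that by (auto simp: lmod_hom_def)
  have "g \<in> lmod_hom R (P\<lparr>carrier := C\<rparr>) B"
    using g.closed g.add g subsetD[OF C] unfolding lmod_hom_def hom_def by simp
  then have "\<exists>h\<in>lmod_hom R (P\<lparr>carrier := C\<rparr>) A. \<forall>p\<in>carrier (P\<lparr>carrier := C\<rparr>). f (h p) = g p"
    using P' A B f surj unfolding projective_module_def by blast
  then obtain h0 where h0: "h0 \<in> lmod_hom R (P\<lparr>carrier := C\<rparr>) A" "\<And>p. p \<in> C \<Longrightarrow> f (h0 p) = g p"
    by auto
  have h0c: "h0 p \<in> carrier A" if "p \<in> C" for p
    using h0 that by (auto simp: lmod_hom_def hom_def)
  have h0a: "h0 (p \<oplus>\<^bsub>P\<^esub> q) = h0 p \<oplus>\<^bsub>A\<^esub> h0 q" if "p \<in> C" "q \<in> C" for p q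
    using h0 that by (auto simp: lmod_hom_def hom_def)
  have h0s: "h0 (r \<odot>\<^bsub>P\<^esub> p) = r \<odot>\<^bsub>A\<^esub> h0 p" if "r \<in> carrier R" "p \<in> C" for r p
    using h0 that by (auto simp: lmod_hom_def hom_def)
  obtain h1 where h1: "h1 \<in> lmod_hom R P A" "\<And>p. p \<in> carrier P \<Longrightarrow> f (h1 p) = g (s p)"
    using lift[OF A B f surj g] by blast
  have h1c: "h1 p \<in> carrier A" if "p \<in> carrier P" for p
    using h1 that by (auto simp: lmod_hom_def hom_def)
  have h1a: "h1 (p \<oplus>\<^bsub>P\<^esub> q) = h1 p \<oplus>\<^bsub>A\<^esub> h1 q" if "p \<in> carrier P" "q \<in> carrier P" for p q
    using h1 that by (auto simp: lmod_hom_def hom_def)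
  have h1s: "h1 (r \<odot>\<^bsub>P\<^esub> p) = r \<odot>\<^bsub>A\<^esub> h1 p" if "r \<in> carrier R" "p \<in> carrier P" for r p
    using h1 that by (auto simp: lmod_hom_def hom_def)
  define d where "d p = p \<ominus>\<^bsub>P\<^esub> s p" for p
  have dC: "d p \<in> C" if "p \<in> carrier P" for p using sC that by (simp add: d_def)
  have da: "d (p \<oplus>\<^bsub>P\<^esub> q) = d p \<oplus>\<^bsub>P\<^esub> d q" if "p \<in> carrier P" "q \<in> carrier P" for p q
    using that s.closed by (simp add: d_def s.add P.M.minus_eq P.M.minus_add P.M.a_ac)
  have ds: "d (r \<odot>\<^bsub>P\<^esub> p) = r \<odot>\<^bsub>P\<^esub> d p" if r: "r \<in> carrier R" and p: "p \<in> carrier P" for r p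
  proof -
    have "additive_map P P (\<lambda>p. r \<odot>\<^bsub>P\<^esub> p)"
      using r by unfold_locales (simp_all add: P.smult_r_distr)
    from additive_map.diff[OF this p s.closed[OF p]] show ?thesis
      using ss[OF r p] by (simp add: d_def)
  qed
  show "\<exists>h\<in>lmod_hom R P A. \<forall>p\<in>carrier P. f (h p) = g p"
  proof (intro bexI[of _ "\<lambda>p. h0 (d p) \<oplus>\<^bsub>A\<^esub> h1 p"] ballI)
    show "(\<lambda>p. h0 (d p) \<oplus>\<^bsub>A\<^esub> h1 p) \<in> lmod_hom R P A"
      unfolding lmod_hom_def hom_def
    proof (intro CollectI conjI ballI funcsetI)
      fix p q assume pq: "p \<in> carrier (add_monoid P)" "q \<in> carrier (add_monoid P)"
      have "h0 (d (p \<oplus>\<^bsub>P\<^esub> q)) \<oplus>\<^bsub>A\<^esub> h1 (p \<oplus>\<^bsub>P\<^esub> q) =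
          (h0 (d p) \<oplus>\<^bsub>A\<^esub> h0 (d q)) \<oplus>\<^bsub>A\<^esub> (h1 p \<oplus>\<^bsub>A\<^esub> h1 q)"
        using pq by (simp add: da h0a h1a dC)
      then show "h0 (d (p \<otimes>\<^bsub>add_monoid P\<^esub> q)) \<oplus>\<^bsub>A\<^esub> h1 (p \<otimes>\<^bsub>add_monoid P\<^esub> q) =
          (h0 (d p) \<oplus>\<^bsub>A\<^esub> h1 p) \<otimes>\<^bsub>add_monoid A\<^esub> (h0 (d q) \<oplus>\<^bsub>A\<^esub> h1 q)"
        using pq h0c h1c dC by (simp add: A.M.a_ac)
    qed (use h0c h1c dC in \<open>simp_all add: ds h0s h1s A.smult_r_distr\<close>)
    fix p assume p: "p \<in> carrier P"
    have "f (h0 (d p) \<oplus>\<^bsub>A\<^esub> h1 p) = g (d p) \<oplus>\<^bsub>B\<^esub> g (s p)"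
      using p h0c h1c dC by (simp add: f.add h0(2) h1(2))
    also have "\<dots> = g (d p \<oplus>\<^bsub>P\<^esub> s p)" using p dC C s.closed by (intro g.add[symmetric]) auto
    also have "d p \<oplus>\<^bsub>P\<^esub> s p = p" using p s.closed by (simp add: d_def P.M.minus_eq P.M.a_assoc P.M.l_neg)
    finally show "f (h0 (d p) \<oplus>\<^bsub>A\<^esub> h1 p) = g p" .
  qed
qed

text \<open>The map \<open>top\<close> generalizes the greatest vertex of a simplex. From the axioms, \<open>m\<close> is defined on
  \<open>s\<close> and preserves the support of the top if \<open>m\<close> is above \<open>top s\<close> (\<open>act_above\<close>), and otherwise it is
  undefined on \<open>s\<close> or lowers this support (\<open>rank_act_less\<close>). The family \<open>b\<close> witnesses that \<open>V\<close> has
  finite dimension over \<open>K\<close>.\<close>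

locale topped_action = left_duo_algebra K M + partial_action K M V S P act
  for K :: "('k, 'y) ring_scheme" and M :: "('m, 'x) monoid_scheme" (structure)
    and V :: "('m \<Rightarrow> 'k, 'v) module" and S :: "'s set"
    and P :: "('m \<Rightarrow> 'k, 's \<Rightarrow> 'v) module" and act :: "'m \<Rightarrow> 's \<Rightarrow> 's option" +
  fixes top :: "'s \<Rightarrow> 'm" and I :: "'i set" and b :: "'i \<Rightarrow> 'v"
  assumes top_idem: "s \<in> S \<Longrightarrow> top s \<in> idems M"
    and top_act: "\<lbrakk>m \<in> carrier M; s \<in> S; act m s = Some t\<rbrakk> \<Longrightarrow> top t = omega M (m \<otimes> top s)"
    and act_top: "s \<in> S \<Longrightarrow> act (top s) s = Some s"
    and top_trivial: "\<lbrakk>s \<in> S; v \<in> carrier V\<rbrakk> \<Longrightarrow> basis K (top s) \<odot>\<^bsub>V\<^esub> v = v"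
    and field_K: "field K"
    and order_invertible: "f \<in> idems M \<Longrightarrow> [order (max_subgroup M f)] \<cdot>\<^bsub>K\<^esub> \<one>\<^bsub>K\<^esub> \<noteq> \<zero>\<^bsub>K\<^esub>"
    and finite_I: "finite I" and b_closed: "i \<in> I \<Longrightarrow> b i \<in> carrier V"
    and b_span: "v \<in> carrier V \<Longrightarrow>
      \<exists>x. (\<forall>i\<in>I. x i \<in> carrier K) \<and> v = (\<Oplus>\<^bsub>V\<^esub>i\<in>I. single K \<one> (x i) \<odot>\<^bsub>V\<^esub> b i)"
begin

text \<open>A choice of \<open>u\<close> as in \<open>annihilated_element\<close>.\<close>

definition annih :: "'m \<Rightarrow> 'm \<Rightarrow> 'k" where
  "annih \<beta> = (SOME u. u \<in> carrier R \<and> (\<forall>m. u m \<noteq> \<zero>\<^bsub>K\<^esub> \<longrightarrow> \<not> above \<beta> m) \<and>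
    (\<forall>m\<in>carrier M. \<not> above \<beta> m \<longrightarrow> basis K m \<otimes>\<^bsub>R\<^esub> (\<one>\<^bsub>R\<^esub> \<ominus>\<^bsub>R\<^esub> u) = \<zero>\<^bsub>R\<^esub>))"

lemma annih:
  assumes "\<beta> \<in> B"
  shows "annih \<beta> \<in> carrier R" "annih \<beta> m \<noteq> \<zero>\<^bsub>K\<^esub> \<Longrightarrow> \<not> above \<beta> m"
    "\<lbrakk>m \<in> carrier M; \<not> above \<beta> m\<rbrakk> \<Longrightarrow> basis K m \<otimes>\<^bsub>R\<^esub> (\<one>\<^bsub>R\<^esub> \<ominus>\<^bsub>R\<^esub> annih \<beta>) = \<zero>\<^bsub>R\<^esub>"
  using someI_ex[OF annihilated_element[OF assms, unfolded Bex_def]] unfolding annih_def by blast+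

abbreviation G where "G \<beta> \<equiv> carrier (max_subgroup M \<beta>)"

text \<open>The inverse of the order of the maximal subgroup at \<open>\<beta>\<close>, as an element of \<open>KM\<close>.\<close>

definition avg :: "'m \<Rightarrow> 'm \<Rightarrow> 'k" where
  "avg \<beta> = single K \<one> (inv\<^bsub>K\<^esub> ([order (max_subgroup M \<beta>)] \<cdot>\<^bsub>K\<^esub> \<one>\<^bsub>K\<^esub>))"

lemma avg_scalar:
  assumes "\<beta> \<in> B"
  shows "inv\<^bsub>K\<^esub> ([order (max_subgroup M \<beta>)] \<cdot>\<^bsub>K\<^esub> \<one>\<^bsub>K\<^esub>) \<in> carrier K"
    "inv\<^bsub>K\<^esub> ([order (max_subgroup M \<beta>)] \<cdot>\<^bsub>K\<^esub> \<one>\<^bsub>K\<^esub>) \<otimes>\<^bsub>K\<^esub> ([order (max_subgroup M \<beta>)] \<cdot>\<^bsub>K\<^esub> \<one>\<^bsub>K\<^esub>) = \<one>\<^bsub>K\<^esub>"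
proof -
  interpret F: field K by (rule field_K)
  have "[order (max_subgroup M \<beta>)] \<cdot>\<^bsub>K\<^esub> \<one>\<^bsub>K\<^esub> \<in> Units K"
    using order_invertible[OF assms] F.field_Units by simp
  then show "inv\<^bsub>K\<^esub> ([order (max_subgroup M \<beta>)] \<cdot>\<^bsub>K\<^esub> \<one>\<^bsub>K\<^esub>) \<in> carrier K"
    "inv\<^bsub>K\<^esub> ([order (max_subgroup M \<beta>)] \<cdot>\<^bsub>K\<^esub> \<one>\<^bsub>K\<^esub>) \<otimes>\<^bsub>K\<^esub> ([order (max_subgroup M \<beta>)] \<cdot>\<^bsub>K\<^esub> \<one>\<^bsub>K\<^esub>) = \<one>\<^bsub>K\<^esub>"
    by (rule K.Units_inv_closed, rule K.Units_l_inv)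
qed

lemma avg_closed: "\<beta> \<in> B \<Longrightarrow> avg \<beta> \<in> carrier R"
  by (simp add: avg_def KN.single_in avg_scalar)

lemma avg_sum:
  assumes "\<beta> \<in> B" "p \<in> carrier P"
  shows "avg \<beta> \<odot>\<^bsub>P\<^esub> (\<Oplus>\<^bsub>P\<^esub>k\<in>G \<beta>. p) = p"
proof -
  have n: "single K \<one> ([n] \<cdot>\<^bsub>K\<^esub> \<one>\<^bsub>K\<^esub>) \<odot>\<^bsub>P\<^esub> p = [n] \<cdot>\<^bsub>P\<^esub> p" for n :: nat
  proof (induction n)
    case (Suc n)
    have "([n] \<cdot>\<^bsub>K\<^esub> \<one>\<^bsub>K\<^esub> \<oplus>\<^bsub>K\<^esub> \<one>\<^bsub>K\<^esub>) \<odot>\<^bsub>scalar_module K M P\<^esub> p =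
        [n] \<cdot>\<^bsub>K\<^esub> \<one>\<^bsub>K\<^esub> \<odot>\<^bsub>scalar_module K M P\<^esub> p \<oplus>\<^bsub>P\<^esub> \<one>\<^bsub>K\<^esub> \<odot>\<^bsub>scalar_module K M P\<^esub> p"
      using assms PM.SC.smult_l_distr[of "[n] \<cdot>\<^bsub>K\<^esub> \<one>\<^bsub>K\<^esub>" "\<one>\<^bsub>K\<^esub>" p] by simp
    then show ?case using Suc assms PM.op_one by simp
  next
    case 0
    show ?case using PM.SC.smult_l_null[of p] assms by simp
  qed
  have "(\<Oplus>\<^bsub>P\<^esub>k\<in>G \<beta>. p) = [card (G \<beta>)] \<cdot>\<^bsub>P\<^esub> p"
    using assms by (intro P.add.finprod_const)
  also have "\<dots> = single K \<one> ([order (max_subgroup M \<beta>)] \<cdot>\<^bsub>K\<^esub> \<one>\<^bsub>K\<^esub>) \<odot>\<^bsub>P\<^esub> p"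
    using n by (simp add: order_def)
  finally show ?thesis
    using PM.A.smult_assoc1[of "avg \<beta>" "single K \<one> ([order (max_subgroup M \<beta>)] \<cdot>\<^bsub>K\<^esub> \<one>\<^bsub>K\<^esub>)" p] assms
    by (simp add: avg_def mult_single avg_scalar KN.single_in PM.op_one)
qed

lemma top_support:
  assumes "m \<in> carrier M" "s \<in> S" "act m s = Some t"
  shows "top t \<otimes> top s = top t" "top s \<otimes> top t = top s \<otimes> \<omega> m"
  using conj_support[OF assms(1) top_idem[OF assms(2)]] top_act[OF assms] by simp_all

lemma rank_act:
  assumes "m \<in> carrier M" "s \<in> S" "act m s = Some t"
  shows "rank (top t) \<le> rank (top s)"
  using top_support(1)[OF assms] by (intro rank_mono top_idem assms act_closed[OF assms])

lemma rank_act_less: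
  assumes "m \<in> carrier M" "s \<in> S" "act m s = Some t" "\<not> above (top s) m"
  shows "rank (top t) < rank (top s)"
proof (rule rank_strict_mono)
  show "top s \<otimes> top t \<noteq> top s" using top_support(2)[OF assms(1-3)] assms(4) by (simp add: above_def)
qed (intro top_idem assms act_closed[OF assms(1-3)] top_support(1)[OF assms(1-3)])+

text \<open>If \<open>m\<close> is above \<open>top s\<close>, then \<open>(top s) m\<^sup>\<dagger> m = top s\<close> fixes \<open>s\<close>, so \<open>m\<close> must be defined on \<open>s\<close>.\<close>

lemma act_above:
  assumes m: "m \<in> carrier M" and s: "s \<in> S" and ab: "above (top s) m"
  obtains t where "act m s = Some t" "t \<in> S" "top t \<otimes> top s = top t" "top s \<otimes> top t = top s"
proof -
  have w: "\<omega> m \<in> carrier M" using m by simp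
  have "Some s = act (top s \<otimes> \<omega> m) s" using ab act_top[OF s] by (simp add: above_def)
  then have "act (\<omega> m) s \<noteq> None"
    using act_mult[OF idemD(1)[OF top_idem[OF s]] w s] by (cases "act (\<omega> m) s") auto
  then have "act (m\<^sup>\<dagger> \<otimes> m) s \<noteq> None" using dagger_facts(3)[OF m] by simp
  then obtain t where "act m s = Some t" 
    using act_mult[OF dagger_closed[OF m] m s] by (cases "act m s") auto
  then show thesis using that top_support[OF m s] act_closed[OF m s] ab by (simp add: above_def)
qed

text \<open>With \<open>t = top s\<close>, \<open>\<beta> = base t\<close>, \<open>G\<close> the maximal subgroup at \<open>\<beta>\<close> and \<open>z = 1 - annih \<beta>\<close>, this is the
  mean over \<open>k \<in> G\<close> of \<open>t k\<^sup>\<dagger> z \<mu> (k (s \<otimes> v))\<close>, on the layer of rank \<open>n\<close>. The element \<open>k\<close> moves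
  \<open>s\<close> to an element with top \<open>\<beta>\<close> and \<open>t k\<^sup>\<dagger>\<close> moves it back, so only the values of \<open>\<mu>\<close> over the
  chosen \<open>\<beta>\<close> enter; \<open>z\<close> makes all that is not above \<open>\<beta>\<close> act as zero on the result.\<close>

definition spread ::
  "('m \<Rightarrow> 'k, 'a) module \<Rightarrow> (('s \<Rightarrow> 'v) \<Rightarrow> 'a) \<Rightarrow> nat \<Rightarrow> 's \<Rightarrow> 'v \<Rightarrow> 'a"
where
  "spread A \<mu> n s v = (if rank (top s) = n then
     avg (base (top s)) \<odot>\<^bsub>A\<^esub> (\<Oplus>\<^bsub>A\<^esub>k\<in>G (base (top s)).
       (basis K (top s \<otimes> k\<^sup>\<dagger>) \<otimes>\<^bsub>R\<^esub> (\<one>\<^bsub>R\<^esub> \<ominus>\<^bsub>R\<^esub> annih (base (top s)))) \<odot>\<^bsub>A\<^esub>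
         \<mu> (basis K k \<odot>\<^bsub>P\<^esub> single V s v))
     else \<zero>\<^bsub>A\<^esub>)"

lemma G_iff: "\<beta> \<in> B \<Longrightarrow> k \<in> G \<beta> \<longleftrightarrow> k \<in> carrier M \<and> \<omega> k = \<beta>"
  by (rule max_subgroup_iff)

lemma spread_coeff_closed:
  "\<lbrakk>s \<in> S; k \<in> carrier M\<rbrakk> \<Longrightarrow>
    basis K (top s \<otimes> k\<^sup>\<dagger>) \<otimes>\<^bsub>R\<^esub> (\<one>\<^bsub>R\<^esub> \<ominus>\<^bsub>R\<^esub> annih (base (top s))) \<in> carrier R"
  using annih(1)[of "base (top s)"] base[OF top_idem[of s]] idemD(1)[OF top_idem[of s]]
  by (intro R.m_closed KN.P.minus_closed basis_in) auto

lemma base_top: "s \<in> S \<Longrightarrow> base (top s) \<in> B"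
  using base top_idem by blast

lemma spread_additive:
  assumes A: "left_module R A" and \<mu>: "additive_map P A \<mu>" and s: "s \<in> S"
  shows "additive_map V A (spread A \<mu> n s)"
proof -
  interpret A: algebra_module K M A
    by (intro algebra_module.intro A finite_monoid_algebra_axioms)
  note \<beta> = base_top[OF s]
  show ?thesis
  proof (cases "rank (top s) = n")
    case True
    have "additive_map V A (\<lambda>v. avg (base (top s)) \<odot>\<^bsub>A\<^esub> (\<Oplus>\<^bsub>A\<^esub>k\<in>G (base (top s)).
       (basis K (top s \<otimes> k\<^sup>\<dagger>) \<otimes>\<^bsub>R\<^esub> (\<one>\<^bsub>R\<^esub> \<ominus>\<^bsub>R\<^esub> annih (base (top s)))) \<odot>\<^bsub>A\<^esub>
         \<mu> (basis K k \<odot>\<^bsub>P\<^esub> single V s v)))"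
    proof (rule additive_comp[OF additive_finsum_maps A.additive_smult[OF avg_closed[OF \<beta>]]])
      fix k assume "k \<in> G (base (top s))"
      then have k: "k \<in> carrier M" using G_iff[OF \<beta>] by blast
      show "additive_map V A (\<lambda>v.
       (basis K (top s \<otimes> k\<^sup>\<dagger>) \<otimes>\<^bsub>R\<^esub> (\<one>\<^bsub>R\<^esub> \<ominus>\<^bsub>R\<^esub> annih (base (top s)))) \<odot>\<^bsub>A\<^esub>
         \<mu> (basis K k \<odot>\<^bsub>P\<^esub> single V s v))"
        by (rule additive_comp[OF additive_comp[OF additive_comp[OF additive_single[OF s]
            PM.additive_smult[OF basis_in[OF k]]] \<mu>] A.additive_smult[OF spread_coeff_closed[OF s k]]])
    qed (rule V.A.M.abelian_group_axioms A.A.M.abelian_group_axioms)+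
    then show ?thesis using True by (simp add: spread_def[abs_def])
  next
    case False
    then show ?thesis
      using additive_map_zero[OF V.A.M.abelian_group_axioms A.A.M.abelian_group_axioms]
      by (simp add: spread_def[abs_def])
  qed
qed

lemma smult_scalar:
  assumes "left_module R A" "\<alpha> \<in> carrier R" "k \<in> carrier K" "a \<in> carrier A"
  shows "\<alpha> \<odot>\<^bsub>A\<^esub> (single K \<one> k \<odot>\<^bsub>A\<^esub> a) = single K \<one> k \<odot>\<^bsub>A\<^esub> (\<alpha> \<odot>\<^bsub>A\<^esub> a)"
proof -
  interpret A: left_module R A by fact
  have k: "single K \<one> k \<in> carrier R" using assms by (simp add: KN.single_in)
  show ?thesis
    using scalar_central[OF assms(3,2)] A.smult_assoc1[OF assms(2) k assms(4)]
      A.smult_assoc1[OF k assms(2,4)] by simp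
qed

lemma spread_scalar:
  assumes A: "left_module R A" and \<mu>: "additive_map P A \<mu>"
    and \<mu>s: "\<And>k p. \<lbrakk>k \<in> carrier K; p \<in> carrier P\<rbrakk> \<Longrightarrow>
      \<mu> (single K \<one> k \<odot>\<^bsub>P\<^esub> p) = single K \<one> k \<odot>\<^bsub>A\<^esub> \<mu> p"
    and s: "s \<in> S" and j: "j \<in> carrier K" and v: "v \<in> carrier V"
  shows "spread A \<mu> n s (V.sc j v) = single K \<one> j \<odot>\<^bsub>A\<^esub> spread A \<mu> n s v"
proof -
  interpret A: algebra_module K M A
    by (intro algebra_module.intro A finite_monoid_algebra_axioms)
  interpret \<mu>: additive_map P A \<mu> by fact
  note \<beta> = base_top[OF s]
  have jR: "single K \<one> j \<in> carrier R" using j by (simp add: KN.single_in)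
  interpret j: additive_map A A "\<lambda>a. single K \<one> j \<odot>\<^bsub>A\<^esub> a" by (rule A.additive_smult[OF jR])
  let ?c = "\<lambda>k. basis K (top s \<otimes> k\<^sup>\<dagger>) \<otimes>\<^bsub>R\<^esub> (\<one>\<^bsub>R\<^esub> \<ominus>\<^bsub>R\<^esub> annih (base (top s)))"
  note sv = single_in[OF s v]
  have kM: "k \<in> carrier M" if "k \<in> G (base (top s))" for k using that G_iff[OF \<beta>] by blast
  have sj: "single V s (V.sc j v) = single K \<one> j \<odot>\<^bsub>P\<^esub> single V s v"
    using smult_single[OF _ j s v, of "\<one>"] by (simp add: act_one[OF s])
  have summand: "?c k \<odot>\<^bsub>A\<^esub> \<mu> (basis K k \<odot>\<^bsub>P\<^esub> single V s (V.sc j v)) =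
      single K \<one> j \<odot>\<^bsub>A\<^esub> (?c k \<odot>\<^bsub>A\<^esub> \<mu> (basis K k \<odot>\<^bsub>P\<^esub> single V s v))"
    if "k \<in> G (base (top s))" for k
    unfolding sj using smult_scalar[OF left_module_P basis_in[OF kM[OF that]] j sv]
      smult_scalar[OF A spread_coeff_closed[OF s kM[OF that]] j] \<mu>s[OF j] \<mu>.closed sv kM[OF that] by simp
  have cl: "?c k \<odot>\<^bsub>A\<^esub> \<mu> (basis K k \<odot>\<^bsub>P\<^esub> single V s v) \<in> carrier A" if "k \<in> G (base (top s))" for k
    using spread_coeff_closed[OF s kM[OF that]] \<mu>.closed sv kM[OF that] by simp
  have "(\<Oplus>\<^bsub>A\<^esub>k\<in>G (base (top s)). ?c k \<odot>\<^bsub>A\<^esub> \<mu> (basis K k \<odot>\<^bsub>P\<^esub> single V s (V.sc j v))) =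
      single K \<one> j \<odot>\<^bsub>A\<^esub> (\<Oplus>\<^bsub>A\<^esub>k\<in>G (base (top s)). ?c k \<odot>\<^bsub>A\<^esub> \<mu> (basis K k \<odot>\<^bsub>P\<^esub> single V s v))"
    using cl jR by (subst j.finsum) (auto simp: summand intro!: A.A.M.finsum_cong')
  moreover have "(\<Oplus>\<^bsub>A\<^esub>k\<in>G (base (top s)). ?c k \<odot>\<^bsub>A\<^esub> \<mu> (basis K k \<odot>\<^bsub>P\<^esub> single V s v)) \<in> carrier A"
    using cl by (intro A.A.M.finsum_closed) auto
  ultimately show ?thesis
    using smult_scalar[OF A avg_closed[OF \<beta>] j] j.zero by (simp add: spread_def)
qed

text \<open>For \<open>k \<in> G\<close> we have \<open>km = k (\<beta>m)\<close>, and \<open>\<beta>m\<close> lies in \<open>G\<close>.\<close>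

lemma max_subgroup_translate:
  assumes \<beta>: "\<beta> \<in> B" and m: "m \<in> carrier M" and ab: "above \<beta> m"
  shows "bij_betw (\<lambda>k. k \<otimes> m) (G \<beta>) (G \<beta>)"
proof -
  interpret G: group "max_subgroup M \<beta>" by (rule group_max_subgroup[OF \<beta>])
  note \<beta>M = idemD[OF \<beta>]
  have \<gamma>: "\<beta> \<otimes> m \<in> G \<beta>" using above_subgroup[OF \<beta> m ab] G_iff[OF \<beta>] \<beta>M m by simp
  have "k \<otimes> m = k \<otimes> (\<beta> \<otimes> m)" if "k \<in> G \<beta>" for k
    using that \<beta>M m in_max_subgroup[OF \<beta>, of k] by (simp add: m_assoc[symmetric])
  moreover have "bij_betw (\<lambda>k. k \<otimes> (\<beta> \<otimes> m)) (G \<beta>) (G \<beta>)"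
  proof (rule bij_betw_byWitness[where f' = "\<lambda>k. k \<otimes>\<^bsub>max_subgroup M \<beta>\<^esub> inv\<^bsub>max_subgroup M \<beta>\<^esub> (\<beta> \<otimes> m)"])
    let ?g = "\<beta> \<otimes> m"
    show "\<forall>k\<in>G \<beta>. k \<otimes> ?g \<otimes>\<^bsub>max_subgroup M \<beta>\<^esub> inv\<^bsub>max_subgroup M \<beta>\<^esub> ?g = k"
      using G.m_assoc[OF _ \<gamma> G.inv_closed[OF \<gamma>]] G.r_inv[OF \<gamma>] G.r_one by simp
    show "\<forall>k\<in>G \<beta>. k \<otimes>\<^bsub>max_subgroup M \<beta>\<^esub> inv\<^bsub>max_subgroup M \<beta>\<^esub> ?g \<otimes> ?g = k"
      using G.m_assoc[OF _ G.inv_closed[OF \<gamma>] \<gamma>] G.l_inv[OF \<gamma>] G.r_one by simp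
    show "(\<lambda>k. k \<otimes> ?g) ` G \<beta> \<subseteq> G \<beta>" using G.m_closed[OF _ \<gamma>] by auto
    show "(\<lambda>k. k \<otimes>\<^bsub>max_subgroup M \<beta>\<^esub> inv\<^bsub>max_subgroup M \<beta>\<^esub> ?g) ` G \<beta> \<subseteq> G \<beta>"
      using G.m_closed[OF _ G.inv_closed[OF \<gamma>]] by blast
  qed
  ultimately show ?thesis by (subst bij_betw_cong) auto
qed

text \<open>The substitution \<open>k \<mapsto> km\<close> turns the coefficients of \<open>spread\<close> at an element with top \<open>t\<close>,
  multiplied by \<open>m\<close>, into those at its image, which has top \<open>\<omega> (mt)\<close>: both sides agree after
  writing \<open>\<omega> (mt) \<beta> m = mt\<close>.\<close>

lemma translate_coefficient:
  assumes t: "t \<in> B" and \<beta>: "\<beta> \<in> B" "\<beta> \<otimes> t = \<beta>" "t \<otimes> \<beta> = t"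
    and m: "m \<in> carrier M" and ab: "above t m" and k: "k \<in> G \<beta>"
  shows "m \<otimes> (t \<otimes> (k \<otimes> m)\<^sup>\<dagger>) = \<omega> (m \<otimes> t) \<otimes> k\<^sup>\<dagger>"
proof -
  note \<beta>M = idemD[OF \<beta>(1)] and tM = idemD[OF t] and d = dagger_facts[OF m]
  have kM: "k \<in> carrier M" "\<omega> k = \<beta>" using k G_iff[OF \<beta>(1)] by auto
  have ab\<beta>: "above \<beta> m" by (rule above_trans[OF \<beta>(1) t m \<beta>(2) ab])
  have km: "k \<otimes> m \<in> G \<beta>"
    using max_subgroup_translate[OF \<beta>(1) m ab\<beta>] k by (auto simp: bij_betw_def)
  define j where "j = (k \<otimes> m)\<^sup>\<dagger>"
  have kmM: "k \<otimes> m \<in> carrier M" "\<omega> (k \<otimes> m) = \<beta>" using km G_iff[OF \<beta>(1)] by auto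
  have j: "j \<in> carrier M" "k \<otimes> m \<otimes> j = \<beta>" "\<beta> \<otimes> j = j"
    using dagger_facts[OF kmM(1)] kmM(2) by (simp_all add: j_def)
  have kd: "k\<^sup>\<dagger> \<in> carrier M" "k\<^sup>\<dagger> \<otimes> k = \<beta>" "k\<^sup>\<dagger> \<otimes> \<beta> = k\<^sup>\<dagger>"
    using dagger_facts[OF kM(1)] kM(2) by simp_all
  have \<gamma>j: "\<beta> \<otimes> m \<otimes> j = k\<^sup>\<dagger>"
  proof -
    have "\<beta> \<otimes> m \<otimes> j = k\<^sup>\<dagger> \<otimes> k \<otimes> m \<otimes> j" using kd(2) by simp
    also have "\<dots> = k\<^sup>\<dagger> \<otimes> (k \<otimes> m \<otimes> j)" using kd(1) kM(1) m j(1) by (simp add: m_assoc)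
    finally show ?thesis using j(2) kd(3) by simp
  qed
  have "\<omega> (m \<otimes> t) \<otimes> (\<beta> \<otimes> m) = m \<otimes> ((t \<otimes> \<beta>) \<otimes> (m\<^sup>\<dagger> \<otimes> (\<beta> \<otimes> m)))"
    unfolding \<beta>(3) omega_mult_idem[OF m t] using m tM(1) \<beta>M(1) d(1) by (simp add: m_assoc)
  also have "\<dots> = m \<otimes> (t \<otimes> (\<beta> \<otimes> (m\<^sup>\<dagger> \<otimes> m)))"
    using m tM(1) \<beta>M(1) d(1) absorb''[OF \<beta>(1) d(1) m] by (simp add: m_assoc)
  also have "\<dots> = m \<otimes> ((t \<otimes> \<beta>) \<otimes> \<omega> m)"
    unfolding d(3) using m tM(1) \<beta>M(1) by (simp add: m_assoc)
  also have "\<dots> = m \<otimes> t" using ab \<beta>(3) by (simp add: above_def)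
  finally have t\<gamma>: "\<omega> (m \<otimes> t) \<otimes> (\<beta> \<otimes> m) = m \<otimes> t" .
  have w: "\<omega> (m \<otimes> t) \<in> carrier M" using m tM(1) by simp
  have "m \<otimes> (t \<otimes> j) = \<omega> (m \<otimes> t) \<otimes> (\<beta> \<otimes> m) \<otimes> j"
    unfolding t\<gamma> using m tM(1) j(1) by (simp add: m_assoc)
  also have "\<dots> = \<omega> (m \<otimes> t) \<otimes> (\<beta> \<otimes> m \<otimes> j)"
    using w m \<beta>M(1) j(1) by (simp add: m_assoc)
  finally show ?thesis unfolding \<gamma>j unfolding j_def .
qed

text \<open>If \<open>m\<close> is above \<open>top s\<close>, substitute \<open>km\<close> for \<open>k\<close> in the mean. Otherwise \<open>m t k\<^sup>\<dagger>\<close> is not above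
  \<open>\<beta>\<close> and is killed by \<open>z\<close>, while \<open>ms\<close> has rank below \<open>n\<close> or is undefined.\<close>

lemma spread_equivariant:
  assumes A: "left_module R A" and \<mu>: "additive_map P A \<mu>"
    and bound: "\<And>s. s \<in> S \<Longrightarrow> rank (top s) \<le> n"
    and m: "m \<in> carrier M" and s: "s \<in> S" and v: "v \<in> carrier V"
  shows "basis K m \<odot>\<^bsub>A\<^esub> spread A \<mu> n s v =
    (case act m s of None \<Rightarrow> \<zero>\<^bsub>A\<^esub> | Some t \<Rightarrow> spread A \<mu> n t (basis K m \<odot>\<^bsub>V\<^esub> v))"
proof -
  interpret A: algebra_module K M A
    by (intro algebra_module.intro A finite_monoid_algebra_axioms)
  interpret \<mu>: additive_map P A \<mu> by fact
  interpret m: additive_map A A "\<lambda>a. basis K m \<odot>\<^bsub>A\<^esub> a" by (rule A.additive_smult[OF basis_in[OF m]])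
  define t where "t = top s"
  define \<beta> where "\<beta> = base t"
  have t: "t \<in> B" using top_idem[OF s] by (simp add: t_def)
  have \<beta>: "\<beta> \<in> B" "\<beta> \<otimes> t = \<beta>" "t \<otimes> \<beta> = t" using base[OF t] by (auto simp: \<beta>_def)
  note tM = idemD[OF t]
  let ?z = "\<one>\<^bsub>R\<^esub> \<ominus>\<^bsub>R\<^esub> annih \<beta>"
  have z: "?z \<in> carrier R" using annih(1)[OF \<beta>(1)] by simp
  have kM: "k \<in> carrier M" if "k \<in> G \<beta>" for k using that G_iff[OF \<beta>(1)] by blast
  note sv = single_in[OF s v]
  let ?F = "\<lambda>k. (basis K (t \<otimes> k\<^sup>\<dagger>) \<otimes>\<^bsub>R\<^esub> ?z) \<odot>\<^bsub>A\<^esub> \<mu> (basis K k \<odot>\<^bsub>P\<^esub> single V s v)"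
  let ?F' = "\<lambda>k. (basis K (m \<otimes> (t \<otimes> k\<^sup>\<dagger>)) \<otimes>\<^bsub>R\<^esub> ?z) \<odot>\<^bsub>A\<^esub> \<mu> (basis K k \<odot>\<^bsub>P\<^esub> single V s v)"
  have cl: "basis K (x \<otimes> k\<^sup>\<dagger>) \<otimes>\<^bsub>R\<^esub> ?z \<in> carrier R" if "x \<in> carrier M" "k \<in> carrier M" for x k
    using z that by (intro R.m_closed basis_in) auto
  have \<mu>cl: "\<mu> (basis K k \<odot>\<^bsub>P\<^esub> p) \<in> carrier A" if "k \<in> carrier M" "p \<in> carrier P" for k p
    using that \<mu>.closed by simp
  have Fcl: "?F k \<in> carrier A" if "k \<in> G \<beta>" for k
    using cl[OF tM(1) kM[OF that]] \<mu>cl[OF kM[OF that] sv] by simp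
  have mF: "basis K m \<odot>\<^bsub>A\<^esub> ?F k = ?F' k" if "k \<in> G \<beta>" for k
  proof -
    have "basis K m \<otimes>\<^bsub>R\<^esub> (basis K (t \<otimes> k\<^sup>\<dagger>) \<otimes>\<^bsub>R\<^esub> ?z) = basis K (m \<otimes> (t \<otimes> k\<^sup>\<dagger>)) \<otimes>\<^bsub>R\<^esub> ?z"
      using m tM(1) kM[OF that] z R.m_assoc[of "basis K m" "basis K (t \<otimes> k\<^sup>\<dagger>)" ?z]
      by (simp add: basis_in mult_single)
    then show ?thesis
      using A.A.smult_assoc1[OF basis_in[OF m] cl[OF tM(1) kM[OF that]] \<mu>cl[OF kM[OF that] sv]] by simp
  qed
  show ?thesis
  proof (cases "rank t = n")
    case False
    then have lt: "rank t < n" using bound[OF s] by (simp add: t_def)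
    have "spread A \<mu> n s v = \<zero>\<^bsub>A\<^esub>" using False by (simp add: spread_def t_def)
    moreover have "spread A \<mu> n s' w = \<zero>\<^bsub>A\<^esub>" if "act m s = Some s'" for s' w
      using rank_act[OF m s that] lt by (simp add: spread_def t_def)
    ultimately show ?thesis using m.zero by (auto split: option.splits)
  next
    case True
    have "basis K m \<odot>\<^bsub>A\<^esub> spread A \<mu> n s v = avg \<beta> \<odot>\<^bsub>A\<^esub> (basis K m \<odot>\<^bsub>A\<^esub> (\<Oplus>\<^bsub>A\<^esub>k\<in>G \<beta>. ?F k))"
      using True Fcl smult_scalar[OF A basis_in[OF m] avg_scalar(1)[OF \<beta>(1)]]
      by (simp add: spread_def t_def \<beta>_def avg_def A.A.M.finsum_closed Pi_def)
    also have "\<dots> = avg \<beta> \<odot>\<^bsub>A\<^esub> (\<Oplus>\<^bsub>A\<^esub>k\<in>G \<beta>. ?F' k)"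
    proof -
      have "basis K m \<odot>\<^bsub>A\<^esub> (\<Oplus>\<^bsub>A\<^esub>k\<in>G \<beta>. ?F k) = (\<Oplus>\<^bsub>A\<^esub>k\<in>G \<beta>. basis K m \<odot>\<^bsub>A\<^esub> ?F k)"
        by (rule m.finsum[OF Fcl])
      also have "\<dots> = (\<Oplus>\<^bsub>A\<^esub>k\<in>G \<beta>. ?F' k)"
        using Fcl m.closed mF by (intro A.A.M.finsum_cong') (auto simp flip: mF)
      finally show ?thesis by simp
    qed
    finally have lhs: "basis K m \<odot>\<^bsub>A\<^esub> spread A \<mu> n s v = avg \<beta> \<odot>\<^bsub>A\<^esub> (\<Oplus>\<^bsub>A\<^esub>k\<in>G \<beta>. ?F' k)" .
    have F'cl: "?F' k \<in> carrier A" if "k \<in> G \<beta>" for k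
      unfolding mF[OF that, symmetric] by (rule m.closed[OF Fcl[OF that]])
    show ?thesis
    proof (cases "above t m")
      case False
      have "?F' k = \<zero>\<^bsub>A\<^esub>" if k: "k \<in> G \<beta>" for k
      proof -
        have tk: "t \<otimes> k\<^sup>\<dagger> \<in> carrier M" using kM[OF k] tM by simp
        have "\<not> above \<beta> m" using False above_trans[OF t \<beta>(1) m \<beta>(3)] by blast
        then have "\<not> above \<beta> (m \<otimes> (t \<otimes> k\<^sup>\<dagger>))" using above_mult[OF \<beta>(1) m tk] by blast
        then have "basis K (m \<otimes> (t \<otimes> k\<^sup>\<dagger>)) \<otimes>\<^bsub>R\<^esub> ?z = \<zero>\<^bsub>R\<^esub>"
          using annih(3)[OF \<beta>(1)] m tk by simp
        then show ?thesis
          using additive_map.zero[OF A.additive_algebra[OF \<mu>cl[OF kM[OF k] sv]]] by simp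
      qed
      then have "(\<Oplus>\<^bsub>A\<^esub>k\<in>G \<beta>. ?F' k) = \<zero>\<^bsub>A\<^esub>" by (rule A.A.M.add.finprod_one_eqI)
      then have "basis K m \<odot>\<^bsub>A\<^esub> spread A \<mu> n s v = \<zero>\<^bsub>A\<^esub>"
        using lhs additive_map.zero[OF A.additive_smult[OF avg_closed[OF \<beta>(1)]]] by simp
      moreover have "spread A \<mu> n s' w = \<zero>\<^bsub>A\<^esub>" if "act m s = Some s'" for s' w
        using rank_act_less[OF m s that] False True by (simp add: spread_def t_def)
      ultimately show ?thesis by (auto split: option.splits)
    next
      case ab: True
      then obtain s' where s': "act m s = Some s'" "s' \<in> S" and
        sup: "top s' \<otimes> t = top s'" "t \<otimes> top s' = t"
        using act_above[OF m s] unfolding t_def by blast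
      have t': "top s' \<in> B" "top s' = \<omega> (m \<otimes> t)"
        using top_idem[OF s'(2)] top_act[OF m s s'(1)] by (auto simp: t_def)
      have \<beta>': "base (top s') = \<beta>" using base_cong[OF t'(1) t sup] by (simp add: \<beta>_def)
      have "rank t \<le> rank (top s')" by (rule rank_mono[OF t t'(1) sup(2)])
      then have r': "rank (top s') = n" using rank_act[OF m s s'(1)] True by (simp add: t_def)
      have ab\<beta>: "above \<beta> m" by (rule above_trans[OF \<beta>(1) t m \<beta>(2) ab])
      note bij = max_subgroup_translate[OF \<beta>(1) m ab\<beta>]
      have mv: "basis K m \<odot>\<^bsub>V\<^esub> v \<in> carrier V" using m v by simp
      have msv: "single V s' (basis K m \<odot>\<^bsub>V\<^esub> v) = basis K m \<odot>\<^bsub>P\<^esub> single V s v"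
        using smult_single[OF m _ s v, of "\<one>\<^bsub>K\<^esub>"] s'(1) by simp
      have eq: "?F' (k \<otimes> m) = (basis K (top s' \<otimes> k\<^sup>\<dagger>) \<otimes>\<^bsub>R\<^esub> ?z) \<odot>\<^bsub>A\<^esub>
          \<mu> (basis K k \<odot>\<^bsub>P\<^esub> single V s' (basis K m \<odot>\<^bsub>V\<^esub> v))" if k: "k \<in> G \<beta>" for k
        unfolding translate_coefficient[OF t \<beta> m ab k] t'(2)[symmetric] msv
        using PM.op_mult[OF kM[OF k] m sv] by simp
      have km: "k \<otimes> m \<in> G \<beta>" if "k \<in> G \<beta>" for k using bij that by (auto simp: bij_betw_def)
      have "(\<Oplus>\<^bsub>A\<^esub>k\<in>G \<beta>. ?F' k) = (\<Oplus>\<^bsub>A\<^esub>k\<in>(\<lambda>k. k \<otimes> m) ` G \<beta>. ?F' k)"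
        using bij by (simp add: bij_betw_def)
      also have "\<dots> = (\<Oplus>\<^bsub>A\<^esub>k\<in>G \<beta>. ?F' (k \<otimes> m))"
        using bij F'cl km by (intro A.A.M.finsum_reindex) (auto simp: bij_betw_def)
      also have "\<dots> = (\<Oplus>\<^bsub>A\<^esub>k\<in>G \<beta>. (basis K (top s' \<otimes> k\<^sup>\<dagger>) \<otimes>\<^bsub>R\<^esub> ?z) \<odot>\<^bsub>A\<^esub>
          \<mu> (basis K k \<odot>\<^bsub>P\<^esub> single V s' (basis K m \<odot>\<^bsub>V\<^esub> v)))"
        using eq F'cl km by (intro A.A.M.finsum_cong') (auto simp flip: eq)
      finally show ?thesis using lhs s' r' \<beta>' by (simp add: spread_def)
    qed
  qed
qed

lemma spread_natural:
  assumes A: "left_module R A" and B: "left_module R A'" and \<mu>: "additive_map P A \<mu>"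
    and f: "f \<in> lmod_hom R A A'" and s: "s \<in> S" and v: "v \<in> carrier V"
    and eq: "\<And>p. p \<in> carrier P \<Longrightarrow> f (\<mu> p) = \<mu>' p"
  shows "f (spread A \<mu> n s v) = spread A' \<mu>' n s v"
proof -
  interpret A: algebra_module K M A
    by (intro algebra_module.intro A finite_monoid_algebra_axioms)
  interpret A': algebra_module K M A'
    by (intro algebra_module.intro B finite_monoid_algebra_axioms)
  interpret \<mu>: additive_map P A \<mu> by fact
  interpret f: additive_map A A' f
    by (rule additive_mapD_lmod_hom[OF A.A.M.abelian_group_axioms A'.A.M.abelian_group_axioms f])
  have fs: "f (r \<odot>\<^bsub>A\<^esub> a) = r \<odot>\<^bsub>A'\<^esub> f a" if "r \<in> carrier R" "a \<in> carrier A" for r a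
    using f that by (auto simp: lmod_hom_def)
  note \<beta> = base_top[OF s] and sv = single_in[OF s v]
  let ?c = "\<lambda>k. basis K (top s \<otimes> k\<^sup>\<dagger>) \<otimes>\<^bsub>R\<^esub> (\<one>\<^bsub>R\<^esub> \<ominus>\<^bsub>R\<^esub> annih (base (top s)))"
  let ?F = "\<lambda>k. ?c k \<odot>\<^bsub>A\<^esub> \<mu> (basis K k \<odot>\<^bsub>P\<^esub> single V s v)"
  have kM: "k \<in> carrier M" if "k \<in> G (base (top s))" for k using that G_iff[OF \<beta>] by blast
  have p: "basis K k \<odot>\<^bsub>P\<^esub> single V s v \<in> carrier P" if "k \<in> G (base (top s))" for k
    using kM[OF that] sv by simp
  have Fcl: "?F k \<in> carrier A" if "k \<in> G (base (top s))" for k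
    using spread_coeff_closed[OF s kM[OF that]] \<mu>.closed[OF p[OF that]] by simp
  have fF: "f (?F k) = ?c k \<odot>\<^bsub>A'\<^esub> \<mu>' (basis K k \<odot>\<^bsub>P\<^esub> single V s v)" if "k \<in> G (base (top s))" for k
    using fs[OF spread_coeff_closed[OF s kM[OF that]] \<mu>.closed[OF p[OF that]]] eq[OF p[OF that]] by simp
  have "f (\<Oplus>\<^bsub>A\<^esub>k\<in>G (base (top s)). ?F k) = (\<Oplus>\<^bsub>A'\<^esub>k\<in>G (base (top s)). f (?F k))"
    by (rule f.finsum[OF Fcl])
  also have "\<dots> = (\<Oplus>\<^bsub>A'\<^esub>k\<in>G (base (top s)). ?c k \<odot>\<^bsub>A'\<^esub> \<mu>' (basis K k \<odot>\<^bsub>P\<^esub> single V s v))"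
  proof (rule A'.A.M.finsum_cong')
    show "(\<lambda>k. ?c k \<odot>\<^bsub>A'\<^esub> \<mu>' (basis K k \<odot>\<^bsub>P\<^esub> single V s v)) \<in> G (base (top s)) \<rightarrow> carrier A'"
      using f.closed[OF Fcl] unfolding Pi_def by (simp only: fF mem_Collect_eq) blast
  qed (simp_all only: fF)
  finally show ?thesis
    using fs[OF avg_closed[OF \<beta>] A.A.M.finsum_closed[of ?F "G (base (top s))"]] Fcl f.zero
    by (simp add: spread_def Pi_def)
qed

lemma restrict_carrier:
  assumes "S' \<subseteq> S"
  shows "f \<in> fun_carrier S' V \<longleftrightarrow> f \<in> carrier P \<and> (\<forall>s. s \<notin> S' \<longrightarrow> f s = \<zero>\<^bsub>V\<^esub>)"
  using assms by (auto simp: carrier_P fun_carrier_def)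

lemma restrict_action:
  assumes sub: "S' \<subseteq> S" and inv: "\<And>m s t. \<lbrakk>m \<in> carrier M; s \<in> S'; act m s = Some t\<rbrakk> \<Longrightarrow> t \<in> S'"
  shows "topped_action K M V S' (P\<lparr>carrier := fun_carrier S' V\<rparr>) act top I b"
proof (intro topped_action.intro topped_action_axioms.intro partial_action.intro
    partial_action_axioms.intro function_group.intro function_group_axioms.intro
    left_duo_algebra_axioms finite_monoid_algebra_axioms V.algebra_module_axioms
    V.A.M.abelian_group_axioms)
  show "finite S'" using sub finite_S finite_subset by blast
  fix \<alpha> f t assume \<alpha>: "\<alpha> \<in> carrier R" and f: "f \<in> carrier (P\<lparr>carrier := fun_carrier S' V\<rparr>)"
  then have out: "f s = \<zero>\<^bsub>V\<^esub>" if "s \<notin> S'" for s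
    using that restrict_carrier[OF sub] by auto
  have fP: "f \<in> carrier P" using f restrict_carrier[OF sub] by auto
  note cl = single_V[OF _ KN.val_closed[OF \<alpha>] val_closed[OF fP]]
  have zero: "single K m (\<alpha> m) \<odot>\<^bsub>V\<^esub> \<zero>\<^bsub>V\<^esub> = \<zero>\<^bsub>V\<^esub>" if "m \<in> carrier M" for m
    using additive_map.zero[OF V.additive_smult] KN.single_in[OF that KN.val_closed[OF \<alpha>]] by blast
  have "(\<alpha> \<odot>\<^bsub>P\<^esub> f) t = (\<Oplus>\<^bsub>V\<^esub>m\<in>carrier M. \<Oplus>\<^bsub>V\<^esub>s\<in>S'.
        if act m s = Some t then single K m (\<alpha> m) \<odot>\<^bsub>V\<^esub> f s else \<zero>\<^bsub>V\<^esub>)"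
    unfolding smult_P[OF \<alpha> fP]
  proof (rule V.A.M.finsum_cong')
    fix m assume m: "m \<in> carrier M"
    show "(\<Oplus>\<^bsub>V\<^esub>s\<in>S. if act m s = Some t then single K m (\<alpha> m) \<odot>\<^bsub>V\<^esub> f s else \<zero>\<^bsub>V\<^esub>) =
        (\<Oplus>\<^bsub>V\<^esub>s\<in>S'. if act m s = Some t then single K m (\<alpha> m) \<odot>\<^bsub>V\<^esub> f s else \<zero>\<^bsub>V\<^esub>)"
      using finite_S sub cl[OF m] out zero[OF m]
      by (intro V.A.M.add.finprod_mono_neutral_cong_right) auto
  qed (use cl in \<open>auto intro!: V.A.M.finsum_closed\<close>)
  then show "(\<alpha> \<odot>\<^bsub>P\<lparr>carrier := fun_carrier S' V\<rparr>\<^esub> f) t = (\<Oplus>\<^bsub>V\<^esub>m\<in>carrier M. \<Oplus>\<^bsub>V\<^esub>s\<in>S'.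
        if act m s = Some t then single K m (\<alpha> m) \<odot>\<^bsub>V\<^esub> f s else \<zero>\<^bsub>V\<^esub>)" by simp
next
  fix m s t assume "m \<in> carrier M" "s \<in> S'" "act m s = Some t"
  then show "t \<in> S'" "top t = \<omega> (m \<otimes> top s)" using inv top_act sub by auto
next
  fix m n s assume "m \<in> carrier M" "n \<in> carrier M" "s \<in> S'"
  then show "act (m \<otimes> n) s = Option.bind (act n s) (act m)" using sub act_mult by auto
next
  show "field K" by (rule field_K)
  show "finite I" by (rule finite_I)
  show "\<And>i. i \<in> I \<Longrightarrow> b i \<in> carrier V" by (rule b_closed)
  show "\<And>v. v \<in> carrier V \<Longrightarrow>
      \<exists>x. (\<forall>i\<in>I. x i \<in> carrier K) \<and> v = (\<Oplus>\<^bsub>V\<^esub>i\<in>I. single K \<one> (x i) \<odot>\<^bsub>V\<^esub> b i)" by (rule b_span)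
  show "\<And>f. f \<in> B \<Longrightarrow> [order (max_subgroup M f)] \<cdot>\<^bsub>K\<^esub> \<one>\<^bsub>K\<^esub> \<noteq> \<zero>\<^bsub>K\<^esub>" by (rule order_invertible)
qed (use sub act_one top_idem act_top top_trivial add_P zero_P in auto)

text \<open>The action does not raise the rank, so the lower layers form a submodule of the same kind.\<close>

lemma restrict_rank:
  "topped_action K M V {s \<in> S. rank (top s) < n}
    (P\<lparr>carrier := fun_carrier {s \<in> S. rank (top s) < n} V\<rparr>) act top I b"
proof (rule restrict_action)
  fix m s t assume *: "m \<in> carrier M" "s \<in> {s \<in> S. rank (top s) < n}" "act m s = Some t"
  then show "t \<in> {s \<in> S. rank (top s) < n}"
    using act_closed[of m s t] rank_act[of m s t] by simp
qed auto

text \<open>Replacing \<open>z\<close> by \<open>1\<close> in the mean gives \<open>t k\<^sup>\<dagger> k (s \<otimes> v) = t (s \<otimes> v) = s \<otimes> v\<close> for all \<open>k\<close>, and the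
  difference \<open>z - 1\<close> is a combination of elements that lower the rank.\<close>

lemma spread_complement:
  assumes bound: "\<And>s. s \<in> S \<Longrightarrow> rank (top s) \<le> n" and S': "S' = {s \<in> S. rank (top s) < n}"
    and s: "s \<in> S" and v: "v \<in> carrier V"
  shows "single V s v \<ominus>\<^bsub>P\<^esub> spread P (\<lambda>p. p) n s v \<in> fun_carrier S' V"
proof -
  have sub: "S' \<subseteq> S" by (auto simp: S')
  interpret Q: topped_action K M V S' "P\<lparr>carrier := fun_carrier S' V\<rparr>" act top I b
    unfolding S' by (rule restrict_rank)
  let ?D = "fun_carrier S' V"
  note D = restrict_carrier[OF sub]
  have Dsm: "\<alpha> \<odot>\<^bsub>P\<^esub> f \<in> ?D" if "\<alpha> \<in> carrier R" "f \<in> ?D" for \<alpha> f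
    using Q.smult_closed_P[of \<alpha> f] that by simp
  have Dsum: "(\<Oplus>\<^bsub>P\<^esub>i\<in>J. F i) \<in> ?D" if "\<And>i. i \<in> J \<Longrightarrow> F i \<in> ?D" for J :: "'m set" and F
  proof -
    have FP: "F i \<in> carrier P" if "i \<in> J" for i using D \<open>\<And>i. i \<in> J \<Longrightarrow> F i \<in> ?D\<close> that by blast
    have "(\<Oplus>\<^bsub>P\<^esub>i\<in>J. F i) t = \<zero>\<^bsub>V\<^esub>" if t: "t \<notin> S'" for t
    proof -
      have "(\<Oplus>\<^bsub>P\<^esub>i\<in>J. F i) t = (\<Oplus>\<^bsub>V\<^esub>i\<in>J. F i t)" by (rule finsum_val[OF FP])
      also have "\<dots> = \<zero>\<^bsub>V\<^esub>"
        using D t \<open>\<And>i. i \<in> J \<Longrightarrow> F i \<in> ?D\<close> by (intro V.A.M.add.finprod_one_eqI) blast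
      finally show ?thesis .
    qed
    then show ?thesis unfolding D using FP by (auto intro!: P.finsum_closed)
  qed
  have Dneg: "\<ominus>\<^bsub>P\<^esub> f \<in> ?D" if "f \<in> ?D" for f
    using that unfolding D by (simp add: minus_val)
  have D0: "\<zero>\<^bsub>P\<^esub> \<in> ?D" unfolding D using P.zero_closed by (simp add: zero_P)
  have Dsingle: "single V d w \<in> ?D" if "d \<in> S'" "w \<in> carrier V" for d w
    using Q.single_in[OF that] by simp
  define p where "p = single V s v"
  have p: "p \<in> carrier P" using single_in[OF s v] by (simp add: p_def)
  show ?thesis
  proof (cases "rank (top s) = n")
    case False
    then have "s \<in> S'" using bound[OF s] s by (simp add: S')
    then have "p \<in> fun_carrier S' V" unfolding p_def using Dsingle v by blast
    moreover have "p \<ominus>\<^bsub>P\<^esub> \<zero>\<^bsub>P\<^esub> = p"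
    proof -
      have "\<ominus>\<^bsub>P\<^esub> \<zero>\<^bsub>P\<^esub> = \<zero>\<^bsub>P\<^esub>" by (rule P.minus_equality) simp_all
      then show ?thesis unfolding P.minus_eq using p by (simp only: P.r_zero)
    qed
    moreover have "spread P (\<lambda>p. p) n s v = \<zero>\<^bsub>P\<^esub>" using False by (simp add: spread_def)
    ultimately show ?thesis unfolding p_def by simp
  next
    case True
    define t where "t = top s"
    define \<beta> where "\<beta> = base t"
    have t: "t \<in> B" using top_idem[OF s] by (simp add: t_def)
    have \<beta>: "\<beta> \<in> B" "\<beta> \<otimes> t = \<beta>" "t \<otimes> \<beta> = t" using base[OF t] by (auto simp: \<beta>_def)
    note tM = idemD(1)[OF t]
    note u = annih[OF \<beta>(1)]
    let ?u = "annih \<beta>"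
    \<comment> \<open>what is not above \<open>\<beta>\<close> lowers the rank\<close>
    have low: "?u \<odot>\<^bsub>P\<^esub> (basis K k \<odot>\<^bsub>P\<^esub> p) \<in> ?D" if k: "k \<in> G \<beta>" for k
    proof -
      have kM: "k \<in> carrier M" "\<omega> k = \<beta>" using k G_iff[OF \<beta>(1)] by auto
      have "above t k" using \<beta>(3) kM by (simp add: above_def)
      then obtain d where d: "act k s = Some d" "d \<in> S" "t \<otimes> top d = t"
        using act_above[OF kM(1) s] unfolding t_def by metis
      define w where "w = basis K k \<odot>\<^bsub>V\<^esub> v"
      have w: "w \<in> carrier V" using kM(1) v by (simp add: w_def)
      have q: "basis K k \<odot>\<^bsub>P\<^esub> p = single V d w"
        using smult_single[OF kM(1) _ s v, of "\<one>\<^bsub>K\<^esub>"] d(1) by (simp add: p_def w_def)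
      have rd: "rank (top d) \<le> n" using bound[OF d(2)] .
      have "single K m (?u m) \<odot>\<^bsub>P\<^esub> single V d w \<in> ?D" if m: "m \<in> carrier M" for m
      proof (cases "?u m = \<zero>\<^bsub>K\<^esub>")
        case True
        have "single K m \<zero>\<^bsub>K\<^esub> = \<zero>\<^bsub>R\<^esub>" by (auto simp: single_def KN.zero_P)
        then show ?thesis
          using True D0 additive_map.zero[OF PM.additive_algebra[OF single_in[OF d(2) w]]] by simp
      next
        case False
        have "\<not> above (top d) m"
        proof
          assume "above (top d) m"
          then have "above t m" by (rule above_trans[OF t top_idem[OF d(2)] m d(3)])
          then have "above \<beta> m" by (rule above_trans[OF \<beta>(1) t m \<beta>(2)])
          then show False using u(2) False by blast
        qed
        then have "e \<in> S'" if "act m d = Some e" for e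
          using rank_act_less[OF m d(2) that] act_closed[OF m d(2) that] rd by (simp add: S')
        then show ?thesis
          using smult_single[OF m KN.val_closed[OF u(1)] d(2) w] D0
            single_V[OF m KN.val_closed[OF u(1)] w] Dsingle by (auto split: option.splits)
      qed
      then show ?thesis
        unfolding q PM.smult_expand[OF u(1) single_in[OF d(2) w]] by (rule Dsum)
    qed
    define r where "r k = basis K (t \<otimes> k\<^sup>\<dagger>) \<odot>\<^bsub>P\<^esub> (?u \<odot>\<^bsub>P\<^esub> (basis K k \<odot>\<^bsub>P\<^esub> p))" for k
    have kM: "k \<in> carrier M" if "k \<in> G \<beta>" for k using that G_iff[OF \<beta>(1)] by blast
    have rD: "r k \<in> ?D" if k: "k \<in> G \<beta>" for k
      unfolding r_def using tM kM[OF k] by (intro Dsm low[OF k] basis_in) auto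
    have rP: "r k \<in> carrier P" if "k \<in> G \<beta>" for k using rD[OF that] D by blast
    have main: "(basis K (t \<otimes> k\<^sup>\<dagger>) \<otimes>\<^bsub>R\<^esub> (\<one>\<^bsub>R\<^esub> \<ominus>\<^bsub>R\<^esub> ?u)) \<odot>\<^bsub>P\<^esub> (basis K k \<odot>\<^bsub>P\<^esub> p) = p \<oplus>\<^bsub>P\<^esub> (\<ominus>\<^bsub>P\<^esub> r k)"
      if k: "k \<in> G \<beta>" for k
    proof -
      have k': "k \<in> carrier M" "\<omega> k = \<beta>" using k G_iff[OF \<beta>(1)] by auto
      let ?q = "basis K k \<odot>\<^bsub>P\<^esub> p"
      have qP: "?q \<in> carrier P" using k' p by simp
      have tk: "t \<otimes> k\<^sup>\<dagger> \<in> carrier M" using tM k' by simp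
      have "(\<one>\<^bsub>R\<^esub> \<ominus>\<^bsub>R\<^esub> ?u) \<odot>\<^bsub>P\<^esub> ?q = \<one>\<^bsub>R\<^esub> \<odot>\<^bsub>P\<^esub> ?q \<ominus>\<^bsub>P\<^esub> ?u \<odot>\<^bsub>P\<^esub> ?q"
        by (rule additive_map.diff[OF PM.additive_algebra[OF qP] R.one_closed u(1)])
      then have 1: "(\<one>\<^bsub>R\<^esub> \<ominus>\<^bsub>R\<^esub> ?u) \<odot>\<^bsub>P\<^esub> ?q = ?q \<ominus>\<^bsub>P\<^esub> ?u \<odot>\<^bsub>P\<^esub> ?q"
        using PM.A.smult_one[OF qP] by simp
      have "(t \<otimes> k\<^sup>\<dagger>) \<otimes> k = t"
        using tM k' dagger_facts(3)[OF k'(1)] \<beta>(3) by (simp add: m_assoc)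
      then have "basis K (t \<otimes> k\<^sup>\<dagger>) \<odot>\<^bsub>P\<^esub> ?q = basis K t \<odot>\<^bsub>P\<^esub> p"
        using PM.op_mult[OF tk k'(1) p] by simp
      also have "\<dots> = p"
        using smult_single[OF tM _ s v, of "\<one>\<^bsub>K\<^esub>"] act_top[OF s] top_trivial[OF s v]
        by (simp add: p_def t_def)
      finally have 2: "basis K (t \<otimes> k\<^sup>\<dagger>) \<odot>\<^bsub>P\<^esub> ?q = p" .
      have uq: "?u \<odot>\<^bsub>P\<^esub> ?q \<in> carrier P" using u(1) qP by simp
      have "(basis K (t \<otimes> k\<^sup>\<dagger>) \<otimes>\<^bsub>R\<^esub> (\<one>\<^bsub>R\<^esub> \<ominus>\<^bsub>R\<^esub> ?u)) \<odot>\<^bsub>P\<^esub> ?q =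
          basis K (t \<otimes> k\<^sup>\<dagger>) \<odot>\<^bsub>P\<^esub> (?q \<ominus>\<^bsub>P\<^esub> ?u \<odot>\<^bsub>P\<^esub> ?q)"
        unfolding 1[symmetric] using basis_in[OF tk] u(1) qP by (intro PM.A.smult_assoc1) auto
      also have "\<dots> = p \<ominus>\<^bsub>P\<^esub> r k"
        unfolding r_def using additive_map.diff[OF PM.additive_smult[OF basis_in[OF tk]] qP uq] 2 by simp
      finally show ?thesis by (simp add: P.minus_eq)
    qed
    define y where "y = (\<Oplus>\<^bsub>P\<^esub>k\<in>G \<beta>. \<ominus>\<^bsub>P\<^esub> r k)"
    have yD: "y \<in> ?D" unfolding y_def using rD Dneg by (intro Dsum) auto
    then have yP: "y \<in> carrier P" using D by blast
    note \<iota> = avg_closed[OF \<beta>(1)]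
    have sp: "(\<Oplus>\<^bsub>P\<^esub>k\<in>G \<beta>. p) \<in> carrier P" using p by (intro P.finsum_closed) auto
    have iy: "avg \<beta> \<odot>\<^bsub>P\<^esub> y \<in> ?D" by (rule Dsm[OF \<iota> yD])
    then have iyP: "avg \<beta> \<odot>\<^bsub>P\<^esub> y \<in> carrier P" using D by blast
    have "(\<Oplus>\<^bsub>P\<^esub>k\<in>G \<beta>. (basis K (t \<otimes> k\<^sup>\<dagger>) \<otimes>\<^bsub>R\<^esub> (\<one>\<^bsub>R\<^esub> \<ominus>\<^bsub>R\<^esub> ?u)) \<odot>\<^bsub>P\<^esub> (basis K k \<odot>\<^bsub>P\<^esub> p)) =
        (\<Oplus>\<^bsub>P\<^esub>k\<in>G \<beta>. p \<oplus>\<^bsub>P\<^esub> (\<ominus>\<^bsub>P\<^esub> r k))"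
      using p rP main by (intro P.finsum_cong') auto
    also have "\<dots> = (\<Oplus>\<^bsub>P\<^esub>k\<in>G \<beta>. p) \<oplus>\<^bsub>P\<^esub> y"
      unfolding y_def using p rP by (intro P.finsum_addf) auto
    finally have "spread P (\<lambda>p. p) n s v = avg \<beta> \<odot>\<^bsub>P\<^esub> ((\<Oplus>\<^bsub>P\<^esub>k\<in>G \<beta>. p) \<oplus>\<^bsub>P\<^esub> y)"
      using True by (simp add: spread_def t_def \<beta>_def p_def)
    also have "\<dots> = p \<oplus>\<^bsub>P\<^esub> avg \<beta> \<odot>\<^bsub>P\<^esub> y"
      using PM.A.smult_r_distr[OF \<iota> sp yP] avg_sum[OF \<beta>(1) p] by simp
    finally have "p \<ominus>\<^bsub>P\<^esub> spread P (\<lambda>p. p) n s v = \<ominus>\<^bsub>P\<^esub> (avg \<beta> \<odot>\<^bsub>P\<^esub> y)"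
      using p iyP by (simp add: P.minus_eq P.minus_add P.a_assoc[symmetric] P.r_neg)
    then show ?thesis using Dneg[OF iy] by (simp add: p_def)
  qed
qed

lemma spread_hom:
  assumes A: "left_module R A" and \<mu>: "additive_map P A \<mu>"
    and \<mu>s: "\<And>k p. \<lbrakk>k \<in> carrier K; p \<in> carrier P\<rbrakk> \<Longrightarrow>
      \<mu> (single K \<one> k \<odot>\<^bsub>P\<^esub> p) = single K \<one> k \<odot>\<^bsub>A\<^esub> \<mu> p"
    and bound: "\<And>s. s \<in> S \<Longrightarrow> rank (top s) \<le> n"
  shows "(\<lambda>p. \<Oplus>\<^bsub>A\<^esub>s\<in>S. spread A \<mu> n s (p s)) \<in> lmod_hom R P A"
  by (rule equivariant_family_hom[OF A spread_additive[OF A \<mu>] spread_scalar[OF A \<mu> \<mu>s]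
    spread_equivariant[OF A \<mu> bound]])

lemma scalar_lmod_hom:
  assumes "h \<in> lmod_hom R A A'"
  shows "h \<in> lmod_hom K (scalar_module K M A) (scalar_module K M A')"
  using assms by (auto simp: lmod_hom_def hom_def KN.single_in)

text \<open>A \<open>K\<close>-linear lift of a homomorphism on \<open>P\<close>; it exists because \<open>V\<close> is finite-dimensional.\<close>

lemma linear_lift_P:
  fixes A :: "('m \<Rightarrow> 'k, 'a) module" and A' :: "('m \<Rightarrow> 'k, 'b) module"
  assumes A: "left_module R A" and A': "left_module R A'" and f: "f \<in> lmod_hom R A A'"
    and surj: "f ` carrier A = carrier A'" and g: "g \<in> lmod_hom R P A'"
  shows "\<exists>\<mu>. additive_map P A \<mu> \<and> (\<forall>k\<in>carrier K. \<forall>p\<in>carrier P.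
      \<mu> (single K \<one> k \<odot>\<^bsub>P\<^esub> p) = single K \<one> k \<odot>\<^bsub>A\<^esub> \<mu> p) \<and> (\<forall>p\<in>carrier P. f (\<mu> p) = g p)"
proof -
  interpret A: algebra_module K M A
    by (intro algebra_module.intro A finite_monoid_algebra_axioms)
  interpret A': algebra_module K M A'
    by (intro algebra_module.intro A' finite_monoid_algebra_axioms)
  interpret f: additive_map A A' f
    by (rule additive_mapD_lmod_hom[OF A.A.M.abelian_group_axioms A'.A.M.abelian_group_axioms f])
  interpret g: additive_map P A' g
    by (rule additive_mapD_lmod_hom[OF P.abelian_group_axioms A'.A.M.abelian_group_axioms g])
  have gs: "g (r \<odot>\<^bsub>P\<^esub> p) = r \<odot>\<^bsub>A'\<^esub> g p" if "r \<in> carrier R" "p \<in> carrier P" for r p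
    using g that by (auto simp: lmod_hom_def)
  have ssc: "single V s (V.sc k v) = single K \<one> k \<odot>\<^bsub>P\<^esub> single V s v"
    if "s \<in> S" "k \<in> carrier K" "v \<in> carrier V" for s k v
    using smult_single[OF one_closed that(2,1,3)] act_one[OF that(1)] by simp
  have "\<exists>h. additive_map V A h \<and> (\<forall>k\<in>carrier K. \<forall>v\<in>carrier V. h (V.sc k v) = A.sc k (h v)) \<and>
      (\<forall>v\<in>carrier V. f (h v) = g (single V s v))" if s: "s \<in> S" for s
  proof -
    note ag = additive_comp[OF additive_single[OF s] g.additive_map_axioms]
    have "(\<lambda>v. g (single V s v)) \<in> lmod_hom K (scalar_module K M V) (scalar_module K M A')"
      using additive_map.closed[OF ag] additive_map.add[OF ag] ssc[OF s] gs single_in[OF s]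
      by (simp add: lmod_hom_def hom_def KN.single_in)
    then obtain h where h: "h \<in> lmod_hom K (scalar_module K M V) (scalar_module K M A)"
      "\<forall>v\<in>carrier V. f (h v) = g (single V s v)"
      using linear_lift[OF field_K V.scalars A.scalars A'.scalars finite_I, of b f "\<lambda>v. g (single V s v)"]
        scalar_lmod_hom[OF f] surj b_closed b_span by auto
    then show ?thesis
      using V.A.M.abelian_group_axioms A.A.M.abelian_group_axioms
      by (intro exI[of _ h]) (auto simp: additive_map_def additive_map_axioms_def lmod_hom_def hom_def)
  qed
  then obtain h where h: "\<And>s. s \<in> S \<Longrightarrow> additive_map V A (h s)"
    "\<And>s k v. \<lbrakk>s \<in> S; k \<in> carrier K; v \<in> carrier V\<rbrakk> \<Longrightarrow> h s (V.sc k v) = A.sc k (h s v)"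
    "\<And>s v. \<lbrakk>s \<in> S; v \<in> carrier V\<rbrakk> \<Longrightarrow> f (h s v) = g (single V s v)"
    by metis
  let ?\<mu> = "\<lambda>p. \<Oplus>\<^bsub>A\<^esub>s\<in>S. h s (p s)"
  have \<mu>: "additive_map P A ?\<mu>" by (rule additive_family[OF A.A.M.abelian_group_axioms h(1)])
  have \<mu>1: "?\<mu> (single V s v) = h s v" if "s \<in> S" "v \<in> carrier V" for s v
    by (rule family_single[OF h(1) that])
  have "?\<mu> (single K \<one> k \<odot>\<^bsub>P\<^esub> p) = A.sc k (?\<mu> p)" if k: "k \<in> carrier K" and p: "p \<in> carrier P" for k p
  proof -
    have kR: "single K \<one> k \<in> carrier R" using k by (simp add: KN.single_in)
    show ?thesis
    proof (rule additive_eqI[OF additive_comp[OF PM.additive_smult[OF kR] \<mu>]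
          additive_comp[OF \<mu> A.additive_smult[OF kR]] _ p])
      fix s v assume sv: "s \<in> S" "v \<in> carrier V"
      have "?\<mu> (single K \<one> k \<odot>\<^bsub>P\<^esub> single V s v) = h s (V.sc k v)"
        unfolding ssc[OF sv(1) k sv(2), symmetric] by (rule \<mu>1) (use sv k in auto)
      then show "?\<mu> (single K \<one> k \<odot>\<^bsub>P\<^esub> single V s v) = A.sc k (?\<mu> (single V s v))"
        unfolding \<mu>1[OF sv] h(2)[OF sv(1) k sv(2)] .
    qed
  qed
  moreover have "f (?\<mu> p) = g p" if "p \<in> carrier P" for p
  proof (rule additive_eqI[OF additive_comp[OF \<mu> f.additive_map_axioms] g.additive_map_axioms _ that])
    show "f (?\<mu> (single V s v)) = g (single V s v)" if "s \<in> S" "v \<in> carrier V" for s v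
      unfolding \<mu>1[OF that] by (rule h(3)[OF that])
  qed
  ultimately show ?thesis using \<mu> by blast
qed

text \<open>The endomorphism \<open>s\<close> of the splitting criterion is \<open>spread\<close> for \<open>\<mu> = id\<close>. To lift \<open>g \<circ> s\<close>, apply
  \<open>spread\<close> to a \<open>K\<close>-linear lift of \<open>g\<close> and use naturality.\<close>

lemma projective_from_lower_rank:
  fixes n
  defines "S' \<equiv> {s \<in> S. rank (top s) < n}"
  assumes bound: "\<And>s. s \<in> S \<Longrightarrow> rank (top s) \<le> n"
    and low: "projective_module TYPE('a) TYPE('b) R (P\<lparr>carrier := fun_carrier S' V\<rparr>)"
  shows "projective_module TYPE('a) TYPE('b) R P"
proof -
  let ?id = "\<lambda>p :: 's \<Rightarrow> 'v. p"
  let ?s = "\<lambda>p. \<Oplus>\<^bsub>P\<^esub>s\<in>S. spread P ?id n s (p s)"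
  have id: "additive_map P P ?id" by unfold_locales auto
  have s: "?s \<in> lmod_hom R P P" by (rule spread_hom[OF left_module_P id _ bound]) auto
  note sa = additive_mapD_lmod_hom[OF P.abelian_group_axioms P.abelian_group_axioms s]
  have ssp: "?s (single V s v) = spread P ?id n s v" if "s \<in> S" "v \<in> carrier V" for s v
    by (rule family_single[OF spread_additive[OF left_module_P id] that])
  have sub: "S' \<subseteq> S" by (auto simp: S'_def)
  note D = restrict_carrier[OF sub]
  show ?thesis
  proof (rule projective_extension[OF left_module_P low _ s])
    show "fun_carrier S' V \<subseteq> carrier P" using D by blast
  next
    fix p assume p: "p \<in> carrier P"
    have sm: "?s q \<in> carrier P" if "q \<in> carrier P" for q by (rule additive_map.closed[OF sa that])
    interpret d: additive_map P P "\<lambda>p. p \<ominus>\<^bsub>P\<^esub> ?s p"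
    proof
      fix a a' assume "a \<in> carrier P" "a' \<in> carrier P"
      then show "a \<oplus>\<^bsub>P\<^esub> a' \<ominus>\<^bsub>P\<^esub> ?s (a \<oplus>\<^bsub>P\<^esub> a') = a \<ominus>\<^bsub>P\<^esub> ?s a \<oplus>\<^bsub>P\<^esub> (a' \<ominus>\<^bsub>P\<^esub> ?s a')"
        using sm by (simp only: additive_map.add[OF sa] P.minus_eq P.minus_add P.a_ac P.a_inv_closed P.a_closed)
    qed (use sm in auto)
    have "(p \<ominus>\<^bsub>P\<^esub> ?s p) t = \<zero>\<^bsub>V\<^esub>" if t: "t \<notin> S'" for t
    proof (rule additive_eqI[OF additive_comp[OF d.additive_map_axioms additive_val]
          additive_map_zero[OF P.abelian_group_axioms V.A.M.abelian_group_axioms] _ p])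
      fix s v assume sv: "s \<in> S" "v \<in> carrier V"
      show "(single V s v \<ominus>\<^bsub>P\<^esub> ?s (single V s v)) t = \<zero>\<^bsub>V\<^esub>"
        unfolding ssp[OF sv] using spread_complement[OF bound S'_def[THEN meta_eq_to_obj_eq] sv] D t by blast
    qed
    then show "p \<ominus>\<^bsub>P\<^esub> ?s p \<in> fun_carrier S' V" unfolding D using d.closed[OF p] by blast
  next
    fix A :: "('m \<Rightarrow> 'k, 'a) module" and A' :: "('m \<Rightarrow> 'k, 'b) module" and f g
    assume A: "left_module R A" and A': "left_module R A'" and f: "f \<in> lmod_hom R A A'"
      and surj: "f ` carrier A = carrier A'" and g: "g \<in> lmod_hom R P A'"
    interpret A: algebra_module K M A
      by (intro algebra_module.intro A finite_monoid_algebra_axioms)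
    interpret A': algebra_module K M A'
      by (intro algebra_module.intro A' finite_monoid_algebra_axioms)
    obtain \<mu> where \<mu>: "additive_map P A \<mu>"
      and \<mu>s: "\<And>k p. \<lbrakk>k \<in> carrier K; p \<in> carrier P\<rbrakk> \<Longrightarrow>
        \<mu> (single K \<one> k \<odot>\<^bsub>P\<^esub> p) = single K \<one> k \<odot>\<^bsub>A\<^esub> \<mu> p"
      and f\<mu>: "\<And>p. p \<in> carrier P \<Longrightarrow> f (\<mu> p) = g p"
      using linear_lift_P[OF A A' f surj g] by blast
    let ?h = "\<lambda>p. \<Oplus>\<^bsub>A\<^esub>s\<in>S. spread A \<mu> n s (p s)"
    have h: "?h \<in> lmod_hom R P A" by (rule spread_hom[OF A \<mu> \<mu>s bound])
    have hsp: "?h (single V s v) = spread A \<mu> n s v" if "s \<in> S" "v \<in> carrier V" for s v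
      by (rule family_single[OF spread_additive[OF A \<mu>] that])
    note ha = additive_mapD_lmod_hom[OF P.abelian_group_axioms A.A.M.abelian_group_axioms h]
    note fa = additive_mapD_lmod_hom[OF A.A.M.abelian_group_axioms A'.A.M.abelian_group_axioms f]
    note ga = additive_mapD_lmod_hom[OF P.abelian_group_axioms A'.A.M.abelian_group_axioms g]
    have "f (?h p) = g (?s p)" if p: "p \<in> carrier P" for p
    proof (rule additive_eqI[OF additive_comp[OF ha fa] additive_comp[OF sa ga] _ p])
      fix s v assume sv: "s \<in> S" "v \<in> carrier V"
      have "f (spread A \<mu> n s v) = spread A' g n s v"
        by (rule spread_natural[OF A A' \<mu> f sv f\<mu>])
      also have "\<dots> = g (spread P ?id n s v)"
        by (rule spread_natural[OF left_module_P A' id g sv, symmetric]) auto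
      finally show "f (?h (single V s v)) = g (?s (single V s v))" unfolding ssp[OF sv] hsp[OF sv] .
    qed
    then have "\<forall>p\<in>carrier P. f (?h p) = g (?s p)" by (rule ballI)
    from bexI[where P = "\<lambda>h. \<forall>p\<in>carrier P. f (h p) = g (?s p)", OF this h]
    show "\<exists>h\<in>lmod_hom R P A. \<forall>p\<in>carrier P. f (h p) = g (?s p)" .
  qed
qed

end

theorem topped_action_projective:
  fixes K :: "('k, 'y) ring_scheme" and M :: "('m, 'x) monoid_scheme"
    and V :: "('m \<Rightarrow> 'k, 'v) module" and P :: "('m \<Rightarrow> 'k, 's \<Rightarrow> 'v) module"
    and top :: "'s \<Rightarrow> 'm"
  assumes "topped_action K M V S P act top I b"
  shows "projective_module TYPE('a) TYPE('b) (monoid_algebra K M) P"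
  using assms
proof (induction "card S" arbitrary: S P rule: less_induct)
  case less
  interpret topped_action K M V S P act top I b by (rule less.prems)
  show ?case
  proof (cases "S = {}")
    case True
    then have c: "carrier P = {\<zero>\<^bsub>P\<^esub>}" by (auto simp: carrier_P fun_carrier_def zero_P)
    show ?thesis unfolding projective_module_def
    proof (intro conjI allI impI left_module_P)
      fix A :: "('m \<Rightarrow> 'k, 'a) module" and A' :: "('m \<Rightarrow> 'k, 'b) module" and f g
      assume *: "left_module R A \<and> left_module R A' \<and> f \<in> lmod_hom R A A' \<and>
        f ` carrier A = carrier A' \<and> g \<in> lmod_hom R P A'"
      interpret A: algebra_module K M A
        using * by (intro algebra_module.intro finite_monoid_algebra_axioms) auto
      interpret A': algebra_module K M A'
        using * by (intro algebra_module.intro finite_monoid_algebra_axioms) auto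
      have f0: "f \<zero>\<^bsub>A\<^esub> = \<zero>\<^bsub>A'\<^esub>" and g0: "g \<zero>\<^bsub>P\<^esub> = \<zero>\<^bsub>A'\<^esub>"
        using * additive_map.zero[OF additive_mapD_lmod_hom] A.A.M.abelian_group_axioms
          A'.A.M.abelian_group_axioms P.abelian_group_axioms by blast+
      have "(\<lambda>_. \<zero>\<^bsub>A\<^esub>) \<in> lmod_hom R P A"
        using additive_map.zero[OF A.additive_smult] by (auto simp: lmod_hom_def hom_def)
      then show "\<exists>h\<in>lmod_hom R P A. \<forall>p\<in>carrier P. f (h p) = g p" using c f0 g0 by auto
    qed
  next
    case False
    define n where "n = Max ((rank \<circ> top) ` S)"
    have bound: "rank (top s) \<le> n" if "s \<in> S" for s
      unfolding n_def using that finite_S by (intro Max_ge) auto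
    have "n \<in> (rank \<circ> top) ` S" unfolding n_def using False finite_S by (intro Max_in) auto
    then have "{s \<in> S. rank (top s) < n} \<subset> S" by auto
    then have "card {s \<in> S. rank (top s) < n} < card S" using finite_S by (simp add: psubset_card_mono)
    then show ?thesis
      using less.hyps[OF _ restrict_rank] by (intro projective_from_lower_rank[OF bound])
  qed
qed

section \<open>Alternating sums over faces\<close>

text \<open>The faces of \<open>b # c\<close> are \<open>c\<close> and the faces of \<open>c\<close> with \<open>b\<close> in front, the latter with opposite
  signs.\<close>

fun face_sum :: "('w, 'z) ring_scheme \<Rightarrow> ('p list \<Rightarrow> 'w) \<Rightarrow> 'p list \<Rightarrow> 'w" where
  "face_sum W \<phi> [] = \<zero>\<^bsub>W\<^esub>"
| "face_sum W \<phi> (b # c) = \<phi> c \<ominus>\<^bsub>W\<^esub> face_sum W (\<lambda>x. \<phi> (b # x)) c"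

lemma face_0 [simp]: "face 0 (b # c) = c"
  by (simp add: face_def)

lemma face_Suc [simp]: "face (Suc i) (b # c) = b # face i c"
  by (simp add: face_def)

lemma length_face: "i < length c \<Longrightarrow> length (face i c) = length c - 1"
  by (simp add: face_def)

lemma face_sum_cong:
  assumes "\<And>i. i < length c \<Longrightarrow> \<phi> (face i c) = \<psi> (face i c)"
  shows "face_sum W \<phi> c = face_sum W \<psi> c"
  using assms
proof (induction c arbitrary: \<phi> \<psi>)
  case (Cons b c)
  have "\<phi> c = \<psi> c" using Cons.prems[of 0] by simp
  moreover have "face_sum W (\<lambda>x. \<phi> (b # x)) c = face_sum W (\<lambda>x. \<psi> (b # x)) c"
    by (rule Cons.IH) (use Cons.prems[of "Suc i" for i] in simp)
  ultimately show ?case by simp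
qed simp

context abelian_group
begin

lemma minus_zero_G: "\<ominus> \<zero> = \<zero>"
  by (rule minus_equality) simp_all

lemma diff_zero: "x \<in> carrier G \<Longrightarrow> x \<ominus> \<zero> = x"
  unfolding minus_eq minus_zero_G by simp

lemma diff_self: "x \<in> carrier G \<Longrightarrow> x \<ominus> x = \<zero>"
  by (simp add: minus_eq r_neg)

lemma diff_add_diff:
  "\<lbrakk>a \<in> carrier G; b \<in> carrier G; c \<in> carrier G; d \<in> carrier G\<rbrakk> \<Longrightarrow>
    (a \<ominus> b) \<ominus> (c \<ominus> d) = (a \<ominus> c) \<ominus> (b \<ominus> d)"
  by (simp add: minus_eq minus_add a_ac)

lemma face_sum_closed:
  assumes "\<And>i. i < length c \<Longrightarrow> \<phi> (face i c) \<in> carrier G"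
  shows "face_sum G \<phi> c \<in> carrier G"
  using assms
proof (induction c arbitrary: \<phi>)
  case (Cons b c)
  have "face_sum G (\<lambda>x. \<phi> (b # x)) c \<in> carrier G"
    by (rule Cons.IH) (use Cons.prems[of "Suc i" for i] in simp)
  then show ?case using Cons.prems[of 0] by simp
qed simp

lemma face_sum_zero: "face_sum G (\<lambda>_. \<zero>) c = \<zero>"
  by (induction c) (simp_all add: diff_zero)

lemma face_sum_eq_zero:
  assumes "\<And>i. i < length c \<Longrightarrow> \<phi> (face i c) = \<zero>"
  shows "face_sum G \<phi> c = \<zero>"
  using face_sum_cong[of c \<phi> "\<lambda>_. \<zero>" G] assms face_sum_zero by simp

lemma face_sum_diff:
  assumes "\<And>i. i < length c \<Longrightarrow> \<phi> (face i c) \<in> carrier G"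
    and "\<And>i. i < length c \<Longrightarrow> \<psi> (face i c) \<in> carrier G"
  shows "face_sum G (\<lambda>x. \<phi> x \<ominus> \<psi> x) c = face_sum G \<phi> c \<ominus> face_sum G \<psi> c"
  using assms
proof (induction c arbitrary: \<phi> \<psi>)
  case (Cons b c)
  have 1: "\<phi> c \<in> carrier G" "\<psi> c \<in> carrier G" using Cons.prems(1)[of 0] Cons.prems(2)[of 0] by auto
  have 2: "\<phi> (b # face i c) \<in> carrier G" "\<psi> (b # face i c) \<in> carrier G" if "i < length c" for i
    using Cons.prems(1)[of "Suc i"] Cons.prems(2)[of "Suc i"] that by auto
  show ?case
    using Cons.IH[of "\<lambda>x. \<phi> (b # x)" "\<lambda>x. \<psi> (b # x)"] 1 2
    by (simp add: diff_add_diff face_sum_closed)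
qed (simp add: diff_zero)

text \<open>By the recursion, the face \<open>c\<close> of \<open>b # c\<close> contributes the alternating sum of \<open>\<phi>\<close> over the faces
  of \<open>c\<close>, and the other faces contribute it with the opposite sign. What remains is the double sum
  for \<open>c\<close>, with \<open>b\<close> in front.\<close>

lemma face_sum_face_sum:
  assumes "\<And>i j. i < length c \<Longrightarrow> j < length c - 1 \<Longrightarrow> \<phi> (face j (face i c)) \<in> carrier G"
  shows "face_sum G (\<lambda>x. face_sum G \<phi> x) c = \<zero>"
  using assms
proof (induction c arbitrary: \<phi>)
  case (Cons b c)
  have 1: "\<phi> (face j c) \<in> carrier G" if "j < length c" for j
    using Cons.prems[of 0 j] that by simp
  have 2: "\<phi> (b # face j (face i c)) \<in> carrier G" if "i < length c" "j < length c - 1" for i j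
    using Cons.prems[of "Suc i" "Suc j"] that by simp
  have fc: "face_sum G \<phi> c \<in> carrier G" by (rule face_sum_closed) (rule 1)
  have gc: "face_sum G (\<lambda>y. \<phi> (b # y)) (face i c) \<in> carrier G" if "i < length c" for i
    by (rule face_sum_closed) (use 2 that length_face[OF that] in simp)
  have "face_sum G (\<lambda>x. \<phi> x \<ominus> face_sum G (\<lambda>y. \<phi> (b # y)) x) c =
      face_sum G \<phi> c \<ominus> face_sum G (\<lambda>x. face_sum G (\<lambda>y. \<phi> (b # y)) x) c"
    by (rule face_sum_diff) (use 1 gc in auto)
  also have "face_sum G (\<lambda>x. face_sum G (\<lambda>y. \<phi> (b # y)) x) c = \<zero>"
    by (rule Cons.IH) (rule 2)
  finally show ?case using fc by (simp add: diff_zero diff_self)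
qed simp

definition signed :: "nat \<Rightarrow> 'a \<Rightarrow> 'a" where
  "signed n w = (if even n then w else \<ominus> w)"

lemma signed_closed: "w \<in> carrier G \<Longrightarrow> signed n w \<in> carrier G"
  by (simp add: signed_def)

lemma signed_Suc: "w \<in> carrier G \<Longrightarrow> signed (Suc n) w = \<ominus> signed n w"
  by (simp add: signed_def)

lemma signed_signed: "w \<in> carrier G \<Longrightarrow> signed n (signed n w) = w"
  by (simp add: signed_def)

lemma face_sum_snoc:
  assumes "\<phi> c \<in> carrier G" "\<And>i. i < length c \<Longrightarrow> \<phi> (face i c @ [a]) \<in> carrier G"
  shows "face_sum G \<phi> (c @ [a]) = face_sum G (\<lambda>x. \<phi> (x @ [a])) c \<oplus> signed (length c) (\<phi> c)"
  using assms
proof (induction c arbitrary: \<phi>)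
  case Nil
  then show ?case by (simp add: signed_def diff_zero)
next
  case (Cons b c)
  have 1: "\<phi> (c @ [a]) \<in> carrier G" using Cons.prems(2)[of 0] by simp
  have 2: "\<phi> (b # face i c @ [a]) \<in> carrier G" if "i < length c" for i
    using Cons.prems(2)[of "Suc i"] that by simp
  have fc: "face_sum G (\<lambda>x. \<phi> (b # x @ [a])) c \<in> carrier G"
    by (rule face_sum_closed) (rule 2)
  have sc: "signed (length c) (\<phi> (b # c)) \<in> carrier G" using Cons.prems(1) by (rule signed_closed)
  have "face_sum G (\<lambda>x. \<phi> (b # x)) (c @ [a]) =
      face_sum G (\<lambda>x. \<phi> (b # x @ [a])) c \<oplus> signed (length c) (\<phi> (b # c))"
    using Cons.IH[of "\<lambda>x. \<phi> (b # x)"] Cons.prems(1) 2 by simp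
  then show ?case
    using 1 fc sc signed_Suc[OF Cons.prems(1)] by (simp add: minus_eq minus_add a_assoc)
qed

text \<open>A simplicial map sends a simplex that it collapses to zero. The alternating sum over the
  faces of a collapsed simplex vanishes: if its first two vertices have the same image, then the first
  two faces cancel and all other faces collapse. The second premise holds for monotone \<open>\<mu>\<close> and
  increasing \<open>c\<close>: then two vertices with the same image force all vertices between them to have it.\<close>

lemma face_sum_map:
  assumes "\<And>i. i < length c \<Longrightarrow> distinct (map \<mu> (face i c)) \<Longrightarrow> \<phi> (map \<mu> (face i c)) \<in> carrier G"
    and "\<And>x y z u. c = x @ y # z # u \<Longrightarrow> \<mu> y \<in> set (map \<mu> (z # u)) \<Longrightarrow> \<mu> y = \<mu> z"
  shows "face_sum G (\<lambda>x. if distinct (map \<mu> x) then \<phi> (map \<mu> x) else \<zero>) c =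
    (if distinct (map \<mu> c) then face_sum G \<phi> (map \<mu> c) else \<zero>)"
  using assms
proof (induction c arbitrary: \<phi>)
  case (Cons b c)
  let ?\<nu> = "\<lambda>\<phi> x. if distinct (map \<mu> x) then \<phi> (map \<mu> x) else \<zero>"
  have face_sub: "set (face i c) \<subseteq> set c" for i
    unfolding face_def using set_take_subset[of i c] set_drop_subset[of "Suc i" c] by auto
  have \<phi>c: "distinct (map \<mu> c) \<Longrightarrow> \<phi> (map \<mu> c) \<in> carrier G" using Cons.prems(1)[of 0] by simp
  show ?case
  proof (cases "\<mu> b \<in> set (map \<mu> c)")
    case False
    have nb: "\<mu> b \<notin> set (map \<mu> (face i c))" for i using False face_sub[of i] by auto
    have "face_sum G (\<lambda>x. ?\<nu> \<phi> (b # x)) c = face_sum G (?\<nu> (\<lambda>x. \<phi> (\<mu> b # x))) c"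
    proof (rule face_sum_cong)
      show "?\<nu> \<phi> (b # face i c) = ?\<nu> (\<lambda>x. \<phi> (\<mu> b # x)) (face i c)" for i using nb[of i] by simp
    qed
    also have "\<dots> = (if distinct (map \<mu> c) then face_sum G (\<lambda>x. \<phi> (\<mu> b # x)) (map \<mu> c) else \<zero>)"
    proof (rule Cons.IH)
      show "\<phi> (\<mu> b # map \<mu> (face i c)) \<in> carrier G"
        if "i < length c" "distinct (map \<mu> (face i c))" for i
        using Cons.prems(1)[of "Suc i"] that nb[of i] by simp
      show "\<mu> y = \<mu> z" if "c = x @ y # z # u" "\<mu> y \<in> set (map \<mu> (z # u))" for x y z u
        using Cons.prems(2)[of "b # x" y z u] that by simp
    qed
    finally show ?thesis using False \<phi>c by (auto simp: diff_zero)
  next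
    case True
    then obtain b1 c' where c: "c = b1 # c'" by (cases c) auto
    have eq: "\<mu> b = \<mu> b1" using Cons.prems(2)[of "[]" b b1 c'] True c by simp
    have "face_sum G (\<lambda>x. ?\<nu> \<phi> (b # b1 # x)) c' = \<zero>"
      using eq by (intro face_sum_eq_zero) simp
    moreover have "?\<nu> \<phi> (b # c') = ?\<nu> \<phi> c" using eq c by simp
    moreover have "?\<nu> \<phi> c \<in> carrier G" using \<phi>c by simp
    ultimately have "face_sum G (?\<nu> \<phi>) (b # c) = \<zero>"
      unfolding c by (simp add: diff_zero diff_self del: list.map)
    then show ?thesis using True by auto
  qed
qed simp

end

lemma (in additive_map) face_sum:
  assumes "\<And>i. i < length c \<Longrightarrow> \<phi> (face i c) \<in> carrier A"
  shows "h (face_sum A \<phi> c) = face_sum B (\<lambda>x. h (\<phi> x)) c"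
  using assms
proof (induction c arbitrary: \<phi>)
  case (Cons b c)
  have 1: "\<phi> c \<in> carrier A" using Cons.prems[of 0] by simp
  have 2: "\<phi> (b # face i c) \<in> carrier A" if "i < length c" for i
    using Cons.prems[of "Suc i"] that by simp
  show ?case
    using Cons.IH[of "\<lambda>x. \<phi> (b # x)"] 1 2 A.face_sum_closed[of c "\<lambda>x. \<phi> (b # x)"] by (simp add: diff)
qed (simp add: zero)

lemma (in ring) face_sum_explicit:
  assumes "\<And>i. i < length c \<Longrightarrow> \<phi> (face i c) \<in> carrier R"
  shows "face_sum R \<phi> c = (\<Oplus>i\<in>{..<length c}. (\<ominus> \<one>) [^] i \<otimes> \<phi> (face i c))"
  using assms
proof (induction c arbitrary: \<phi>)
  case (Cons b c)
  have 1: "\<phi> c \<in> carrier R" using Cons.prems[of 0] by simp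
  have 2: "\<phi> (b # face i c) \<in> carrier R" if "i < length c" for i
    using Cons.prems[of "Suc i"] that by simp
  have sgn: "(\<ominus> \<one>) [^] Suc i \<otimes> w = \<ominus> ((\<ominus> \<one>) [^] i \<otimes> w)" if "w \<in> carrier R" for i w
    using that by (simp add: nat_pow_Suc2 l_minus r_minus m_assoc del: nat_pow_Suc)
  interpret neg: additive_map R R "\<lambda>x. \<ominus> x"
    by unfold_locales (simp_all add: minus_add)
  let ?f = "\<lambda>i. (\<ominus> \<one>) [^] i \<otimes> \<phi> (face i (b # c))"
  have "(\<Oplus>i\<in>{..<length (b # c)}. ?f i) = (\<Oplus>i\<in>insert 0 (Suc ` {..<length c}). ?f i)"
    by (rule arg_cong[where f = "finsum R ?f"]) (simp add: lessThan_Suc_eq_insert_0)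
  also have "\<dots> = \<phi> c \<oplus> (\<Oplus>i\<in>Suc ` {..<length c}. ?f i)"
    using 1 2 by (subst finsum_insert) auto
  also have "(\<Oplus>i\<in>Suc ` {..<length c}. ?f i) = (\<Oplus>i\<in>{..<length c}. ?f (Suc i))"
    using 2 by (subst finsum_reindex) auto
  also have "\<dots> = (\<Oplus>i\<in>{..<length c}. \<ominus> ((\<ominus> \<one>) [^] i \<otimes> \<phi> (b # face i c)))"
    using 2 sgn by (intro finsum_cong') auto
  also have "\<dots> = \<ominus> face_sum R (\<lambda>x. \<phi> (b # x)) c"
    using 2 Cons.IH[of "\<lambda>x. \<phi> (b # x)"] by (subst neg.finsum[symmetric]) auto
  finally show ?case by (simp add: minus_eq)
qed simp

lemma (in abelian_group) signed_additive: "additive_map G G (signed n)"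
  by unfold_locales (simp_all add: signed_def minus_add)

lemma (in additive_map) signed: "a \<in> carrier A \<Longrightarrow> h (A.signed n a) = B.signed n (h a)"
  by (simp add: A.signed_def B.signed_def minus)

lemma face_sum_additive:
  assumes "abelian_group C" "abelian_group G"
    and "\<And>i. i < length c \<Longrightarrow> additive_map C G (\<phi> (face i c))"
  shows "additive_map C G (\<lambda>v. face_sum G (\<lambda>x. \<phi> x v) c)"
  using assms(3)
proof (induction c arbitrary: \<phi>)
  case Nil
  interpret C: abelian_group C by fact
  interpret G: abelian_group G by fact
  show ?case by unfold_locales simp_all
next
  case (Cons b c)
  have 1: "additive_map C G (\<phi> c)" using Cons.prems[of 0] by simp
  have 2: "additive_map C G (\<lambda>v. face_sum G (\<lambda>x. \<phi> (b # x) v) c)"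
    by (rule Cons.IH) (use Cons.prems[of "Suc i" for i] in simp)
  show ?case using additive_map_diff[OF 1 2] by simp
qed

section \<open>The complex of a simple module\<close>

lemma module_ge_simps [simp]:
  "carrier (module_ge K M X e V) = carrier V" "add (module_ge K M X e V) = add V"
  "zero (module_ge K M X e V) = zero V" "finsum (module_ge K M X e V) f S = finsum V f S"
  by (simp_all add: module_ge_def)

locale simple_chains = left_duo_algebra K M
  for K :: "('k, 'y) ring_scheme" and M :: "('m, 'x) monoid_scheme" (structure) +
  fixes e :: 'm and V :: "('m \<Rightarrow> 'k, 'v) module"
  assumes field_K: "field K" and e: "e \<in> idems M"
    and simple: "simple_module (monoid_algebra K (max_subgroup M e)) V"
    and char_ok: "\<forall>f \<in> idems M. \<not> ring_char K dvd order (max_subgroup M f)"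
begin

abbreviation X where "X \<equiv> idems M #> e"
abbreviation N where "N \<equiv> monoid_ge M X"
abbreviation H where "H \<equiv> max_subgroup M e"
abbreviation V0 where "V0 \<equiv> module_ge K M X e V"
abbreviation W where "W \<equiv> inflate (rho K M X) V0"

lemma N_iff: "m \<in> carrier N \<longleftrightarrow> m \<in> carrier M \<and> above e m"
  by (rule in_monoid_ge[OF e])

lemma Bge_iff: "b \<in> idems_ge M X \<longleftrightarrow> b \<in> B \<and> e \<otimes> b = e"
  by (rule in_idems_ge[OF e])

lemma one_N [simp]: "one N = \<one>" "mult N = mult M" by (simp_all add: monoid_ge_def)

lemma one_in_N: "\<one> \<in> carrier N" using N_iff above_one[OF e] by simp

lemma finite_N': "finite (carrier N)"
  using N_iff finite_M by (auto intro: finite_subset[of _ "carrier M"])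

lemma e_mult_H: "m \<in> carrier N \<Longrightarrow> e \<otimes> m \<in> carrier H"
  using above_subgroup[OF e, of m] idemD(1)[OF e] by (simp add: N_iff max_subgroup_iff[OF e])

sublocale H: finite_monoid_algebra K H
proof -
  interpret H: group H by (rule group_max_subgroup[OF e])
  have "carrier H \<subseteq> carrier M" using max_subgroup_iff[OF e] by auto
  then show "finite_monoid_algebra K H"
    using finite_M finite_subset by unfold_locales auto
qed

sublocale VH: algebra_module K H V
  using simple by (intro algebra_module.intro H.finite_monoid_algebra_axioms) (simp add: simple_module_def)

text \<open>The map \<open>KM \<rightarrow> KM\<^bsub>\<ge>X\<^esub> \<rightarrow> KG\<^sub>e\<close> along which \<open>V\<close> becomes a \<open>KM\<close>-module.\<close>

definition to_KH :: "('m \<Rightarrow> 'k) \<Rightarrow> 'm \<Rightarrow> 'k" where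
  "to_KH \<alpha> = algebra_map K N (\<lambda>m. e \<otimes> m) (rho K M X \<alpha>)"

lemma smult_W: "\<alpha> \<odot>\<^bsub>W\<^esub> v = to_KH \<alpha> \<odot>\<^bsub>V\<^esub> v"
  by (simp add: module_ge_def to_KH_def)

lemma to_KH_val:
  "\<alpha> \<in> carrier R \<Longrightarrow> to_KH \<alpha> g = (\<Oplus>\<^bsub>K\<^esub>m\<in>{m \<in> carrier N. e \<otimes> m = g}. \<alpha> m)"
  unfolding to_KH_def algebra_map_def
  using KN.val_closed by (intro K.finsum_cong') (auto simp: rho_def)

lemma to_KH_additive: "additive_map R H.R to_KH"
proof
  note fin = finite_subset[OF _ finite_N']
  fix \<alpha> assume \<alpha>: "\<alpha> \<in> carrier R"
  note cl = KN.val_closed[OF \<alpha>]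
  show "to_KH \<alpha> \<in> carrier H.R"
  proof (rule H.KN.in_carrierI)
    show "to_KH \<alpha> g \<in> carrier K" for g unfolding to_KH_val[OF \<alpha>] using cl by (intro K.finsum_closed) auto
    show "to_KH \<alpha> g = \<zero>\<^bsub>K\<^esub>" if "g \<notin> carrier H" for g
    proof -
      have "{m \<in> carrier N. e \<otimes> m = g} = {}" using e_mult_H that by auto
      then show ?thesis unfolding to_KH_val[OF \<alpha>] by (simp only: K.finsum_empty)
    qed
  qed
  fix \<beta> assume \<beta>: "\<beta> \<in> carrier R"
  note cl' = KN.val_closed[OF \<beta>]
  show "to_KH (\<alpha> \<oplus>\<^bsub>R\<^esub> \<beta>) = to_KH \<alpha> \<oplus>\<^bsub>H.R\<^esub> to_KH \<beta>"
  proof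
    fix g
    show "to_KH (\<alpha> \<oplus>\<^bsub>R\<^esub> \<beta>) g = (to_KH \<alpha> \<oplus>\<^bsub>H.R\<^esub> to_KH \<beta>) g"
      unfolding H.KN.add_P to_KH_val[OF KN.P.a_closed[OF \<alpha> \<beta>]] to_KH_val[OF \<alpha>] to_KH_val[OF \<beta>]
      unfolding KN.add_P using cl cl' by (intro K.finsum_addf) auto
  qed
qed

lemma to_KH_single:
  assumes "m \<in> carrier M" "k \<in> carrier K"
  shows "to_KH (single K m k) = (if above e m then single K (e \<otimes> m) k else \<zero>\<^bsub>H.R\<^esub>)"
proof
  fix g
  have "to_KH (single K m k) g = (\<Oplus>\<^bsub>K\<^esub>n\<in>{n \<in> carrier N. e \<otimes> n = g}. if n = m then k else \<zero>\<^bsub>K\<^esub>)"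
    unfolding to_KH_val[OF KN.single_in[OF assms]] unfolding single_def ..
  also have "\<dots> = (if m \<in> {n \<in> carrier N. e \<otimes> n = g} then k else \<zero>\<^bsub>K\<^esub>)"
    using assms finite_N' by (intro K.finsum_delta) auto
  finally show "to_KH (single K m k) g = (if above e m then single K (e \<otimes> m) k else \<zero>\<^bsub>H.R\<^esub>) g"
    using assms by (auto simp: N_iff single_def H.KN.zero_P)
qed

lemma left_module_W: "left_module R W"
proof (rule left_moduleI)
  interpret to_KH: additive_map R H.R to_KH by (rule to_KH_additive)
  show "abelian_group W"
    by (rule abelian_groupI)
      (auto simp: VH.A.M.a_ac intro: bexI[where x = "\<ominus>\<^bsub>V\<^esub> x" for x] VH.A.M.l_neg)
  show "\<alpha> \<odot>\<^bsub>W\<^esub> w \<in> carrier W" if "\<alpha> \<in> carrier R" "w \<in> carrier W" for \<alpha> w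
    using that to_KH.closed unfolding smult_W by simp
  show "(\<alpha> \<oplus>\<^bsub>R\<^esub> \<beta>) \<odot>\<^bsub>W\<^esub> w = \<alpha> \<odot>\<^bsub>W\<^esub> w \<oplus>\<^bsub>W\<^esub> \<beta> \<odot>\<^bsub>W\<^esub> w"
    if "\<alpha> \<in> carrier R" "\<beta> \<in> carrier R" "w \<in> carrier W" for \<alpha> \<beta> w
    unfolding smult_W using that to_KH.closed by (simp add: to_KH.add VH.A.smult_l_distr)
  show "\<alpha> \<odot>\<^bsub>W\<^esub> (w \<oplus>\<^bsub>W\<^esub> w') = \<alpha> \<odot>\<^bsub>W\<^esub> w \<oplus>\<^bsub>W\<^esub> \<alpha> \<odot>\<^bsub>W\<^esub> w'"
    if "\<alpha> \<in> carrier R" "w \<in> carrier W" "w' \<in> carrier W" for \<alpha> w w'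
    unfolding smult_W using that to_KH.closed by (simp add: VH.A.smult_r_distr)
  show "basis K \<one> \<odot>\<^bsub>W\<^esub> w = w" if "w \<in> carrier W" for w
    unfolding smult_W using that VH.op_one[of w] idemD(1)[OF e]
    by (simp add: to_KH_single above_one[OF e])
  fix m n k j w
  assume *: "m \<in> carrier M" "n \<in> carrier M" "k \<in> carrier K" "j \<in> carrier K" "w \<in> carrier W"
  have z: "\<zero>\<^bsub>H.R\<^esub> \<odot>\<^bsub>V\<^esub> v = \<zero>\<^bsub>V\<^esub>" if "v \<in> carrier V" for v
    by (rule additive_map.zero[OF VH.additive_algebra[OF that]])
  have z': "\<alpha> \<odot>\<^bsub>V\<^esub> \<zero>\<^bsub>V\<^esub> = \<zero>\<^bsub>V\<^esub>" if "\<alpha> \<in> carrier H.R" for \<alpha>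
    by (rule additive_map.zero[OF VH.additive_smult[OF that]])
  have eH: "e \<otimes> m \<in> carrier H" if "above e m" "m \<in> carrier M" for m
    using e_mult_H that N_iff by blast
  note sc = H.KN.single_in
  have prod: "e \<otimes> (m \<otimes> n) = (e \<otimes> m) \<otimes> (e \<otimes> n)"
    using absorb[OF e *(1)] idemD[OF e] * by (simp add: m_assoc[symmetric])
  show "single K (m \<otimes> n) (k \<otimes>\<^bsub>K\<^esub> j) \<odot>\<^bsub>W\<^esub> w = single K m k \<odot>\<^bsub>W\<^esub> (single K n j \<odot>\<^bsub>W\<^esub> w)"
  proof (cases "above e m \<and> above e n")
    case True
    have "single K (e \<otimes> (m \<otimes> n)) (k \<otimes>\<^bsub>K\<^esub> j) =
        single K (e \<otimes> m) k \<otimes>\<^bsub>H.R\<^esub> single K (e \<otimes> n) j"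
      using * H.mult_single[of k j "e \<otimes> m" "e \<otimes> n"] prod by simp
    then show ?thesis
      unfolding smult_W using True * above_mult[OF e *(1,2)] sc[OF eH] VH.A.smult_assoc1
      by (simp add: to_KH_single)
  next
    case False
    then have "\<not> above e (m \<otimes> n)" using above_mult[OF e *(1,2)] by blast
    moreover have "to_KH (single K n j) \<odot>\<^bsub>V\<^esub> w \<in> carrier V" "to_KH (single K m k) \<in> carrier H.R"
      using * to_KH.closed[OF KN.single_in] by simp_all
    ultimately show ?thesis
      unfolding smult_W using False * z z' by (auto simp: to_KH_single)
  qed
qed

sublocale W: algebra_module K M W
  by (intro algebra_module.intro left_module_W finite_monoid_algebra_axioms)

lemma smult_W_single: "\<lbrakk>m \<in> carrier N; k \<in> carrier K\<rbrakk> \<Longrightarrow> single K m k \<odot>\<^bsub>W\<^esub> v = single K m k \<odot>\<^bsub>V0\<^esub> v"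
proof -
  assume "m \<in> carrier N" "k \<in> carrier K"
  then have "rho K M X (single K m k) = single K m k" by (auto simp: rho_def single_def)
  then show ?thesis by simp
qed

lemma trivial_W: "\<lbrakk>b \<in> idems_ge M X; v \<in> carrier V\<rbrakk> \<Longrightarrow> basis K b \<odot>\<^bsub>W\<^esub> v = v"
  unfolding smult_W using VH.op_one[of v] idemD(1)[of b]
  by (simp add: to_KH_single Bge_iff above_idem)

lemma zero_W: "\<lbrakk>m \<in> carrier M; \<not> above e m; v \<in> carrier V\<rbrakk> \<Longrightarrow> basis K m \<odot>\<^bsub>W\<^esub> v = \<zero>\<^bsub>V\<^esub>"
  unfolding smult_W using additive_map.zero[OF VH.additive_algebra[of v]] by (simp add: to_KH_single)

text \<open>By simplicity \<open>V = KG\<^sub>e v\<^sub>0\<close> for every nonzero \<open>v\<^sub>0\<close>, so the finitely many \<open>g v\<^sub>0\<close> span \<open>V\<close> over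
  \<open>K\<close>.\<close>

lemma spanning_W:
  "\<exists>v0\<in>carrier V. \<forall>v\<in>carrier W. \<exists>x. (\<forall>g\<in>carrier H. x g \<in> carrier K) \<and>
    v = (\<Oplus>\<^bsub>W\<^esub>g\<in>carrier H. single K \<one> (x g) \<odot>\<^bsub>W\<^esub> (basis K g \<odot>\<^bsub>V\<^esub> v0))"
proof -
  obtain v0 where v0: "v0 \<in> carrier V" "v0 \<noteq> \<zero>\<^bsub>V\<^esub>"
    using simple VH.A.M.zero_closed unfolding simple_module_def by blast
  interpret a: additive_map H.R V "\<lambda>\<alpha>. \<alpha> \<odot>\<^bsub>V\<^esub> v0" by (rule VH.additive_algebra[OF v0(1)])
  let ?U = "(\<lambda>\<alpha>. \<alpha> \<odot>\<^bsub>V\<^esub> v0) ` carrier H.R"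
  have "submodule ?U H.R V"
  proof (intro submodule.intro submodule_axioms.intro subgroup.intro)
    show "?U \<subseteq> carrier (add_monoid V)" using a.closed by auto
    show "x \<otimes>\<^bsub>add_monoid V\<^esub> y \<in> ?U" if "x \<in> ?U" "y \<in> ?U" for x y
      using that by (auto simp: a.add[symmetric])
    show "\<one>\<^bsub>add_monoid V\<^esub> \<in> ?U" using a.zero by (auto intro!: image_eqI[of _ _ "\<zero>\<^bsub>H.R\<^esub>"])
    show "inv\<^bsub>add_monoid V\<^esub> x \<in> ?U" if x: "x \<in> ?U" for x
    proof -
      obtain \<alpha> where "\<alpha> \<in> carrier H.R" "x = \<alpha> \<odot>\<^bsub>V\<^esub> v0" using x by blast
      then have "\<ominus>\<^bsub>V\<^esub> x = (\<ominus>\<^bsub>H.R\<^esub> \<alpha>) \<odot>\<^bsub>V\<^esub> v0" "\<ominus>\<^bsub>H.R\<^esub> \<alpha> \<in> carrier H.R" using a.minus by simp_all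
      then show ?thesis unfolding a_inv_def[symmetric] by blast
    qed
    show "\<alpha> \<odot>\<^bsub>V\<^esub> x \<in> ?U" if \<alpha>: "\<alpha> \<in> carrier H.R" and x: "x \<in> ?U" for \<alpha> x
    proof -
      obtain \<beta> where "\<beta> \<in> carrier H.R" "x = \<beta> \<odot>\<^bsub>V\<^esub> v0" using x by blast
      then have "\<alpha> \<odot>\<^bsub>V\<^esub> x = (\<alpha> \<otimes>\<^bsub>H.R\<^esub> \<beta>) \<odot>\<^bsub>V\<^esub> v0" "\<alpha> \<otimes>\<^bsub>H.R\<^esub> \<beta> \<in> carrier H.R"
        using \<alpha> v0(1) VH.A.smult_assoc1 by simp_all
      then show ?thesis by blast
    qed
  qed
  then have "?U = {\<zero>\<^bsub>V\<^esub>} \<or> ?U = carrier V" using simple unfolding simple_module_def by blast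
  moreover have "v0 \<in> ?U" using VH.A.smult_one[OF v0(1)] H.R.one_closed by (metis image_eqI)
  ultimately have U: "?U = carrier V" using v0(2) by auto
  show ?thesis
  proof (intro bexI[OF _ v0(1)] ballI)
    fix v assume "v \<in> carrier W"
    then have "v \<in> ?U" using U by simp
    then obtain \<alpha> where \<alpha>: "\<alpha> \<in> carrier H.R" "v = \<alpha> \<odot>\<^bsub>V\<^esub> v0" by blast
    note av = H.KN.val_closed[OF \<alpha>(1)]
    have sc: "single K \<one> k \<odot>\<^bsub>W\<^esub> w = single K \<one>\<^bsub>H\<^esub> k \<odot>\<^bsub>V\<^esub> w" if "k \<in> carrier K" for k w
      unfolding smult_W using that idemD(1)[OF e] by (simp add: to_KH_single above_one[OF e])
    have "v = (\<Oplus>\<^bsub>V\<^esub>g\<in>carrier H. single K g (\<alpha> g) \<odot>\<^bsub>V\<^esub> v0)"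
      using VH.smult_expand[OF \<alpha>(1) v0(1)] \<alpha>(2) by simp
    also have "\<dots> = (\<Oplus>\<^bsub>V\<^esub>g\<in>carrier H. single K \<one> (\<alpha> g) \<odot>\<^bsub>W\<^esub> (basis K g \<odot>\<^bsub>V\<^esub> v0))"
      using av v0(1) VH.single_smult by (intro VH.A.M.finsum_cong') (auto simp only: sc Pi_def VH.sc_closed VH.op_closed)
    also have "\<dots> = (\<Oplus>\<^bsub>W\<^esub>g\<in>carrier H. single K \<one> (\<alpha> g) \<odot>\<^bsub>W\<^esub> (basis K g \<odot>\<^bsub>V\<^esub> v0))"
      by simp
    finally have "(\<forall>g\<in>carrier H. \<alpha> g \<in> carrier K) \<and>
        v = (\<Oplus>\<^bsub>W\<^esub>g\<in>carrier H. single K \<one> (\<alpha> g) \<odot>\<^bsub>W\<^esub> (basis K g \<odot>\<^bsub>V\<^esub> v0))"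
      by (intro conjI ballI av)
    then show "\<exists>x. (\<forall>g\<in>carrier H. x g \<in> carrier K) \<and>
        v = (\<Oplus>\<^bsub>W\<^esub>g\<in>carrier H. single K \<one> (x g) \<odot>\<^bsub>W\<^esub> (basis K g \<odot>\<^bsub>V\<^esub> v0))"
      by (rule exI[where x = \<alpha>])
  qed
qed

abbreviation S where "S q \<equiv> simplices_ge M X q"
abbreviation P where "P q \<equiv> inflate (rho K M X) (coeff_chain_module K M X V0 q)"

text \<open>The elements outside \<open>M\<^bsub>\<ge>X\<^esub>\<close>, which act as zero on the inflated modules, are nowhere defined.\<close>

definition act :: "'m \<Rightarrow> 'm list \<Rightarrow> 'm list option" where
  "act m c = (if above e m then simplex_act M m c else None)"

lemma S_iff: "c \<in> S q \<longleftrightarrow> length c = Suc q \<and> set c \<subseteq> idems_ge M X \<and>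
    sorted_wrt (\<lambda>a b. idem_le M a b \<and> a \<noteq> b) c"
  by (simp add: simplices_ge_def order_simplices_def)

lemma S_idem: "c \<in> S q \<Longrightarrow> x \<in> set c \<Longrightarrow> x \<in> B \<and> e \<otimes> x = e"
  using Bge_iff by (auto simp: S_iff)

lemma finite_S: "finite (S q)"
proof (rule finite_subset)
  show "S q \<subseteq> {c. set c \<subseteq> B \<and> length c = Suc q}" using S_idem by (auto simp: S_iff)
  show "finite {c. set c \<subseteq> B \<and> length c = Suc q}" by (rule finite_lists_length_eq[OF finite_B])
qed

lemma S_last: "c \<in> S q \<Longrightarrow> last c \<in> B \<and> e \<otimes> last c = e"
  using S_idem[of c q "last c"] by (cases "c = []") (auto simp: S_iff)

lemma S_le_last:
  assumes c: "c \<in> S q" and x: "x \<in> set c"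
  shows "last c \<otimes> x = x"
proof -
  have "c \<noteq> []" using x by auto
  then have c': "c = butlast c @ [last c]" by simp
  then have "sorted_wrt (\<lambda>a b. idem_le M a b \<and> a \<noteq> b) (butlast c @ [last c])"
    using c by (simp add: S_iff)
  then have "x \<in> set (butlast c) \<Longrightarrow> idem_le M x (last c)" by (auto simp: sorted_wrt_append)
  moreover have "x \<in> set (butlast c) \<or> x = last c" using x c' by (metis Un_iff empty_iff insert_iff list.set set_append)
  ultimately show ?thesis using S_last[OF c] idemD by (auto simp: idem_le_def)
qed

lemma act_eq:
  assumes "m \<in> carrier M" "c \<in> S q"
  shows "act m c = (if above e m \<and> distinct (map (\<lambda>b. \<omega> (m \<otimes> b)) c)
    then Some (map (\<lambda>b. \<omega> (m \<otimes> b)) c) else None)"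
proof -
  have eq: "map (\<lambda>b. m \<otimes> b \<otimes> dagger M m) c = map (\<lambda>b. \<omega> (m \<otimes> b)) c"
    using omega_mult_idem[OF assms(1)] S_idem[OF assms(2)] by simp
  show ?thesis unfolding act_def simplex_act_def Let_def eq by simp
qed

lemma map_conj_in_S:
  assumes m: "m \<in> carrier M" and am: "above e m" and c: "c \<in> S q"
    and d: "distinct (map (\<lambda>b. \<omega> (m \<otimes> b)) c)"
  shows "map (\<lambda>b. \<omega> (m \<otimes> b)) c \<in> S q"
  unfolding S_iff
proof (intro conjI)
  show "length (map (\<lambda>b. \<omega> (m \<otimes> b)) c) = Suc q" using c by (simp add: S_iff)
  show "set (map (\<lambda>b. \<omega> (m \<otimes> b)) c) \<subseteq> idems_ge M X"
  proof
    fix y assume "y \<in> set (map (\<lambda>b. \<omega> (m \<otimes> b)) c)"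
    then obtain x where x: "x \<in> set c" "y = \<omega> (m \<otimes> x)" by auto
    have xb: "x \<in> B" "e \<otimes> x = e" using S_idem[OF c x(1)] by auto
    then show "y \<in> idems_ge M X"
      unfolding Bge_iff x(2) using omega_idem[of "m \<otimes> x"] conj_ge[OF e m am xb] m idemD(1)[OF xb(1)]
      by simp
  qed
  have "idem_le M (\<omega> (m \<otimes> (c ! i))) (\<omega> (m \<otimes> (c ! j)))" if "i < j" "j < length c" for i j
  proof (rule idem_le_conj[OF m])
    show "c ! i \<in> B" "c ! j \<in> B" using S_idem[OF c] that by auto
    show "idem_le M (c ! i) (c ! j)"
      using c that by (auto simp: S_iff sorted_wrt_iff_nth_less)
  qed
  then show "sorted_wrt (\<lambda>a b. idem_le M a b \<and> a \<noteq> b) (map (\<lambda>b. \<omega> (m \<otimes> b)) c)"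
    unfolding sorted_wrt_iff_nth_less using d by (auto simp: distinct_conv_nth)
qed

lemma S_distinct: "c \<in> S q \<Longrightarrow> distinct c"
  unfolding S_iff distinct_conv_nth sorted_wrt_iff_nth_less by (metis linorder_neqE_nat)

lemma act_mult_chain:
  assumes m: "m \<in> carrier M" and n: "n \<in> carrier M" and c: "c \<in> S q"
  shows "act (m \<otimes> n) c = Option.bind (act n c) (act m)"
proof -
  let ?mn = "map (\<lambda>b. \<omega> (m \<otimes> n \<otimes> b)) c" and ?n = "map (\<lambda>b. \<omega> (n \<otimes> b)) c"
  have eq: "?mn = map (\<lambda>b. \<omega> (m \<otimes> b)) ?n"
    using omega_mult_omega[OF m] n S_idem[OF c] idemD(1) by (simp add: m_assoc m n)
  show ?thesis
  proof (cases "above e n \<and> distinct ?n")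
    case True
    then have n1: "act n c = Some ?n" "?n \<in> S q" using act_eq[OF n c] map_conj_in_S[OF n _ c] by auto
    then show ?thesis
      using act_eq[OF m n1(2)] act_eq[OF m_closed[OF m n] c] above_mult[OF e m n] eq True by simp
  next
    case False
    then have "act n c = None" using act_eq[OF n c] by simp
    moreover have "distinct (map (\<lambda>b. \<omega> (m \<otimes> b)) ?n) \<Longrightarrow> distinct ?n" by (metis distinct_map)
    ultimately show ?thesis
      using act_eq[OF m_closed[OF m n] c] above_mult[OF e m n] eq False by auto
  qed
qed

lemma P_simps:
  "carrier (P q) = fun_carrier (S q) W" "add (P q) = (\<lambda>f g s. f s \<oplus>\<^bsub>W\<^esub> g s)"
  "zero (P q) = (\<lambda>_. \<zero>\<^bsub>W\<^esub>)"
  by (simp_all add: coeff_chain_module_def free_tensor_def fun_carrier_def)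

lemma chain_module_basis:
  assumes m: "m \<in> carrier N" and s: "s \<in> S q"
  shows "(basis K m \<odot>\<^bsub>chain_module K M X q\<^esub> basis K s) t = (if act m s = Some t then \<one>\<^bsub>K\<^esub> else \<zero>\<^bsub>K\<^esub>)"
proof -
  let ?I = "{(m, s) \<in> carrier N \<times> S q. simplex_act M m s = Some t}"
  have "(basis K m \<odot>\<^bsub>chain_module K M X q\<^esub> basis K s) t =
      (\<Oplus>\<^bsub>K\<^esub>p\<in>?I. basis K m (fst p) \<otimes>\<^bsub>K\<^esub> basis K s (snd p))"
    by (simp add: chain_module_def basis_module_def)
  also have "\<dots> = (\<Oplus>\<^bsub>K\<^esub>p\<in>?I. if p = (m, s) then \<one>\<^bsub>K\<^esub> else \<zero>\<^bsub>K\<^esub>)"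
    by (intro K.finsum_cong') (auto simp: single_def)
  also have "\<dots> = (if (m, s) \<in> ?I then \<one>\<^bsub>K\<^esub> else \<zero>\<^bsub>K\<^esub>)"
  proof (rule K.finsum_delta)
    show "finite ?I" using finite_N' finite_S by (auto intro: finite_subset[of _ "carrier N \<times> S q"])
  qed simp
  finally show ?thesis using m s N_iff by (simp add: act_def)
qed

lemma scalar_V0: "k \<in> carrier K \<Longrightarrow> k \<odot>\<^bsub>scalar_module K N V0\<^esub> v = W.sc k v"
  using smult_W_single[OF one_in_N] by simp

lemma smult_chains:
  assumes \<alpha>: "\<alpha> \<in> carrier R" and f: "f \<in> carrier (P q)"
  shows "(\<alpha> \<odot>\<^bsub>P q\<^esub> f) t = (\<Oplus>\<^bsub>W\<^esub>m\<in>carrier M. \<Oplus>\<^bsub>W\<^esub>s\<in>S q.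
    if act m s = Some t then single K m (\<alpha> m) \<odot>\<^bsub>W\<^esub> f s else \<zero>\<^bsub>W\<^esub>)"
proof -
  note \<alpha>K = KN.val_closed[OF \<alpha>]
  have fV: "f s \<in> carrier W" for s using f unfolding P_simps fun_carrier_def by auto
  let ?F = "\<lambda>m s. if act m s = Some t then single K m (\<alpha> m) \<odot>\<^bsub>W\<^esub> f s else \<zero>\<^bsub>W\<^esub>"
  have Fcl: "?F m s \<in> carrier W" if "m \<in> carrier M" for m s
    using that fV \<alpha>K KN.single_in W.A.smult_closed W.A.M.zero_closed by presburger
  let ?T = "\<lambda>p. rho K M X \<alpha> (fst p) \<odot>\<^bsub>scalar_module K N V0\<^esub>
      pure_tensor K N V0 (basis K (fst p) \<odot>\<^bsub>chain_module K M X q\<^esub> basis K (snd p))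
        (basis K (fst p) \<odot>\<^bsub>V0\<^esub> f (snd p)) t"
  have T: "?T (m, s) = ?F m s" if m: "m \<in> carrier N" and s: "s \<in> S q" for m s
  proof -
    have mM: "m \<in> carrier M" using m N_iff by simp
    have rho: "rho K M X \<alpha> m = \<alpha> m" using m by (simp add: rho_def)
    have mv: "basis K m \<odot>\<^bsub>V0\<^esub> f s = W.op m (f s)" using smult_W_single[OF m] by simp
    have mvV: "W.op m (f s) \<in> carrier W" using mM fV by (rule W.op_closed)
    have pt: "pure_tensor K N V0 (basis K m \<odot>\<^bsub>chain_module K M X q\<^esub> basis K s) (W.op m (f s)) t =
        (if act m s = Some t then W.op m (f s) else \<zero>\<^bsub>W\<^esub>)"
      using W.SC.smult_one[OF mvV] W.SC.smult_l_null[OF mvV]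
      unfolding pure_tensor_def chain_module_basis[OF m s] by (simp only: scalar_V0 K.one_closed K.zero_closed split: if_splits) simp
    show ?thesis
      unfolding fst_conv snd_conv rho mv pt scalar_V0[OF \<alpha>K]
      using W.single_smult[OF mM \<alpha>K fV] W.SC.smult_r_null[OF \<alpha>K] by simp
  qed
  have "(\<alpha> \<odot>\<^bsub>P q\<^esub> f) t = (\<Oplus>\<^bsub>W\<^esub>p\<in>carrier N \<times> S q. ?T p)"
    by (simp add: coeff_chain_module_def free_tensor_def)
  also have "\<dots> = (\<Oplus>\<^bsub>W\<^esub>p\<in>carrier N \<times> S q. ?F (fst p) (snd p))"
  proof (rule W.A.M.finsum_cong')
    show "(\<lambda>p. ?F (fst p) (snd p)) \<in> carrier N \<times> S q \<rightarrow> carrier W"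
      using Fcl N_iff by fastforce
    show "?T p = ?F (fst p) (snd p)" if "p \<in> carrier N \<times> S q" for p
      using T[of "fst p" "snd p"] that by (cases p) (simp only: fst_conv snd_conv mem_Times_iff)
  qed simp
  also have "\<dots> = (\<Oplus>\<^bsub>W\<^esub>m\<in>carrier N. \<Oplus>\<^bsub>W\<^esub>s\<in>S q. ?F m s)"
    using finite_N' finite_S Fcl N_iff by (subst W.A.M.finsum_Times) (simp_all only: fst_conv snd_conv)
  also have "\<dots> = (\<Oplus>\<^bsub>W\<^esub>m\<in>carrier M. \<Oplus>\<^bsub>W\<^esub>s\<in>S q. ?F m s)"
  proof (rule W.A.M.add.finprod_mono_neutral_cong_left)
    show "carrier N \<subseteq> carrier M" using N_iff by auto
    show "(\<Oplus>\<^bsub>W\<^esub>s\<in>S q. ?F m s) = \<zero>\<^bsub>W\<^esub>" if "m \<in> carrier M - carrier N" for m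
      using that N_iff by (intro W.A.M.add.finprod_one_eqI) (simp add: act_def)
  qed (use finite_M Fcl in \<open>auto intro!: W.A.M.finsum_closed\<close>)
  finally show ?thesis .
qed

lemma partial_action_chains: "partial_action K M W (S q) (P q) act"
proof (intro partial_action.intro partial_action_axioms.intro function_group.intro
    function_group_axioms.intro finite_monoid_algebra_axioms W.algebra_module_axioms
    W.A.M.abelian_group_axioms finite_S P_simps smult_chains)
  show "t \<in> S q" if "m \<in> carrier M" "s \<in> S q" "act m s = Some t" for m s t
    using act_eq[OF that(1,2)] map_conj_in_S[OF that(1) _ that(2)] that(3) by (auto split: if_splits)
  show "act \<one> s = Some s" if s: "s \<in> S q" for s
  proof -
    have "map (\<lambda>b. \<omega> (\<one> \<otimes> b)) s = map (\<lambda>b. b) s"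
      using S_idem[OF s] idemD(1) omega_of_idem by (intro map_cong) auto
    then show ?thesis using act_eq[OF one_closed s] above_one[OF e] S_distinct[OF s] by simp
  qed
  show "act (m \<otimes> n) s = Option.bind (act n s) (act m)"
    if "m \<in> carrier M" "n \<in> carrier M" "s \<in> S q" for m n s
    by (rule act_mult_chain[OF that])
qed

lemma projective_chains: "projective_module TYPE('a) TYPE('b) R (P q)"
proof -
  obtain v0 where v0: "v0 \<in> carrier V" and span: "\<forall>v\<in>carrier W. \<exists>x. (\<forall>g\<in>carrier H. x g \<in> carrier K) \<and>
    v = (\<Oplus>\<^bsub>W\<^esub>g\<in>carrier H. single K \<one> (x g) \<odot>\<^bsub>W\<^esub> (basis K g \<odot>\<^bsub>V\<^esub> v0))"
    using spanning_W by blast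
  interpret PA: partial_action K M W "S q" "P q" act by (rule partial_action_chains)
  have "topped_action K M W (S q) (P q) act last (carrier H) (\<lambda>g. basis K g \<odot>\<^bsub>V\<^esub> v0)"
  proof (intro topped_action.intro left_duo_algebra_axioms partial_action_chains
      topped_action_axioms.intro field_K)
    show "last s \<in> idems M" if "s \<in> S q" for s using S_last[OF that] by simp
    show "last t = \<omega> (m \<otimes> last s)" if "m \<in> carrier M" "s \<in> S q" "act m s = Some t" for m s t
    proof -
      have "s \<noteq> []" using that(2) by (auto simp: S_iff)
      then show ?thesis using act_eq[OF that(1,2)] that(3) by (auto simp: last_map split: if_splits)
    qed
    show "act (last s) s = Some s" if s: "s \<in> S q" for s
    proof -
      note l = S_last[OF s]
      have "map (\<lambda>b. \<omega> (last s \<otimes> b)) s = map (\<lambda>b. b) s"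
        using S_le_last[OF s] S_idem[OF s] omega_of_idem by (intro map_cong) auto
      then show ?thesis
        using act_eq[OF _ s, of "last s"] l idemD(1) above_idem S_distinct[OF s] by simp
    qed
    show "basis K (last s) \<odot>\<^bsub>W\<^esub> v = v" if "s \<in> S q" "v \<in> carrier W" for s v
      using trivial_W[of "last s" v] S_last[OF that(1)] that(2) Bge_iff by simp
    show "[order (max_subgroup M f)] \<cdot>\<^bsub>K\<^esub> \<one>\<^bsub>K\<^esub> \<noteq> \<zero>\<^bsub>K\<^esub>" if "f \<in> idems M" for f
      using char_ok that by (intro ring_char_not_dvd K.ring_axioms) auto
    show "finite (carrier H)" by (rule H.finite_N)
    show "basis K g \<odot>\<^bsub>V\<^esub> v0 \<in> carrier W" if "g \<in> carrier H" for g
      using VH.op_closed[OF that v0] by simp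
    show "\<exists>x. (\<forall>i\<in>carrier H. x i \<in> carrier K) \<and>
        v = (\<Oplus>\<^bsub>W\<^esub>g\<in>carrier H. single K \<one> (x g) \<odot>\<^bsub>W\<^esub> (basis K g \<odot>\<^bsub>V\<^esub> v0))"
      if "v \<in> carrier W" for v
      using span that by (rule bspec)
  qed
  then show ?thesis by (rule topped_action_projective)
qed

abbreviation D where "D q \<equiv> coeff_boundary K M X V0 q"
abbreviation \<epsilon> where "\<epsilon> \<equiv> coeff_augmentation K M X V0"

text \<open>The boundary of \<open>s \<otimes> v\<close>.\<close>

definition bdry :: "nat \<Rightarrow> 'm list \<Rightarrow> 'v \<Rightarrow> 'm list \<Rightarrow> 'v" where
  "bdry q s v = face_sum (P q) (\<lambda>x. single W x v) s"

lemma function_group_chains: "function_group W (S q) (P q)"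
  using partial_action_chains by (rule partial_action.axioms)

lemma group_P: "abelian_group (P q)"
proof -
  interpret function_group W "S q" "P q" by (rule function_group_chains)
  show ?thesis by (rule P.abelian_group_axioms)
qed

lemma face_in_S:
  assumes s: "s \<in> S (Suc q)" and i: "i < length s"
  shows "face i s \<in> S q"
proof -
  have eq: "s = take i s @ s ! i # drop (Suc i) s" using i by (rule id_take_nth_drop)
  have "set (face i s) \<subseteq> set s"
    unfolding face_def using set_take_subset[of i s] set_drop_subset[of "Suc i" s] by auto
  moreover have "sorted_wrt (\<lambda>a b. idem_le M a b \<and> a \<noteq> b) (face i s)"
  proof -
    have "sorted_wrt (\<lambda>a b. idem_le M a b \<and> a \<noteq> b) (take i s @ s ! i # drop (Suc i) s)"
      using s eq by (simp add: S_iff)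
    then show ?thesis unfolding face_def sorted_wrt_append by simp
  qed
  ultimately show ?thesis using s i by (auto simp: S_iff length_face)
qed

lemma single_in_P: "\<lbrakk>s \<in> S q; v \<in> carrier V\<rbrakk> \<Longrightarrow> single W s v \<in> carrier (P q)"
  using function_group.single_in[OF function_group_chains, of s q v] by simp

lemma bdry_closed: "\<lbrakk>s \<in> S (Suc q); v \<in> carrier V\<rbrakk> \<Longrightarrow> bdry q s v \<in> carrier (P q)"
  unfolding bdry_def by (intro abelian_group.face_sum_closed[OF group_P] single_in_P face_in_S)

lemma bdry_additive:
  assumes s: "s \<in> S (Suc q)"
  shows "additive_map W (P q) (bdry q s)"
proof -
  interpret C: function_group W "S q" "P q" by (rule function_group_chains)
  show ?thesis
    unfolding bdry_def[abs_def]
    by (rule face_sum_additive[where \<phi> = "single W", OF W.A.M.abelian_group_axioms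
      C.P.abelian_group_axioms C.additive_single[OF face_in_S[OF s]]])
qed

lemma single_W_scalar:
  assumes "k \<in> carrier K" "s \<in> S q" "v \<in> carrier V"
  shows "single W s (W.sc k v) = single K \<one> k \<odot>\<^bsub>P q\<^esub> single W s v"
proof -
  interpret C: partial_action K M W "S q" "P q" act by (rule partial_action_chains)
  show ?thesis
    using C.smult_single[OF one_closed assms(1,2), of v] C.act_one[OF assms(2)] assms(3) by simp
qed

text \<open>The images of \<open>y \<le> z \<le> w\<close> are again increasing; if the outer two agree, so do all three.\<close>

lemma conj_convex:
  assumes m: "m \<in> carrier M" and s: "s \<in> S q" "s = x @ y # z # u"
    and eq: "\<omega> (m \<otimes> y) \<in> set (map (\<lambda>b. \<omega> (m \<otimes> b)) (z # u))"
  shows "\<omega> (m \<otimes> y) = \<omega> (m \<otimes> z)"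
proof -
  obtain w where w: "w \<in> set (z # u)" "\<omega> (m \<otimes> y) = \<omega> (m \<otimes> w)" using eq by auto
  have B': "y \<in> B" "z \<in> B" "w \<in> B" using S_idem[OF s(1)] s(2) w(1) by auto
  have sorted: "sorted_wrt (\<lambda>a b. idem_le M a b \<and> a \<noteq> b) (x @ y # z # u)"
    using s by (simp add: S_iff)
  then have yz: "idem_le M y z" by (simp add: sorted_wrt_append)
  have zw: "idem_le M z w" using sorted w(1) idem_le_refl[OF B'(2)] by (auto simp: sorted_wrt_append)
  have M': "m \<otimes> y \<in> carrier M" "m \<otimes> z \<in> carrier M" using m B' idemD(1) by auto
  show ?thesis
    using idem_le_antisym[OF omega_idem[OF M'(1)] omega_idem[OF M'(2)]
      idem_le_conj[OF m B'(1,2) yz]] idem_le_conj[OF m B'(2,3) zw] w(2) by simp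
qed

lemma bdry_equivariant:
  assumes m: "m \<in> carrier M" and s: "s \<in> S (Suc q)" and v: "v \<in> carrier V"
  shows "basis K m \<odot>\<^bsub>P q\<^esub> bdry q s v =
    (case act m s of None \<Rightarrow> \<zero>\<^bsub>P q\<^esub> | Some t \<Rightarrow> bdry q t (basis K m \<odot>\<^bsub>W\<^esub> v))"
proof -
  interpret C: partial_action K M W "S q" "P q" act by (rule partial_action_chains)
  interpret m: additive_map "P q" "P q" "\<lambda>p. basis K m \<odot>\<^bsub>P q\<^esub> p"
    by (rule C.PM.additive_smult[OF basis_in[OF m]])
  let ?\<mu> = "\<lambda>b. \<omega> (m \<otimes> b)"
  let ?w = "basis K m \<odot>\<^bsub>W\<^esub> v"
  note f = face_in_S[OF s]
  have w: "?w \<in> carrier V" using W.op_closed[OF m, of v] v by simp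
  have 1: "basis K m \<odot>\<^bsub>P q\<^esub> bdry q s v = face_sum (P q) (\<lambda>x. basis K m \<odot>\<^bsub>P q\<^esub> single W x v) s"
    unfolding bdry_def by (rule m.face_sum) (rule single_in_P[OF f v])
  have face: "basis K m \<odot>\<^bsub>P q\<^esub> single W x v =
      (if above e m then if distinct (map ?\<mu> x) then single W (map ?\<mu> x) ?w else \<zero>\<^bsub>P q\<^esub> else \<zero>\<^bsub>P q\<^esub>)"
    if x: "x \<in> S q" for x
    using C.smult_single[OF m K.one_closed x, of v] v act_eq[OF m x] by auto
  show ?thesis
  proof (cases "above e m")
    case False
    have "face_sum (P q) (\<lambda>x. basis K m \<odot>\<^bsub>P q\<^esub> single W x v) s = \<zero>\<^bsub>P q\<^esub>"
      by (rule C.P.face_sum_eq_zero) (use face[OF f] False in simp)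
    then show ?thesis unfolding 1 act_eq[OF m s] using False by simp
  next
    case True
    have "face_sum (P q) (\<lambda>x. basis K m \<odot>\<^bsub>P q\<^esub> single W x v) s =
        face_sum (P q) (\<lambda>x. if distinct (map ?\<mu> x) then single W (map ?\<mu> x) ?w else \<zero>\<^bsub>P q\<^esub>) s"
      by (rule face_sum_cong) (use face[OF f] True in simp)
    also have "\<dots> = (if distinct (map ?\<mu> s) then face_sum (P q) (\<lambda>x. single W x ?w) (map ?\<mu> s) else \<zero>\<^bsub>P q\<^esub>)"
    proof (rule C.P.face_sum_map)
      show "single W (map ?\<mu> (face i s)) ?w \<in> carrier (P q)"
        if "i < length s" "distinct (map ?\<mu> (face i s))" for i
        by (rule single_in_P[OF map_conj_in_S[OF m True f[OF that(1)] that(2)] w])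
      show "?\<mu> y = ?\<mu> z" if "s = x @ y # z # u" "?\<mu> y \<in> set (map ?\<mu> (z # u))" for x y z u
        by (rule conj_convex[OF m s that])
    qed
    finally show ?thesis
      unfolding 1 act_eq[OF m s] using True
      by (cases "distinct (map ?\<mu> s)") (simp_all only: bdry_def simp_thms if_True if_False option.case)
  qed
qed

lemma bdry_scalar:
  assumes k: "k \<in> carrier K" and s: "s \<in> S (Suc q)" and v: "v \<in> carrier V"
  shows "bdry q s (W.sc k v) = single K \<one> k \<odot>\<^bsub>P q\<^esub> bdry q s v"
proof -
  interpret C: partial_action K M W "S q" "P q" act by (rule partial_action_chains)
  have kR: "single K \<one> k \<in> carrier R" using k by (simp add: KN.single_in)
  interpret k: additive_map "P q" "P q" "\<lambda>p. single K \<one> k \<odot>\<^bsub>P q\<^esub> p" by (rule C.PM.additive_smult[OF kR])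
  have "face_sum (P q) (\<lambda>x. single W x (W.sc k v)) s =
      face_sum (P q) (\<lambda>x. single K \<one> k \<odot>\<^bsub>P q\<^esub> single W x v) s"
    by (rule face_sum_cong) (rule single_W_scalar[OF k face_in_S[OF s] v])
  then show ?thesis
    unfolding bdry_def using k.face_sum[of s "\<lambda>x. single W x v", OF single_in_P[OF face_in_S[OF s] v]] by simp
qed

lemma boundary_basis:
  assumes s: "s \<in> S (Suc q)"
  shows "boundary K (idems_ge M X) (idem_le M) q (basis K s) t =
    face_sum K (\<lambda>x. if x = t then \<one>\<^bsub>K\<^esub> else \<zero>\<^bsub>K\<^esub>) s"
proof -
  have len: "length s = Suc (Suc q)" using s by (simp add: S_iff)
  let ?I = "{(c, i) \<in> S (Suc q) \<times> {..Suc q}. face i c = t}"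
  let ?g = "\<lambda>i. (\<ominus>\<^bsub>K\<^esub> \<one>\<^bsub>K\<^esub>) [^]\<^bsub>K\<^esub> (i :: nat)"
  have "boundary K (idems_ge M X) (idem_le M) q (basis K s) t =
      (\<Oplus>\<^bsub>K\<^esub>p\<in>?I. ?g (snd p) \<otimes>\<^bsub>K\<^esub> basis K s (fst p))"
    by (simp add: boundary_def simplices_ge_def)
  also have "\<dots> = (\<Oplus>\<^bsub>K\<^esub>p\<in>Pair s ` {i \<in> {..Suc q}. face i s = t}. ?g (snd p))"
  proof (rule K.add.finprod_mono_neutral_cong_right)
    show "finite ?I" using finite_S by (auto intro: finite_subset[of _ "S (Suc q) \<times> {..Suc q}"])
  qed (use s in \<open>auto simp: single_def\<close>)
  also have "\<dots> = (\<Oplus>\<^bsub>K\<^esub>i\<in>{i \<in> {..Suc q}. face i s = t}. ?g i)"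
    by (subst K.finsum_reindex) (auto simp: inj_on_def)
  also have "\<dots> = (\<Oplus>\<^bsub>K\<^esub>i\<in>{..Suc q}. if face i s = t then ?g i else \<zero>\<^bsub>K\<^esub>)"
    by (rule K.finsum_if[symmetric]) auto
  also have "\<dots> = (\<Oplus>\<^bsub>K\<^esub>i\<in>{..<length s}. ?g i \<otimes>\<^bsub>K\<^esub> (if face i s = t then \<one>\<^bsub>K\<^esub> else \<zero>\<^bsub>K\<^esub>))"
    unfolding len lessThan_Suc_atMost by (rule K.finsum_cong') auto
  also have "\<dots> = face_sum K (\<lambda>x. if x = t then \<one>\<^bsub>K\<^esub> else \<zero>\<^bsub>K\<^esub>) s"
    by (rule K.face_sum_explicit[symmetric]) simp
  finally show ?thesis .
qed

lemma bdry_val: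
  assumes s: "s \<in> S (Suc q)" and v: "v \<in> carrier V"
  shows "bdry q s v t = W.sc (boundary K (idems_ge M X) (idem_le M) q (basis K s) t) v"
proof -
  interpret C: function_group W "S q" "P q" by (rule function_group_chains)
  have vW: "v \<in> carrier W" using v by simp
  have sc: "additive_map K W (\<lambda>k. W.sc k v)"
    using W.SC.smult_l_distr[OF _ _ vW] W.sc_closed[OF _ vW] K.abelian_group_axioms W.A.M.abelian_group_axioms
    by (simp add: additive_map_def additive_map_axioms_def)
  have "W.sc (face_sum K (\<lambda>x. if x = t then \<one>\<^bsub>K\<^esub> else \<zero>\<^bsub>K\<^esub>) s) v =
      face_sum W (\<lambda>x. W.sc (if x = t then \<one>\<^bsub>K\<^esub> else \<zero>\<^bsub>K\<^esub>) v) s"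
    by (rule additive_map.face_sum[OF sc]) simp
  also have "\<dots> = face_sum W (\<lambda>x. single W x v t) s"
    using W.SC.smult_one[OF vW] W.SC.smult_l_null[OF vW] by (intro face_sum_cong) (auto simp: single_def[of W])
  also have "\<dots> = bdry q s v t"
    unfolding bdry_def
    by (rule additive_map.face_sum[OF C.additive_val, symmetric]) (rule single_in_P[OF face_in_S[OF s] v])
  finally show ?thesis unfolding boundary_basis[OF s] by simp
qed

lemma boundary_eq:
  assumes f: "f \<in> carrier (P (Suc q))"
  shows "D q f = (\<Oplus>\<^bsub>P q\<^esub>s\<in>S (Suc q). bdry q s (f s))"
proof
  fix t
  interpret C: function_group W "S q" "P q" by (rule function_group_chains)
  interpret C': function_group W "S (Suc q)" "P (Suc q)" by (rule function_group_chains)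
  have fV: "f s \<in> carrier V" for s using C'.val_closed[OF f, of s] by simp
  have bK: "boundary K (idems_ge M X) (idem_le M) q (basis K s) t \<in> carrier K" if "s \<in> S (Suc q)" for s
    unfolding boundary_basis[OF that] by (rule K.face_sum_closed) simp
  have "D q f t = (\<Oplus>\<^bsub>W\<^esub>s\<in>S (Suc q).
      boundary K (idems_ge M X) (idem_le M) q (basis K s) t \<odot>\<^bsub>scalar_module K N V0\<^esub> f s)"
    unfolding coeff_boundary_def tensor_map_def pure_tensor_def by simp
  also have "\<dots> = (\<Oplus>\<^bsub>W\<^esub>s\<in>S (Suc q). bdry q s (f s) t)"
  proof (rule W.A.M.finsum_cong')
    show "(\<lambda>s. bdry q s (f s) t) \<in> S (Suc q) \<rightarrow> carrier W"
      using C.val_closed[OF bdry_closed[OF _ fV]] by blast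
    show "boundary K (idems_ge M X) (idem_le M) q (basis K s) t \<odot>\<^bsub>scalar_module K N V0\<^esub> f s =
        bdry q s (f s) t" if "s \<in> S (Suc q)" for s
      unfolding scalar_V0[OF bK[OF that]] by (rule bdry_val[OF that fV, symmetric])
  qed simp
  also have "\<dots> = (\<Oplus>\<^bsub>P q\<^esub>s\<in>S (Suc q). bdry q s (f s)) t"
    by (rule C.finsum_val[symmetric]) (rule bdry_closed[OF _ fV])
  finally show "D q f t = (\<Oplus>\<^bsub>P q\<^esub>s\<in>S (Suc q). bdry q s (f s)) t" .
qed

lemma boundary_hom: "D q \<in> lmod_hom R (P (Suc q)) (P q)"
proof -
  interpret C: partial_action K M W "S q" "P q" act by (rule partial_action_chains)
  interpret C': partial_action K M W "S (Suc q)" "P (Suc q)" act by (rule partial_action_chains)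
  have "(\<lambda>f. \<Oplus>\<^bsub>P q\<^esub>s\<in>S (Suc q). bdry q s (f s)) \<in> lmod_hom R (P (Suc q)) (P q)"
    by (rule C'.equivariant_family_hom[OF C.left_module_P bdry_additive], assumption)
      (rule bdry_scalar bdry_equivariant; simp)+
  then show ?thesis by (rule lmod_hom_cong[OF C'.left_module_P]) (rule boundary_eq)
qed

lemma boundary_additive: "additive_map (P (Suc q)) (P q) (D q)"
  by (rule additive_mapD_lmod_hom[OF group_P group_P boundary_hom])

lemma boundary_single:
  assumes "s \<in> S (Suc q)" "v \<in> carrier V"
  shows "D q (single W s v) = face_sum (P q) (\<lambda>x. single W x v) s"
proof -
  interpret C': function_group W "S (Suc q)" "P (Suc q)" by (rule function_group_chains)
  have "v \<in> carrier W" using assms by simp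
  from C'.family_single[OF bdry_additive assms(1) this]
  show ?thesis unfolding boundary_eq[OF single_in_P[OF assms]] by (simp only: bdry_def)
qed

lemma augmentation_eq:
  assumes f: "f \<in> carrier (P 0)"
  shows "\<epsilon> f = (\<Oplus>\<^bsub>W\<^esub>s\<in>S 0. f s)"
proof -
  interpret C: function_group W "S 0" "P 0" by (rule function_group_chains)
  have aug: "augmentation K (idems_ge M X) (idem_le M) (basis K s) = \<one>\<^bsub>K\<^esub>" if s: "s \<in> S 0" for s
  proof -
    have "augmentation K (idems_ge M X) (idem_le M) (basis K s) = (\<Oplus>\<^bsub>K\<^esub>c\<in>S 0. if c = s then \<one>\<^bsub>K\<^esub> else \<zero>\<^bsub>K\<^esub>)"
      by (simp add: augmentation_def simplices_ge_def single_def)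
    then show ?thesis using K.finsum_delta[OF finite_S, where f = "\<lambda>_. \<one>\<^bsub>K\<^esub>" and x = s] s by simp
  qed
  have "\<epsilon> f = (\<Oplus>\<^bsub>W\<^esub>s\<in>S 0. augmentation K (idems_ge M X) (idem_le M) (basis K s) \<odot>\<^bsub>scalar_module K N V0\<^esub> f s)"
    unfolding coeff_augmentation_def tensor_functional_def by simp
  also have "\<dots> = (\<Oplus>\<^bsub>W\<^esub>s\<in>S 0. f s)"
  proof (rule W.A.M.finsum_cong')
    show "(\<lambda>s. f s) \<in> S 0 \<rightarrow> carrier W" using C.val_closed[OF f] by blast
    show "augmentation K (idems_ge M X) (idem_le M) (basis K s) \<odot>\<^bsub>scalar_module K N V0\<^esub> f s = f s"
      if "s \<in> S 0" for s
      unfolding aug[OF that] scalar_V0[OF K.one_closed] by (rule W.SC.smult_one[OF C.val_closed[OF f]])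
  qed simp
  finally show ?thesis .
qed

lemma augmentation_hom: "\<epsilon> \<in> lmod_hom R (P 0) W"
proof -
  interpret C: partial_action K M W "S 0" "P 0" act by (rule partial_action_chains)
  have "(\<lambda>f. \<Oplus>\<^bsub>W\<^esub>s\<in>S 0. (\<lambda>v. v) (f s)) \<in> lmod_hom R (P 0) W"
  proof (rule C.equivariant_family_hom[OF left_module_W])
    show "additive_map W W (\<lambda>v. v)"
      using W.A.M.abelian_group_axioms by (simp add: additive_map_def additive_map_axioms_def)
    fix m s v assume m: "m \<in> carrier M" and s: "s \<in> S 0" and v: "v \<in> carrier W"
    have "distinct (map (\<lambda>b. \<omega> (m \<otimes> b)) s)"
      using s by (auto simp: S_iff length_Suc_conv)
    then show "basis K m \<odot>\<^bsub>W\<^esub> v = (case act m s of None \<Rightarrow> \<zero>\<^bsub>W\<^esub> | Some t \<Rightarrow> basis K m \<odot>\<^bsub>W\<^esub> v)"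
      unfolding act_eq[OF m s] using zero_W[OF m, of v] v by (cases "above e m") auto
  qed (rule refl)
  then show ?thesis by (rule lmod_hom_cong[OF C.left_module_P]) (rule augmentation_eq)
qed

lemma augmentation_additive: "additive_map (P 0) W \<epsilon>"
  by (rule additive_mapD_lmod_hom[OF group_P W.A.M.abelian_group_axioms augmentation_hom])

lemma augmentation_single:
  assumes "s \<in> S 0" "v \<in> carrier V"
  shows "\<epsilon> (single W s v) = v"
proof -
  interpret C: function_group W "S 0" "P 0" by (rule function_group_chains)
  have v: "v \<in> carrier W" using assms by simp
  have "additive_map W W (\<lambda>v. v)"
    using W.A.M.abelian_group_axioms by (simp add: additive_map_def additive_map_axioms_def)
  from C.family_single[OF this assms(1) v]
  show ?thesis unfolding augmentation_eq[OF single_in_P[OF assms]] .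
qed

lemma boundary_boundary:
  assumes f: "f \<in> carrier (P (Suc (Suc q)))"
  shows "D q (D (Suc q) f) = \<zero>\<^bsub>P q\<^esub>"
proof -
  interpret C: function_group W "S (Suc (Suc q))" "P (Suc (Suc q))" by (rule function_group_chains)
  interpret D: additive_map "P (Suc q)" "P q" "D q" by (rule boundary_additive)
  have comp: "additive_map (P (Suc (Suc q))) (P q) (\<lambda>f. D q (D (Suc q) f))"
    by (rule additive_comp[OF boundary_additive boundary_additive])
  have zero: "additive_map (P (Suc (Suc q))) (P q) (\<lambda>_. \<zero>\<^bsub>P q\<^esub>)"
    by (rule additive_map_zero[OF group_P group_P])
  show ?thesis
  proof (rule C.additive_eqI[OF comp zero _ f])
    fix s v assume s: "s \<in> S (Suc (Suc q))" and "v \<in> carrier W"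
    then have v: "v \<in> carrier V" by simp
    note fs = face_in_S[OF s]
    have "D q (D (Suc q) (single W s v)) = D q (face_sum (P (Suc q)) (\<lambda>x. single W x v) s)"
      unfolding boundary_single[OF s v] ..
    also have "\<dots> = face_sum (P q) (\<lambda>x. D q (single W x v)) s"
      by (rule D.face_sum) (rule single_in_P[OF fs v])
    also have "\<dots> = face_sum (P q) (\<lambda>x. face_sum (P q) (\<lambda>y. single W y v) x) s"
      by (rule face_sum_cong) (rule boundary_single[OF fs v])
    also have "\<dots> = \<zero>\<^bsub>P q\<^esub>"
    proof (rule D.B.face_sum_face_sum)
      fix i j assume ij: "i < length s" "j < length s - 1"
      show "single W (face j (face i s)) v \<in> carrier (P q)"
        by (rule single_in_P[OF face_in_S[OF fs[OF ij(1)]] v]) (use ij length_face[OF ij(1)] in simp)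
    qed
    finally show "D q (D (Suc q) (single W s v)) = \<zero>\<^bsub>P q\<^esub>" .
  qed
qed

lemma S_one_cases:
  assumes s: "s \<in> S 1"
  obtains a b where "s = [a, b]" "[a] \<in> S 0" "[b] \<in> S 0"
proof -
  obtain a b where ab: "s = [a, b]" using s by (auto simp: S_iff length_Suc_conv)
  have "[b] \<in> S 0" "[a] \<in> S 0"
    using face_in_S[of s 0 0] face_in_S[of s 0 1] s ab by (simp_all add: face_def)
  then show thesis using ab that by blast
qed

lemma boundary_edge:
  assumes "[a, b] \<in> S 1" "v \<in> carrier V"
  shows "D 0 (single W [a, b] v) = single W [b] v \<ominus>\<^bsub>P 0\<^esub> single W [a] v"
proof -
  interpret G: abelian_group "P 0" by (rule group_P)
  have s: "[a, b] \<in> S (Suc 0)" using assms(1) by simp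
  have "[a] \<in> S 0" using face_in_S[OF s, of 1] by (simp add: face_def)
  then have "single W [a] v \<ominus>\<^bsub>P 0\<^esub> \<zero>\<^bsub>P 0\<^esub> = single W [a] v"
    by (intro G.diff_zero single_in_P assms(2))
  then show ?thesis unfolding boundary_single[OF s assms(2)] by (simp only: face_sum.simps)
qed

lemma augmentation_boundary:
  assumes f: "f \<in> carrier (P 1)"
  shows "\<epsilon> (D 0 f) = \<zero>\<^bsub>W\<^esub>"
proof -
  interpret C: function_group W "S 1" "P 1" by (rule function_group_chains)
  interpret \<epsilon>: additive_map "P 0" W \<epsilon> by (rule augmentation_additive)
  have D: "additive_map (P 1) (P 0) (D 0)" using boundary_additive[of 0] by simp
  have zero: "additive_map (P 1) W (\<lambda>_. \<zero>\<^bsub>W\<^esub>)"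
    by (rule additive_map_zero[OF group_P W.A.M.abelian_group_axioms])
  show ?thesis
  proof (rule C.additive_eqI[OF additive_comp[OF D augmentation_additive] zero _ f])
    fix s v assume s: "s \<in> S 1" and vW: "v \<in> carrier W"
    then have v: "v \<in> carrier V" by simp
    obtain a b where ab: "s = [a, b]" "[a] \<in> S 0" "[b] \<in> S 0" by (rule S_one_cases[OF s])
    have "\<epsilon> (D 0 (single W s v)) = \<epsilon> (single W [b] v) \<ominus>\<^bsub>W\<^esub> \<epsilon> (single W [a] v)"
      unfolding ab(1) boundary_edge[OF s[unfolded ab(1)] v]
      by (rule \<epsilon>.diff) (rule single_in_P[OF ab(3) v], rule single_in_P[OF ab(2) v])
    also have "\<dots> = \<zero>\<^bsub>W\<^esub>"
      unfolding augmentation_single[OF ab(2) v] augmentation_single[OF ab(3) v] by (rule W.A.M.diff_self[OF vW])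
    finally show "\<epsilon> (D 0 (single W s v)) = \<zero>\<^bsub>W\<^esub>" .
  qed
qed

text \<open>The poset has the greatest element \<open>\<one>\<close>, so its order complex is a cone. As \<open>\<one>\<close> is appended
  at the end of \<open>s\<close>, the face of \<open>s @ [\<one>]\<close> that omits it has the sign \<open>(-1)\<^sup>k\<close> for \<open>k = length s\<close>,
  which \<open>coned\<close> compensates.\<close>

definition coned :: "nat \<Rightarrow> 'm list \<Rightarrow> 'v \<Rightarrow> 'm list \<Rightarrow> 'v" where
  "coned q s v = (if last s = \<one> then \<zero>\<^bsub>P (Suc q)\<^esub>
    else abelian_group.signed (P (Suc q)) (length s) (single W (s @ [\<one>]) v))"

definition cone :: "nat \<Rightarrow> ('m list \<Rightarrow> 'v) \<Rightarrow> 'm list \<Rightarrow> 'v" where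
  "cone q f = (\<Oplus>\<^bsub>P (Suc q)\<^esub>s\<in>S q. coned q s (f s))"

lemma one_at_end:
  assumes s: "s \<in> S q" and "\<one> \<in> set s"
  shows "last s = \<one>"
  using S_le_last[OF assms] S_last[OF s] idemD(1) by simp

lemma append_one:
  assumes s: "s \<in> S q" and l: "last s \<noteq> \<one>"
  shows "s @ [\<one>] \<in> S (Suc q)"
  unfolding S_iff
proof (intro conjI)
  show "length (s @ [\<one>]) = Suc (Suc q)" using s by (simp add: S_iff)
  have "\<one> \<in> idems_ge M X" unfolding Bge_iff using one_idem idemD(1)[OF e] by simp
  then show "set (s @ [\<one>]) \<subseteq> idems_ge M X" using s by (auto simp: S_iff)
  have "idem_le M x \<one> \<and> x \<noteq> \<one>" if "x \<in> set s" for x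
    using one_at_end[OF s] l that S_idem[OF s that] idemD(1) by (auto simp: idem_le_def)
  then show "sorted_wrt (\<lambda>a b. idem_le M a b \<and> a \<noteq> b) (s @ [\<one>])"
    using s by (simp add: S_iff sorted_wrt_append)
qed

lemma coned_additive:
  assumes s: "s \<in> S q"
  shows "additive_map W (P (Suc q)) (coned q s)"
proof -
  interpret C: function_group W "S (Suc q)" "P (Suc q)" by (rule function_group_chains)
  show ?thesis
  proof (cases "last s = \<one>")
    case True
    have "additive_map W (P (Suc q)) (\<lambda>_. \<zero>\<^bsub>P (Suc q)\<^esub>)"
      by (rule additive_map_zero[OF W.A.M.abelian_group_axioms group_P])
    then show ?thesis unfolding coned_def[abs_def] using True by (simp only: if_True refl)
  next
    case False
    show ?thesis
      unfolding coned_def[abs_def] using False additive_comp[OF C.additive_single[OF append_one[OF s False]] C.P.signed_additive]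
      by (simp only: if_False)
  qed
qed

lemma cone_additive: "additive_map (P q) (P (Suc q)) (cone q)"
proof -
  interpret C: function_group W "S q" "P q" by (rule function_group_chains)
  show ?thesis
    unfolding cone_def[abs_def] by (rule C.additive_family[OF group_P coned_additive])
qed

lemma cone_single:
  assumes "s \<in> S q" "v \<in> carrier V"
  shows "cone q (single W s v) = coned q s v"
proof -
  interpret C: function_group W "S q" "P q" by (rule function_group_chains)
  have "v \<in> carrier W" using assms by simp
  from C.family_single[OF coned_additive assms(1) this] show ?thesis unfolding cone_def .
qed

text \<open>If \<open>s\<close> does not end in \<open>\<one>\<close>, neither does any face of \<open>s\<close>; the cones over these faces cancel and
  \<open>s\<close> remains. If \<open>s = c @ [\<one>]\<close>, all faces but \<open>c\<close> end in \<open>\<one>\<close> and have no cone, and the cone over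
  \<open>c\<close> is \<open>s\<close>.\<close>

lemma cone_homotopy:
  assumes f: "f \<in> carrier (P (Suc q))"
  shows "D (Suc q) (cone (Suc q) f) \<oplus>\<^bsub>P (Suc q)\<^esub> cone q (D q f) = f"
proof -
  interpret C: function_group W "S (Suc q)" "P (Suc q)" by (rule function_group_chains)
  interpret D: additive_map "P (Suc (Suc q))" "P (Suc q)" "D (Suc q)" by (rule boundary_additive)
  interpret H: additive_map "P q" "P (Suc q)" "cone q" by (rule cone_additive)
  have hom: "additive_map (P (Suc q)) (P (Suc q)) (\<lambda>f. D (Suc q) (cone (Suc q) f) \<oplus>\<^bsub>P (Suc q)\<^esub> cone q (D q f))"
    by (rule additive_map_add[OF additive_comp[OF cone_additive boundary_additive]
      additive_comp[OF boundary_additive cone_additive]])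
  have id: "additive_map (P (Suc q)) (P (Suc q)) (\<lambda>f. f)" by unfold_locales simp_all
  show ?thesis
  proof (rule C.additive_eqI[OF hom id _ f])
    fix s v assume s: "s \<in> S (Suc q)" and "v \<in> carrier W"
    then have v: "v \<in> carrier V" by simp
    note fs = face_in_S[OF s]
    let ?sg = "C.P.signed"
    let ?one = "\<one>"
    note ss = single_in_P[OF s v]
    show "D (Suc q) (cone (Suc q) (single W s v)) \<oplus>\<^bsub>P (Suc q)\<^esub> cone q (D q (single W s v)) = single W s v"
    proof (cases "last s = ?one")
      case False
      let ?n = "length s"
      define A where "A = face_sum (P (Suc q)) (\<lambda>x. single W (x @ [?one]) v) s"
      have no1: "?one \<notin> set s" using one_at_end[OF s] False by blast
      have ne: "length (face i s) > 0" if "i < ?n" for i using s that by (simp add: S_iff length_face)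
      have nf: "last (face i s) \<noteq> ?one" if "i < ?n" for i
      proof -
        have "last (face i s) \<in> set (face i s)" using ne[OF that] by simp
        also have "\<dots> \<subseteq> set s"
          unfolding face_def using set_take_subset[of i s] set_drop_subset[of "Suc i" s] by auto
        finally show ?thesis using no1 by auto
      qed
      have f1: "single W (face i s @ [?one]) v \<in> carrier (P (Suc q))" if "i < ?n" for i
        by (rule single_in_P[OF append_one[OF fs[OF that] nf[OF that]] v])
      have A: "A \<in> carrier (P (Suc q))" unfolding A_def by (rule C.P.face_sum_closed) (rule f1)
      note s1 = append_one[OF s False]
      have "D (Suc q) (cone (Suc q) (single W s v)) = D (Suc q) (D.A.signed ?n (single W (s @ [?one]) v))"
        unfolding cone_single[OF s v] coned_def using False by (simp only: if_False)
      also have "\<dots> = ?sg ?n (D (Suc q) (single W (s @ [?one]) v))"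
        by (rule D.signed) (rule single_in_P[OF s1 v])
      also have "D (Suc q) (single W (s @ [?one]) v) = A \<oplus>\<^bsub>P (Suc q)\<^esub> ?sg ?n (single W s v)"
        unfolding boundary_single[OF s1 v] A_def by (rule C.P.face_sum_snoc[OF ss f1])
      also have "?sg ?n (A \<oplus>\<^bsub>P (Suc q)\<^esub> ?sg ?n (single W s v)) = ?sg ?n A \<oplus>\<^bsub>P (Suc q)\<^esub> single W s v"
        using A ss by (simp add: C.P.signed_def C.P.minus_add del: inflate_simps)
      finally have 1: "D (Suc q) (cone (Suc q) (single W s v)) = ?sg ?n A \<oplus>\<^bsub>P (Suc q)\<^esub> single W s v" .
      have "cone q (D q (single W s v)) = face_sum (P (Suc q)) (\<lambda>x. cone q (single W x v)) s"
        unfolding boundary_single[OF s v] by (rule H.face_sum) (rule single_in_P[OF fs v])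
      also have "\<dots> = face_sum (P (Suc q)) (\<lambda>x. ?sg (?n - 1) (single W (x @ [?one]) v)) s"
        by (rule face_sum_cong) (simp only: cone_single[OF fs v] coned_def nf if_False length_face)
      also have "\<dots> = ?sg (?n - 1) A"
        unfolding A_def by (rule additive_map.face_sum[OF C.P.signed_additive, symmetric]) (rule f1)
      finally have 2: "cone q (D q (single W s v)) = ?sg (?n - 1) A" .
      have "?n = Suc (?n - 1)" using s by (simp add: S_iff)
      then have "?sg ?n A = \<ominus>\<^bsub>P (Suc q)\<^esub> ?sg (?n - 1) A" using C.P.signed_Suc[OF A] by metis
      then show ?thesis
        unfolding 1 2 using ss C.P.signed_closed[OF A]
        by (simp only: C.P.a_ac C.P.a_inv_closed) (simp only: C.P.r_neg C.P.r_zero)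
    next
      case True
      define c where "c = butlast s"
      have sc: "s = c @ [?one]" 
      proof -
        have "s \<noteq> []" using s by (auto simp: S_iff)
        then show ?thesis using True append_butlast_last_id[of s] by (simp add: c_def)
      qed
      have lc: "length c = Suc q" using s sc by (simp add: S_iff)
      have cS: "c \<in> S q" using fs[of "length c"] sc by (simp add: face_def)
      have "c \<noteq> []" using lc by auto
      then have "last c \<in> set c" by simp
      then have lc1: "last c \<noteq> ?one" using S_distinct[OF s] sc by auto
      have f1: "single W (face i c @ [?one]) v \<in> carrier (P q)" if "i < length c" for i
        using fs[of i] single_in_P[OF _ v] that sc by (simp add: face_def del: inflate_simps)
      note cP = single_in_P[OF cS v]
      have 1: "D (Suc q) (cone (Suc q) (single W s v)) = \<zero>\<^bsub>P (Suc q)\<^esub>"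
        unfolding cone_single[OF s v] coned_def using True by (simp only: refl if_True D.zero)
      let ?A = "face_sum (P q) (\<lambda>x. single W (x @ [?one]) v) c"
      have A: "?A \<in> carrier (P q)" by (rule H.A.face_sum_closed) (rule f1)
      have "cone q (D q (single W s v)) = cone q (?A \<oplus>\<^bsub>P q\<^esub> H.A.signed (length c) (single W c v))"
        unfolding boundary_single[OF s v] unfolding sc by (rule arg_cong[OF H.A.face_sum_snoc[OF cP f1]])
      also have "\<dots> = cone q ?A \<oplus>\<^bsub>P (Suc q)\<^esub> ?sg (length c) (cone q (single W c v))"
        by (simp only: H.add[OF A H.A.signed_closed[OF cP]] H.signed[OF cP])
      also have "cone q ?A = face_sum (P (Suc q)) (\<lambda>x. cone q (single W (x @ [?one]) v)) c"
        by (rule H.face_sum) (rule f1)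
      also have "\<dots> = \<zero>\<^bsub>P (Suc q)\<^esub>"
      proof (rule C.P.face_sum_eq_zero)
        fix i assume i: "i < length c"
        have "face i c @ [?one] \<in> S q" using fs[of i] i sc by (simp add: face_def)
        from cone_single[OF this v] show "cone q (single W (face i c @ [?one]) v) = \<zero>\<^bsub>P (Suc q)\<^esub>"
          by (simp only: coned_def last_snoc refl if_True)
      qed
      also have "cone q (single W c v) = ?sg (length c) (single W s v)"
        unfolding cone_single[OF cS v] coned_def using lc1 by (simp only: if_False sc[symmetric])
      finally have 2: "cone q (D q (single W s v)) = single W s v"
        using ss C.P.signed_signed[OF ss] by (simp only: C.P.l_zero)
      show ?thesis unfolding 1 2 using ss by (rule C.P.l_zero)
    qed
  qed
qed

lemma vertex_one: "[\<one>] \<in> S 0"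
  unfolding S_iff using one_idem idemD(1)[OF e] by (simp add: Bge_iff)

lemma cone_homotopy_0:
  assumes f: "f \<in> carrier (P 0)"
  shows "D 0 (cone 0 f) \<oplus>\<^bsub>P 0\<^esub> single W [\<one>] (\<epsilon> f) = f"
proof -
  interpret C: function_group W "S 0" "P 0" by (rule function_group_chains)
  interpret D: additive_map "P 1" "P 0" "D 0" using boundary_additive[of 0] by simp
  have H: "additive_map (P 0) (P 1) (cone 0)" using cone_additive[of 0] by simp
  have hom: "additive_map (P 0) (P 0) (\<lambda>f. D 0 (cone 0 f) \<oplus>\<^bsub>P 0\<^esub> single W [\<one>] (\<epsilon> f))"
    by (rule additive_map_add[OF additive_comp[OF H D.additive_map_axioms]
      additive_comp[OF augmentation_additive C.additive_single[OF vertex_one]]])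
  have id: "additive_map (P 0) (P 0) (\<lambda>f. f)" by unfold_locales simp_all
  show ?thesis
  proof (rule C.additive_eqI[OF hom id _ f])
    fix s v assume s: "s \<in> S 0" and "v \<in> carrier W"
    then have v: "v \<in> carrier V" by simp
    obtain a where a: "s = [a]" using s by (auto simp: S_iff length_Suc_conv)
    note ss = single_in_P[OF s v] and s1 = single_in_P[OF vertex_one v]
    show "D 0 (cone 0 (single W s v)) \<oplus>\<^bsub>P 0\<^esub> single W [\<one>] (\<epsilon> (single W s v)) = single W s v"
      unfolding augmentation_single[OF s v]
    proof (cases "a = \<one>")
      case True
      have "D 0 (cone 0 (single W s v)) = \<zero>\<^bsub>P 0\<^esub>"
        unfolding cone_single[OF s v] coned_def using True a D.zero by simp
      then show "D 0 (cone 0 (single W s v)) \<oplus>\<^bsub>P 0\<^esub> single W [\<one>] v = single W s v"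
        using s1 True a by (simp only: C.P.l_zero)
    next
      case False
      then have l: "last s \<noteq> \<one>" using a by simp
      have e1: "[a, \<one>] \<in> S 1" using append_one[OF s l] a by simp
      have "cone 0 (single W s v) = \<ominus>\<^bsub>P 1\<^esub> single W [a, \<one>] v"
        unfolding cone_single[OF s v] coned_def using False a D.A.signed_def
        by (simp del: inflate_simps)
      then have "D 0 (cone 0 (single W s v)) = \<ominus>\<^bsub>P 0\<^esub> (single W [\<one>] v \<ominus>\<^bsub>P 0\<^esub> single W s v)"
        using D.minus[OF single_in_P[OF e1 v]] boundary_edge[OF e1 v] a by (simp del: inflate_simps)
      also have "\<dots> = single W s v \<oplus>\<^bsub>P 0\<^esub> (\<ominus>\<^bsub>P 0\<^esub> single W [\<one>] v)"
        using ss s1 by (simp only: C.P.minus_eq C.P.minus_add C.P.a_inv_closed C.P.minus_minus C.P.a_comm)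
      finally show "D 0 (cone 0 (single W s v)) \<oplus>\<^bsub>P 0\<^esub> single W [\<one>] v = single W s v"
        using ss s1 by (simp only: C.P.a_assoc C.P.a_inv_closed C.P.l_neg C.P.r_zero)
    qed
  qed
qed

lemma projective_resolution_chains:
  "projective_resolution TYPE('a) TYPE('b) R P D \<epsilon> W"
  unfolding projective_resolution_def
proof (intro conjI allI left_module_W projective_chains boundary_hom augmentation_hom equalityI subsetI)
  fix q y assume "y \<in> D (Suc q) ` carrier (P (Suc (Suc q)))"
  then obtain f where f: "f \<in> carrier (P (Suc (Suc q)))" "y = D (Suc q) f" by blast
  show "y \<in> {x \<in> carrier (P (Suc q)). D q x = \<zero>\<^bsub>P q\<^esub>}"
    unfolding f(2) mem_Collect_eq
    by (intro conjI additive_map.closed[OF boundary_additive f(1)] boundary_boundary[OF f(1)])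
next
  fix q x assume "x \<in> {x \<in> carrier (P (Suc q)). D q x = \<zero>\<^bsub>P q\<^esub>}"
  then have x: "x \<in> carrier (P (Suc q))" "D q x = \<zero>\<^bsub>P q\<^esub>" by (simp_all only: mem_Collect_eq)
  interpret G: abelian_group "P (Suc q)" by (rule group_P)
  have H: "cone (Suc q) x \<in> carrier (P (Suc (Suc q)))" by (rule additive_map.closed[OF cone_additive x(1)])
  have "D (Suc q) (cone (Suc q) x) \<oplus>\<^bsub>P (Suc q)\<^esub> \<zero>\<^bsub>P (Suc q)\<^esub> = x"
    using cone_homotopy[OF x(1)] x(2) additive_map.zero[OF cone_additive] by (simp only:)
  then have "D (Suc q) (cone (Suc q) x) = x"
    using additive_map.closed[OF boundary_additive H] by (simp only: G.r_zero)
  then show "x \<in> D (Suc q) ` carrier (P (Suc (Suc q)))" using H by (rule image_eqI[OF sym])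
next
  fix y assume "y \<in> D 0 ` carrier (P 1)"
  then obtain f where f: "f \<in> carrier (P 1)" "y = D 0 f" by blast
  then have "f \<in> carrier (P (Suc 0))" by (simp only: One_nat_def)
  then show "y \<in> {x \<in> carrier (P 0). \<epsilon> x = \<zero>\<^bsub>W\<^esub>}"
    unfolding f(2) mem_Collect_eq
    by (intro conjI additive_map.closed[OF boundary_additive] augmentation_boundary[OF f(1)])
next
  fix x assume "x \<in> {x \<in> carrier (P 0). \<epsilon> x = \<zero>\<^bsub>W\<^esub>}"
  then have x: "x \<in> carrier (P 0)" "\<epsilon> x = \<zero>\<^bsub>W\<^esub>" by (simp_all only: mem_Collect_eq)
  interpret C: function_group W "S 0" "P 0" by (rule function_group_chains)
  have H: "cone 0 x \<in> carrier (P (Suc 0))" by (rule additive_map.closed[OF cone_additive x(1)])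
  have "D 0 (cone 0 x) \<oplus>\<^bsub>P 0\<^esub> \<zero>\<^bsub>P 0\<^esub> = x"
    using cone_homotopy_0[OF x(1)] x(2) additive_map.zero[OF C.additive_single[OF vertex_one]] by (simp only:)
  then have "D 0 (cone 0 x) = x"
    using additive_map.closed[OF boundary_additive H] by (simp only: C.P.r_zero)
  then show "x \<in> D 0 ` carrier (P 1)" using H unfolding One_nat_def by (rule image_eqI[OF sym])
next
  fix y assume "y \<in> \<epsilon> ` carrier (P 0)"
  then obtain f where f: "f \<in> carrier (P 0)" "y = \<epsilon> f" by blast
  show "y \<in> carrier W" unfolding f(2) by (rule additive_map.closed[OF augmentation_additive f(1)])
next
  fix v assume "v \<in> carrier W"
  then have v: "v \<in> carrier V" by simp
  show "v \<in> \<epsilon> ` carrier (P 0)"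
    by (rule image_eqI[where f = \<epsilon> and x = "single W [\<one>] v", OF _ single_in_P[OF vertex_one v]])
      (rule augmentation_single[OF vertex_one v, symmetric])
qed

end

theorem theorem4p2:
  fixes M :: "('m, 'x) monoid_scheme"
    and K :: "('k, 'y) ring_scheme"
    and V :: "('m \<Rightarrow> 'k, 'v) module"
    and X :: "'m set"
    and e :: 'm
  assumes "monoid M" and "finite (carrier M)" and "regular_monoid M" and "left_duo M"
    and "field K"
    and "\<forall>f \<in> idems M. \<not> ring_char K dvd order (max_subgroup M f)"
    and "X \<in> support_lattice M"
    and "e \<in> idems M" and "idems M #>\<^bsub>M\<^esub> e = X"
    and "simple_module (monoid_algebra K (max_subgroup M e)) V"
  shows "projective_resolution TYPE('a) TYPE('b) (monoid_algebra K M)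
           (\<lambda>q. inflate (rho K M X) (coeff_chain_module K M X (module_ge K M X e V) q))
           (coeff_boundary K M X (module_ge K M X e V))
           (coeff_augmentation K M X (module_ge K M X e V))
           (inflate (rho K M X) (module_ge K M X e V))"
proof -
  interpret monoid M by fact
  interpret K: field K by fact
  interpret simple_chains K M e V
    using assms by unfold_locales auto
  show ?thesis using projective_resolution_chains unfolding assms(9) .
qed

end
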